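(* For $i=1,2$ let $G_i$ be a finite group, $V_i\neq 0$ a finite-dimensional complex representation of $G_i$, $u_i\in G_i$ a central element of order $2$ acting by $-1$ on $V_i$, and $B_i\in S^2V_i$; put $A_i=A(G_i,V_i,u_i,B_i)$. Then $A_1$ and $A_2$ are isomorphic as Hopf algebras if and only if there exist a group isomorphism $\phi:G_1\to G_2$ with $\phi(u_1)=u_2$ and an isomorphism of $G_1$-representations $\eta:V_1\to\phi^*(V_2)$ such that $(\eta\otimes\eta)(B_1)-B_2\in (S^2V_2)^{G_2}$.
   Context: The ground field is $\mathbb{C}$. $S^2V$ denotes the space of symmetric tensors in $V\otimes V$. $\phi^*(V_2)$ is the space $V_2$ with $g\in G_1$ acting as $\phi(g)$. Definition of $A(G,V,u,B)$. Let $G$ be a finite group, $V$ a finite-dimensional complex representation of $G$, $u\in G$ a central element of order $2$ with $u|_V=-1$, and $B\in S^2V$. Let $\mathbb{C}[G\ltimes V]:=\mathbb{C}[G]\ltimes\Lambda V$ be the Hopf superalgebra generated by $G$ (even) and $V$ (odd), with $gvg^{-1}=g\cdot v$, $vw=-wv$, $\Delta(g)=g\otimes g$, $\Delta(v)=v\otimes1+1\otimes v$, $\varepsilon(g)=1$, $\varepsilon(v)=0$ (tensor products of superalgebras have the super multiplication). Let $J:=e^B\in\Lambda V\otimes\Lambda V\subset\mathbb{C}[G\ltimes V]^{\otimes2}$. The twisted Hopf superalgebra $\mathbb{C}[G\ltimes V]^J$ has the same multiplication and counit, and coproduct $\Delta^J(x)=J^{-1}\Delta(x)J$. For $x$ homogeneous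 of parity $p(x)$ write $\Delta^J(x)=\Delta^J_0(x)+\Delta^J_1(x)$, where the second tensor factor of $\Delta^J_0(x)$ is even and that of $\Delta_1^J(x)$ is odd. Then $A(G,V,u,B)$ is the ordinary Hopf algebra which, as an algebra with counit, is $\mathbb{C}[G]\ltimes\Lambda V$ (grading forgotten), with coproduct $\widetilde{\Delta^J}(x)=\Delta^J_0(x)-(-1)^{p(x)}(u\otimes1)\Delta^J_1(x)$. *)

theory Defs
  imports "HOL-Algebra.Multiplicative_Group" "HOL-Library.Function_Algebras"
begin

section \<open>Tensor products of spaces of functions\<close>

text \<open>
  All vector spaces built below are spaces of complex-valued functions.
  For \<open>E \<subseteq> \<complex>\<^sup>X\<close> and \<open>F \<subseteq> \<complex>\<^sup>Y\<close> the canonical map from \<open>E \<otimes> F\<close> to the functions on \<open>X \<times> Y\<close>,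
  sending \<open>a \<otimes> b\<close> to \<open>(x, y) \<mapsto> a x * b y\<close>, is injective, so \<open>E \<otimes> F\<close> is the span of
  these products.
\<close>

definition fscale :: "complex \<Rightarrow> ('x \<Rightarrow> complex) \<Rightarrow> 'x \<Rightarrow> complex" where
  "fscale c a = (\<lambda>x. c * a x)"

interpretation fspace: vector_space fscale
  by standard (auto simp: fscale_def fun_eq_iff algebra_simps)

definition pure_tensor :: "('x \<Rightarrow> complex) \<Rightarrow> ('y \<Rightarrow> complex) \<Rightarrow> 'x \<times> 'y \<Rightarrow> complex" where
  "pure_tensor a b = (\<lambda>(x, y). a x * b y)"

definition tensor_space ::
    "('x \<Rightarrow> complex) set \<Rightarrow> ('y \<Rightarrow> complex) set \<Rightarrow> ('x \<times> 'y \<Rightarrow> complex) set" where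
  "tensor_space E F = fspace.span {pure_tensor a b | a b. a \<in> E \<and> b \<in> F}"

text \<open>
  \<open>f \<otimes> g\<close> for linear maps \<open>f\<close> on \<open>E\<close> and \<open>g\<close> on \<open>F\<close>: apply \<open>g\<close> in the second variable, then
  \<open>f\<close> in the first (see \<open>tensor_map_pure_tensor\<close> and \<open>tensor_map_linear\<close> below).
\<close>

definition tensor_map ::
    "(('x \<Rightarrow> complex) \<Rightarrow> 'x' \<Rightarrow> complex) \<Rightarrow> (('y \<Rightarrow> complex) \<Rightarrow> 'y' \<Rightarrow> complex)
      \<Rightarrow> ('x \<times> 'y \<Rightarrow> complex) \<Rightarrow> 'x' \<times> 'y' \<Rightarrow> complex" where
  "tensor_map f g t = (\<lambda>(x', y'). f (\<lambda>x. g (\<lambda>y. t (x, y)) y') x')"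

definition linear_map_on ::
    "('x \<Rightarrow> complex) set \<Rightarrow> (('x \<Rightarrow> complex) \<Rightarrow> 'y \<Rightarrow> complex) \<Rightarrow> bool" where
  "linear_map_on E f \<longleftrightarrow>
     (\<forall>a\<in>E. \<forall>b\<in>E. f (a + b) = f a + f b) \<and> (\<forall>c. \<forall>a\<in>E. f (fscale c a) = fscale c (f a))"

text \<open>
  A multiplication is given as a linear map \<open>\<mu> : A \<otimes> A \<rightarrow> A\<close>. If functions supported on
  \<open>{x. even (p x)}\<close> are the even and those supported on \<open>{x. odd (p x)}\<close> the odd elements of \<open>A\<close>,
  the super multiplication on \<open>A \<otimes> A\<close> is \<open>(\<mu> \<otimes> \<mu>) (id \<otimes> \<tau> \<otimes> id)\<close> with \<open>\<tau>\<close> the super flip, i.e.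
  \<open>(a \<otimes> b) (c \<otimes> d) = (-1) ^ (|b| |c|) ac \<otimes> bd\<close>; see \<open>super_tensor_mult_pure_tensor\<close> below.
\<close>

definition super_tensor_mult ::
    "(('x \<times> 'x \<Rightarrow> complex) \<Rightarrow> 'x \<Rightarrow> complex) \<Rightarrow> ('x \<Rightarrow> nat)
      \<Rightarrow> ('x \<times> 'x \<Rightarrow> complex) \<Rightarrow> ('x \<times> 'x \<Rightarrow> complex) \<Rightarrow> 'x \<times> 'x \<Rightarrow> complex" where
  "super_tensor_mult \<mu> p t t' = (\<lambda>(x, y).
     \<mu> (\<lambda>(x1, x2). \<mu> (\<lambda>(y1, y2). (-1) ^ (p y1 * p x2) * t (x1, y1) * t' (x2, y2)) y) x)"

definition parity_part :: "('x \<Rightarrow> nat) \<Rightarrow> nat \<Rightarrow> ('x \<Rightarrow> complex) \<Rightarrow> 'x \<Rightarrow> complex" where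
  "parity_part p k a = (\<lambda>x. if p x mod 2 = k then a x else 0)"

definition exp_series :: "('x \<Rightarrow> complex) monoid \<Rightarrow> ('x \<Rightarrow> complex) \<Rightarrow> 'x \<Rightarrow> complex" where
  "exp_series T b = (\<lambda>x. \<Sum>n::nat. (b [^]\<^bsub>T\<^esub> n) x / fact n)"


section \<open>Representations\<close>

locale finite_group_rep = group G + vector_space scale
  for G (structure) and scale :: "complex \<Rightarrow> 'v::ab_group_add \<Rightarrow> 'v" +
  fixes \<rho> :: "'a \<Rightarrow> 'v \<Rightarrow> 'v"
  assumes finite_carrier: "finite (carrier G)"
    and finite_dim: "\<exists>Basis. finite_dimensional_vector_space scale Basis"
    and rep_linear: "g \<in> carrier G \<Longrightarrow> Vector_Spaces.linear scale scale (\<rho> g)"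
    and rep_one: "\<rho> \<one> v = v"
    and rep_mult: "g \<in> carrier G \<Longrightarrow> h \<in> carrier G \<Longrightarrow> \<rho> (g \<otimes> h) v = \<rho> g (\<rho> h v)"

definition dual_space :: "(complex \<Rightarrow> 'v::ab_group_add \<Rightarrow> 'v) \<Rightarrow> ('v \<Rightarrow> complex) set" where
  "dual_space scale = {f. Vector_Spaces.linear scale (*) f}"

text \<open>A vector regarded as a function on the dual space (and extended by 0).\<close>

definition vec :: "(complex \<Rightarrow> 'v::ab_group_add \<Rightarrow> 'v) \<Rightarrow> 'v \<Rightarrow> ('v \<Rightarrow> complex) \<Rightarrow> complex" where
  "vec scale v = (\<lambda>f. if f \<in> dual_space scale then f v else 0)"

text \<open>The linear map \<open>\<eta> : V \<rightarrow> W\<close>, with \<open>scale\<close> the scaling of \<open>W\<close>, on vectors regarded as functions;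
  see \<open>vec_map_vec\<close> below.\<close>

definition vec_map ::
    "(complex \<Rightarrow> 'w::ab_group_add \<Rightarrow> 'w) \<Rightarrow> ('v \<Rightarrow> 'w)
      \<Rightarrow> (('v \<Rightarrow> complex) \<Rightarrow> complex) \<Rightarrow> ('w \<Rightarrow> complex) \<Rightarrow> complex" where
  "vec_map scale \<eta> a = (\<lambda>f. if f \<in> dual_space scale then a (f \<circ> \<eta>) else 0)"

definition sym_square ::
    "(complex \<Rightarrow> 'v::ab_group_add \<Rightarrow> 'v) \<Rightarrow> (('v \<Rightarrow> complex) \<times> ('v \<Rightarrow> complex) \<Rightarrow> complex) set" where
  "sym_square scale =
     {B \<in> tensor_space (range (vec scale)) (range (vec scale)). \<forall>f f'. B (f', f) = B (f, f')}"

definition sym_square_invariants ::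
    "('g, 'm) monoid_scheme \<Rightarrow> (complex \<Rightarrow> 'v::ab_group_add \<Rightarrow> 'v) \<Rightarrow> ('g \<Rightarrow> 'v \<Rightarrow> 'v)
      \<Rightarrow> (('v \<Rightarrow> complex) \<times> ('v \<Rightarrow> complex) \<Rightarrow> complex) set" where
  "sym_square_invariants G scale \<rho> =
     {B \<in> sym_square scale.
        \<forall>g\<in>carrier G. tensor_map (vec_map scale (\<rho> g)) (vec_map scale (\<rho> g)) B = B}"

definition rep_iso ::
    "('g, 'm) monoid_scheme \<Rightarrow> (complex \<Rightarrow> 'v::ab_group_add \<Rightarrow> 'v) \<Rightarrow> ('g \<Rightarrow> 'v \<Rightarrow> 'v)
      \<Rightarrow> (complex \<Rightarrow> 'w::ab_group_add \<Rightarrow> 'w) \<Rightarrow> ('g \<Rightarrow> 'w \<Rightarrow> 'w) \<Rightarrow> ('v \<Rightarrow> 'w) \<Rightarrow> bool" where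
  "rep_iso G scale \<rho> scale' \<rho>' \<eta> \<longleftrightarrow>
     Vector_Spaces.linear scale scale' \<eta> \<and> bij \<eta> \<and>
     (\<forall>g\<in>carrier G. \<forall>v. \<eta> (\<rho> g v) = \<rho>' g (\<eta> v))"


section \<open>The exterior algebra\<close>

text \<open>
  \<open>\<Lambda>V\<close> is realised by functions on lists of functionals: \<open>v\<^sub>1 \<and> \<dots> \<and> v\<^sub>k\<close> is the function that
  is \<open>det (f\<^sub>i v\<^sub>j)\<close> at a list \<open>[f\<^sub>1, \<dots>, f\<^sub>k]\<close> of \<open>k\<close> elements of \<open>V\<^sup>*\<close> and zero at all
  other lists. The product is the signed shuffle product: \<open>\<alpha> \<and> \<beta>\<close> at \<open>fs\<close> is the sum of
  \<open>\<plusminus> \<alpha> l * \<beta> m\<close> over all ways of splitting \<open>fs\<close> into complementary subsequences \<open>l\<close> and \<open>m\<close>,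
  with the sign of the permutation from \<open>fs\<close> to \<open>l @ m\<close>.
\<close>

fun shuffle :: "('f list \<times> 'f list \<Rightarrow> complex) \<Rightarrow> 'f list \<Rightarrow> complex" where
  "shuffle t [] = t ([], [])"
| "shuffle t (f # fs) =
     shuffle (\<lambda>(l, m). t (f # l, m)) fs + shuffle (\<lambda>(l, m). (-1) ^ length l * t (l, f # m)) fs"

definition ext_mult :: "('f list \<Rightarrow> complex) \<Rightarrow> ('f list \<Rightarrow> complex) \<Rightarrow> 'f list \<Rightarrow> complex" where
  "ext_mult a b = shuffle (pure_tensor a b)"

definition ext_one :: "'f list \<Rightarrow> complex" where
  "ext_one = (\<lambda>l. if l = [] then 1 else 0)"

definition ext_embed :: "('f \<Rightarrow> complex) \<Rightarrow> 'f list \<Rightarrow> complex" where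
  "ext_embed a = (\<lambda>l. case l of [f] \<Rightarrow> a f | _ \<Rightarrow> 0)"

definition wedge :: "(complex \<Rightarrow> 'v::ab_group_add \<Rightarrow> 'v) \<Rightarrow> 'v list \<Rightarrow> ('v \<Rightarrow> complex) list \<Rightarrow> complex"
  where "wedge scale vs = foldr (\<lambda>v. ext_mult (ext_embed (vec scale v))) vs ext_one"

definition exterior ::
    "(complex \<Rightarrow> 'v::ab_group_add \<Rightarrow> 'v) \<Rightarrow> (('v \<Rightarrow> complex) list \<Rightarrow> complex) set" where
  "exterior scale = fspace.span (range (wedge scale))"


section \<open>The Hopf superalgebra \<open>\<complex>[G \<ltimes> V]\<close>\<close>

text \<open>
  The element \<open>\<Sum>\<^sub>g \<omega>\<^sub>g g\<close> of \<open>\<complex>[G] \<ltimes> \<Lambda>V\<close> is the function \<open>(g, fs) \<mapsto> \<omega>\<^sub>g fs\<close>. Since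
  \<open>(\<omega> g) (\<omega>' h) = (\<omega> \<and> g \<cdot> \<omega>') (g h)\<close> and \<open>(g \<cdot> \<omega>') [f\<^sub>1, \<dots>] = \<omega>' [f\<^sub>1 \<circ> \<rho> g, \<dots>]\<close>, the
  multiplication map is \<open>smash_mu\<close>. The defining relations are \<open>smash_group_mult\<close>,
  \<open>smash_vec_anticomm\<close> and \<open>smash_conj\<close> below.
\<close>

type_synonym ('g, 'v) smash = "'g \<times> ('v \<Rightarrow> complex) list \<Rightarrow> complex"
type_synonym ('g, 'v) smash2 =
  "('g \<times> ('v \<Rightarrow> complex) list) \<times> ('g \<times> ('v \<Rightarrow> complex) list) \<Rightarrow> complex"

definition at_group :: "'g \<Rightarrow> (('v \<Rightarrow> complex) list \<Rightarrow> complex) \<Rightarrow> ('g, 'v) smash" where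
  "at_group g \<omega> = (\<lambda>(h, l). if h = g then \<omega> l else 0)"

definition smash_group_elem :: "'g \<Rightarrow> ('g, 'v) smash" where
  "smash_group_elem g = at_group g ext_one"

definition smash_embed ::
    "('g, 'm) monoid_scheme \<Rightarrow> (('v \<Rightarrow> complex) \<Rightarrow> complex) \<Rightarrow> ('g, 'v) smash" where
  "smash_embed G a = at_group \<one>\<^bsub>G\<^esub> (ext_embed a)"

definition smash_carrier ::
    "('g, 'm) monoid_scheme \<Rightarrow> (complex \<Rightarrow> 'v::ab_group_add \<Rightarrow> 'v) \<Rightarrow> ('g, 'v) smash set" where
  "smash_carrier G scale =
     {a. (\<forall>g\<in>carrier G. (\<lambda>l. a (g, l)) \<in> exterior scale) \<and> (\<forall>g l. g \<notin> carrier G \<longrightarrow> a (g, l) = 0)}"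

definition smash_mu ::
    "('g, 'm) monoid_scheme \<Rightarrow> ('g \<Rightarrow> 'v \<Rightarrow> 'v) \<Rightarrow> ('g, 'v) smash2 \<Rightarrow> ('g, 'v) smash" where
  "smash_mu G \<rho> t = (\<lambda>(k, fs). if k \<in> carrier G then
     (\<Sum>g\<in>carrier G. shuffle (\<lambda>(l, m). t ((g, l), (inv\<^bsub>G\<^esub> g \<otimes>\<^bsub>G\<^esub> k, map (\<lambda>f. f \<circ> \<rho> g) m))) fs) else 0)"

definition smash_parity :: "'g \<times> ('v \<Rightarrow> complex) list \<Rightarrow> nat" where
  "smash_parity = (\<lambda>(g, l). length l)"

definition smash_algebra ::
    "('g, 'm) monoid_scheme \<Rightarrow> (complex \<Rightarrow> 'v::ab_group_add \<Rightarrow> 'v) \<Rightarrow> ('g \<Rightarrow> 'v \<Rightarrow> 'v)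
      \<Rightarrow> ('g, 'v) smash monoid" where
  "smash_algebra G scale \<rho> =
     \<lparr>carrier = smash_carrier G scale,
      mult = (\<lambda>a b. smash_mu G \<rho> (pure_tensor a b)),
      one = smash_group_elem \<one>\<^bsub>G\<^esub>\<rparr>"

definition smash_tensor ::
    "('g, 'm) monoid_scheme \<Rightarrow> (complex \<Rightarrow> 'v::ab_group_add \<Rightarrow> 'v) \<Rightarrow> ('g \<Rightarrow> 'v \<Rightarrow> 'v)
      \<Rightarrow> ('g, 'v) smash2 monoid" where
  "smash_tensor G scale \<rho> =
     \<lparr>carrier = tensor_space (smash_carrier G scale) (smash_carrier G scale),
      mult = super_tensor_mult (smash_mu G \<rho>) smash_parity,
      one = pure_tensor (smash_group_elem \<one>\<^bsub>G\<^esub>) (smash_group_elem \<one>\<^bsub>G\<^esub>)\<rparr>"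

text \<open>
  The coproduct is the algebra homomorphism with the prescribed values on generators; existence
  and uniqueness (on the carrier) are \<open>is_smash_comult_formula\<close> and \<open>smash_comult_eq\<close> below.
\<close>

definition is_smash_comult ::
    "('g, 'm) monoid_scheme \<Rightarrow> (complex \<Rightarrow> 'v::ab_group_add \<Rightarrow> 'v) \<Rightarrow> ('g \<Rightarrow> 'v \<Rightarrow> 'v)
      \<Rightarrow> (('g, 'v) smash \<Rightarrow> ('g, 'v) smash2) \<Rightarrow> bool" where
  "is_smash_comult G scale \<rho> D \<longleftrightarrow>
     linear_map_on (smash_carrier G scale) D \<and>
     D \<in> hom (smash_algebra G scale \<rho>) (smash_tensor G scale \<rho>) \<and>
     (\<forall>g\<in>carrier G. D (smash_group_elem g) = pure_tensor (smash_group_elem g) (smash_group_elem g)) \<and>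
     (\<forall>v. let x = smash_embed G (vec scale v); e = smash_group_elem \<one>\<^bsub>G\<^esub> in
        D x = pure_tensor x e + pure_tensor e x)"

definition smash_comult ::
    "('g, 'm) monoid_scheme \<Rightarrow> (complex \<Rightarrow> 'v::ab_group_add \<Rightarrow> 'v) \<Rightarrow> ('g \<Rightarrow> 'v \<Rightarrow> 'v)
      \<Rightarrow> ('g, 'v) smash \<Rightarrow> ('g, 'v) smash2" where
  "smash_comult G scale \<rho> = (SOME D. is_smash_comult G scale \<rho> D)"

text \<open>
  The algebra homomorphism with values 1 at group elements and 0 at vectors; see
  \<open>smash_counit_mult\<close>, \<open>smash_counit_group_elem\<close> and \<open>smash_counit_vec\<close> below.
\<close>

definition smash_counit :: "('g, 'm) monoid_scheme \<Rightarrow> ('g, 'v) smash \<Rightarrow> complex" where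
  "smash_counit G a = (\<Sum>g\<in>carrier G. a (g, []))"


section \<open>The Hopf algebra \<open>A(G, V, u, B)\<close>\<close>

definition twist ::
    "('g, 'm) monoid_scheme \<Rightarrow> (complex \<Rightarrow> 'v::ab_group_add \<Rightarrow> 'v) \<Rightarrow> ('g \<Rightarrow> 'v \<Rightarrow> 'v)
      \<Rightarrow> (('v \<Rightarrow> complex) \<times> ('v \<Rightarrow> complex) \<Rightarrow> complex) \<Rightarrow> ('g, 'v) smash2" where
  "twist G scale \<rho> B =
     exp_series (smash_tensor G scale \<rho>) (tensor_map (smash_embed G) (smash_embed G) B)"

definition twisted_comult ::
    "('g, 'm) monoid_scheme \<Rightarrow> (complex \<Rightarrow> 'v::ab_group_add \<Rightarrow> 'v) \<Rightarrow> ('g \<Rightarrow> 'v \<Rightarrow> 'v)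
      \<Rightarrow> (('v \<Rightarrow> complex) \<times> ('v \<Rightarrow> complex) \<Rightarrow> complex) \<Rightarrow> ('g, 'v) smash \<Rightarrow> ('g, 'v) smash2" where
  "twisted_comult G scale \<rho> B x =
     (let T = smash_tensor G scale \<rho>; J = twist G scale \<rho> B
      in inv\<^bsub>T\<^esub> J \<otimes>\<^bsub>T\<^esub> smash_comult G scale \<rho> x \<otimes>\<^bsub>T\<^esub> J)"

text \<open>Sum over the parities \<open>k\<close> of \<open>\<Delta>\<^sup>J\<^sub>0(x\<^sub>k) - (-1)\<^sup>k (u \<otimes> 1) \<Delta>\<^sup>J\<^sub>1(x\<^sub>k)\<close>, where \<open>x = x\<^sub>0 + x\<^sub>1\<close>.\<close>

definition bosonised_comult ::
    "('g, 'm) monoid_scheme \<Rightarrow> (complex \<Rightarrow> 'v::ab_group_add \<Rightarrow> 'v) \<Rightarrow> ('g \<Rightarrow> 'v \<Rightarrow> 'v) \<Rightarrow> 'g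
      \<Rightarrow> (('v \<Rightarrow> complex) \<times> ('v \<Rightarrow> complex) \<Rightarrow> complex) \<Rightarrow> ('g, 'v) smash \<Rightarrow> ('g, 'v) smash2" where
  "bosonised_comult G scale \<rho> u B x =
     (\<Sum>k\<in>{0, 1}.
        let y = twisted_comult G scale \<rho> B (parity_part smash_parity k x);
            p = (\<lambda>(_, z). smash_parity z)
        in parity_part p 0 y -
           fscale ((-1) ^ k)
             (pure_tensor (smash_group_elem u) (smash_group_elem \<one>\<^bsub>G\<^esub>)
                \<otimes>\<^bsub>smash_tensor G scale \<rho>\<^esub> parity_part p 1 y))"

record 'x hopf_algebra = "('x \<Rightarrow> complex) monoid" +
  comult :: "('x \<Rightarrow> complex) \<Rightarrow> 'x \<times> 'x \<Rightarrow> complex"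
  counit :: "('x \<Rightarrow> complex) \<Rightarrow> complex"

definition hopf_A ::
    "('g, 'm) monoid_scheme \<Rightarrow> (complex \<Rightarrow> 'v::ab_group_add \<Rightarrow> 'v) \<Rightarrow> ('g \<Rightarrow> 'v \<Rightarrow> 'v) \<Rightarrow> 'g
      \<Rightarrow> (('v \<Rightarrow> complex) \<times> ('v \<Rightarrow> complex) \<Rightarrow> complex)
      \<Rightarrow> ('g \<times> ('v \<Rightarrow> complex) list) hopf_algebra" where
  "hopf_A G scale \<rho> u B =
     monoid.extend (smash_algebra G scale \<rho>)
       \<lparr>comult = bosonised_comult G scale \<rho> u B, counit = smash_counit G\<rparr>"

text \<open>Isomorphisms of Hopf algebras automatically preserve antipodes, so these are not recorded.\<close>

definition hopf_iso ::
    "'x hopf_algebra \<Rightarrow> 'y hopf_algebra \<Rightarrow> (('x \<Rightarrow> complex) \<Rightarrow> 'y \<Rightarrow> complex) \<Rightarrow> bool" where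
  "hopf_iso A A' F \<longleftrightarrow>
     linear_map_on (carrier A) F \<and> F \<in> iso A A' \<and> F \<one>\<^bsub>A\<^esub> = \<one>\<^bsub>A'\<^esub> \<and>
     (\<forall>a\<in>carrier A. comult A' (F a) = tensor_map F F (comult A a) \<and> counit A' (F a) = counit A a)"


section \<open>Consistency of the constructions\<close>

subsection \<open>Tensor products and vectors\<close>

lemma fscale_apply [simp]: "fscale c a x = c * a x"
  by (simp add: fscale_def)

lemma pure_tensor_apply [simp]: "pure_tensor a b (x, y) = a x * b y"
  by (simp add: pure_tensor_def)

lemma subspace_tensor_space: "fspace.subspace (tensor_space E F)"
  unfolding tensor_space_def by (rule fspace.subspace_span)

lemma pure_tensor_mem: "a \<in> E \<Longrightarrow> b \<in> F \<Longrightarrow> pure_tensor a b \<in> tensor_space E F"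
  unfolding tensor_space_def by (rule fspace.span_base) blast

lemma fun_sum_apply: "(\<Sum>i\<in>I. f i) x = (\<Sum>i\<in>I. (f i x :: complex))"
  by (induction I rule: infinite_finite_induct) auto

lemma tensor_map_pure_tensor:
  assumes "linear_map_on E f" "linear_map_on F g" "a \<in> E" "b \<in> F"
  shows "tensor_map f g (pure_tensor a b) = pure_tensor (f a) (g b)"
proof -
  have "g (\<lambda>y. a x * b y) y' = a x * g b y'" for x y'
    using assms(2,4) unfolding linear_map_on_def fscale_def by metis
  moreover have "f (\<lambda>x. a x * g b y') x' = f a x' * g b y'" for x' y'
  proof -
    have "f (fscale (g b y') a) = fscale (g b y') (f a)"
      using assms(1,3) unfolding linear_map_on_def by blast
    then show ?thesis by (auto simp: fscale_def fun_eq_iff mult.commute)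
  qed
  ultimately show ?thesis
    by (auto simp: tensor_map_def fun_eq_iff)
qed

lemma tensor_slices:
  assumes E: "fspace.subspace E" and F: "fspace.subspace F" and g: "linear_map_on F g"
    and t: "t \<in> tensor_space E F"
  shows "(\<forall>x. (\<lambda>y. t (x, y)) \<in> F) \<and> (\<forall>y'. (\<lambda>x. g (\<lambda>y. t (x, y)) y') \<in> E)"
  using t unfolding tensor_space_def
proof (induction t rule: fspace.span_induct_alt)
  case base
  have "g (\<lambda>y. 0) = (\<lambda>y. 0)"
  proof -
    have "g (fscale 0 0) = fscale 0 (g 0)"
      using g fspace.subspace_0[OF F] unfolding linear_map_on_def by blast
    then show ?thesis by (simp add: fscale_def zero_fun_def)
  qed
  then show ?case
    using fspace.subspace_0[OF E] fspace.subspace_0[OF F] by (simp add: zero_fun_def)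
next
  case (step c t s)
  then obtain a b where ab: "t = pure_tensor a b" "a \<in> E" "b \<in> F" by blast
  have s1: "(\<lambda>y. (fscale c t + s) (x, y)) = fscale (c * a x) b + (\<lambda>y. s (x, y))" for x
    by (auto simp: ab fun_eq_iff)
  have mem: "fscale (c * a x) b \<in> F" for x
    using ab F fspace.subspace_scale by blast
  have "g (fscale (c * a x) b + (\<lambda>y. s (x, y))) = fscale (c * a x) (g b) + g (\<lambda>y. s (x, y))" for x
    using g mem[of x] step.IH ab(3) unfolding linear_map_on_def by metis
  then have "(\<lambda>x. g (fscale (c * a x) b + (\<lambda>y. s (x, y))) y') =
      fscale (c * g b y') a + (\<lambda>x. g (\<lambda>y. s (x, y)) y')" for y'
    by (intro ext) (simp add: algebra_simps)
  then show ?case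
    unfolding s1 using mem step.IH ab(2) fspace.subspace_add[OF F] fspace.subspace_add[OF E]
      fspace.subspace_scale[OF E] by metis
qed

lemma tensor_map_linear:
  assumes E: "fspace.subspace E" and F: "fspace.subspace F"
    and f: "linear_map_on E f" and g: "linear_map_on F g"
  shows "linear_map_on (tensor_space E F) (tensor_map f g)"
  unfolding linear_map_on_def
proof (intro conjI ballI allI)
  fix s t assume st: "s \<in> tensor_space E F" "t \<in> tensor_space E F"
  note * = tensor_slices[OF E F g]
  have 1: "g (\<lambda>y. (s + t) (x, y)) = g (\<lambda>y. s (x, y)) + g (\<lambda>y. t (x, y))" for x
    using g *[OF st(1)] *[OF st(2)] unfolding linear_map_on_def
    by (simp add: plus_fun_def)
  have 2: "f (\<lambda>x. g (\<lambda>y. (s + t) (x, y)) y') =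
      f (\<lambda>x. g (\<lambda>y. s (x, y)) y') + f (\<lambda>x. g (\<lambda>y. t (x, y)) y')" for y'
    using f *[OF st(1)] *[OF st(2)] unfolding linear_map_on_def 1
    by (simp add: plus_fun_def)
  show "tensor_map f g (s + t) = tensor_map f g s + tensor_map f g t"
    unfolding tensor_map_def 2 by (auto simp: fun_eq_iff)
next
  fix c t assume t: "t \<in> tensor_space E F"
  note * = tensor_slices[OF E F g t]
  have 1: "g (\<lambda>y. (fscale c t) (x, y)) = fscale c (g (\<lambda>y. t (x, y)))" for x
    using g * unfolding linear_map_on_def by (simp add: fscale_def)
  have 2: "f (\<lambda>x. g (\<lambda>y. (fscale c t) (x, y)) y') = fscale c (f (\<lambda>x. g (\<lambda>y. t (x, y)) y'))" for y'
    using f * unfolding linear_map_on_def 1 by (simp add: fscale_def)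
  show "tensor_map f g (fscale c t) = fscale c (tensor_map f g t)"
    unfolding tensor_map_def 2 by (auto simp: fun_eq_iff)
qed

lemma vec_map_vec:
  assumes "Vector_Spaces.linear scale scale' \<eta>"
  shows "vec_map scale' \<eta> (vec scale v) = vec scale' (\<eta> v)"
  using Vector_Spaces.linear_compose[OF assms]
  by (auto simp: vec_map_def vec_def dual_space_def fun_eq_iff)

lemma vec_add: "vec scale (v + w) = vec scale v + vec scale w"
  by (auto simp: vec_def fun_eq_iff dual_space_def Vector_Spaces.linear_def module_hom_def module_hom_axioms_def)

lemma vec_scale: "vec scale (scale c v) = fscale c (vec scale v)"
  by (auto simp: vec_def fun_eq_iff dual_space_def Vector_Spaces.linear_def module_hom_def module_hom_axioms_def)

subsection \<open>Exterior algebra\<close>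

lemma shuffle_add: "shuffle (s + t) = shuffle s + shuffle t"
proof
  fix fs show "shuffle (s + t) fs = (shuffle s + shuffle t) fs"
  proof (induction fs arbitrary: s t)
    case (Cons f fs)
    have 1: "(\<lambda>(l, m). (s + t) (f # l, m)) = (\<lambda>(l, m). s (f # l, m)) + (\<lambda>(l, m). t (f # l, m))"
      and 2: "(\<lambda>(l, m). (-1) ^ length l * (s + t) (l, f # m)) =
        (\<lambda>(l, m). (-1) ^ length l * s (l, f # m)) + (\<lambda>(l, m). (-1) ^ length l * t (l, f # m))"
      by (auto simp: fun_eq_iff algebra_simps)
    show ?case unfolding shuffle.simps 1 2 Cons.IH by (simp add: algebra_simps)
  qed auto
qed

lemma shuffle_scale: "shuffle (fscale c t) = fscale c (shuffle t)"
proof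
  fix fs show "shuffle (fscale c t) fs = fscale c (shuffle t) fs"
  proof (induction fs arbitrary: t)
    case (Cons f fs)
    have 1: "(\<lambda>(l, m). fscale c t (f # l, m)) = fscale c (\<lambda>(l, m). t (f # l, m))"
      and 2: "(\<lambda>(l, m). (-1) ^ length l * fscale c t (l, f # m)) =
        fscale c (\<lambda>(l, m). (-1) ^ length l * t (l, f # m))"
      by (auto simp: fun_eq_iff algebra_simps)
    show ?case unfolding shuffle.simps 1 2 Cons.IH by (simp add: algebra_simps)
  qed auto
qed

lemma shuffle_zero [simp]: "shuffle (\<lambda>_. 0) fs = 0"
  using shuffle_scale[of 0 "\<lambda>_. 0"] by (auto simp: fscale_def fun_eq_iff)

lemma shuffle_sum: "shuffle (\<lambda>x. \<Sum>i\<in>I. t i x) fs = (\<Sum>i\<in>I. shuffle (t i) fs)"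
proof (induction I rule: infinite_finite_induct)
  case (insert i I)
  have "(\<lambda>x. \<Sum>j\<in>insert i I. t j x) = t i + (\<lambda>x. \<Sum>j\<in>I. t j x)"
    using insert by (auto simp: fun_eq_iff)
  then show ?case using insert by (simp add: shuffle_add)
qed auto

lemma shuffle_append:
  "shuffle t (fs @ gs) =
     shuffle (\<lambda>(l, m). shuffle (\<lambda>(l', m'). (-1) ^ (length l' * length m) * t (l @ l', m @ m')) gs) fs"
proof (induction fs arbitrary: t)
  case Nil
  then show ?case by simp
next
  case (Cons f fs)
  have "(\<lambda>(l, m). shuffle (\<lambda>(l', m'). (-1) ^ (length l' * length m) *
            ((-1) ^ length (l @ l') * t (l @ l', f # m @ m'))) gs) =
        (\<lambda>(l, m). (-1) ^ length l * shuffle (\<lambda>(l', m'). (-1) ^ (length l' * length (f # m)) *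
            t (l @ l', f # m @ m')) gs)"
  proof (intro ext, clarify)
    fix l m
    have "(\<lambda>(l', m'). (-1) ^ (length l' * length m) * ((-1) ^ length (l @ l') * t (l @ l', f # m @ m')))
      = fscale ((-1) ^ length l) (\<lambda>(l', m'). (-1) ^ (length l' * length (f # m)) * t (l @ l', f # m @ m'))"
      by (auto simp: fun_eq_iff power_add)
    then show "shuffle (\<lambda>(l', m'). (-1) ^ (length l' * length m) *
            ((-1) ^ length (l @ l') * t (l @ l', f # m @ m'))) gs =
        (-1) ^ length l * shuffle (\<lambda>(l', m'). (-1) ^ (length l' * length (f # m)) *
            t (l @ l', f # m @ m')) gs"
      by (simp add: shuffle_scale)
  qed
  note sgn = this
  have "shuffle t ((f # fs) @ gs) =
      shuffle (\<lambda>(l, m). t (f # l, m)) (fs @ gs) +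
      shuffle (\<lambda>(l, m). (-1) ^ length l * t (l, f # m)) (fs @ gs)"
    by simp
  also have "\<dots> = shuffle (\<lambda>(l, m). shuffle (\<lambda>(l', m'). (-1) ^ (length l' * length m) *
            t (f # l @ l', m @ m')) gs) fs +
      shuffle (\<lambda>(l, m). shuffle (\<lambda>(l', m'). (-1) ^ (length l' * length m) *
            ((-1) ^ length (l @ l') * t (l @ l', f # m @ m'))) gs) fs"
    by (simp only: Cons.IH prod.case)
  also note sgn
  finally show ?case by (simp only: shuffle.simps prod.case append_Cons)
qed

lemma shuffle_map: "shuffle t (map h fs) = shuffle (\<lambda>(l, m). t (map h l, map h m)) fs"
  by (induction fs arbitrary: t) (auto simp: case_prod_beta')

lemma ext_mult_add_right: "ext_mult a (b + c) = ext_mult a b + ext_mult a c"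
proof -
  have "pure_tensor a (b + c) = pure_tensor a b + pure_tensor a c"
    by (auto simp: fun_eq_iff algebra_simps)
  then show ?thesis by (simp add: ext_mult_def shuffle_add)
qed

lemma ext_mult_scale_right: "ext_mult a (fscale c b) = fscale c (ext_mult a b)"
proof -
  have "pure_tensor a (fscale c b) = fscale c (pure_tensor a b)"
    by (auto simp: fun_eq_iff algebra_simps)
  then show ?thesis by (simp add: ext_mult_def shuffle_scale)
qed

lemma ext_mult_scale_left: "ext_mult (fscale c a) b = fscale c (ext_mult a b)"
proof -
  have "pure_tensor (fscale c a) b = fscale c (pure_tensor a b)"
    by (auto simp: fun_eq_iff algebra_simps)
  then show ?thesis by (simp add: ext_mult_def shuffle_scale)
qed

lemma ext_one_mult: "ext_mult ext_one b = b"
proof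
  fix fs show "ext_mult ext_one b fs = b fs"
    unfolding ext_mult_def
  proof (induction fs arbitrary: b)
    case (Cons f fs)
    have 1: "(\<lambda>(l, m). pure_tensor ext_one b (f # l, m)) = (\<lambda>_. 0)"
      and 2: "(\<lambda>(l, m). (-1) ^ length l * pure_tensor ext_one b (l, f # m)) =
        pure_tensor ext_one (\<lambda>m. b (f # m))"
      by (auto simp: ext_one_def fun_eq_iff)
    show ?case unfolding shuffle.simps 1 2 Cons.IH by simp
  qed (simp add: ext_one_def)
qed

lemma ext_mult_one: "ext_mult b ext_one = b"
proof
  fix fs show "ext_mult b ext_one fs = b fs"
    unfolding ext_mult_def
  proof (induction fs arbitrary: b)
    case (Cons f fs)
    have 1: "(\<lambda>(l, m). pure_tensor b ext_one (f # l, m)) = pure_tensor (\<lambda>l. b (f # l)) ext_one"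
      and 2: "(\<lambda>(l, m). (-1) ^ length l * pure_tensor b ext_one (l, f # m)) = (\<lambda>_. 0)"
      by (auto simp: ext_one_def fun_eq_iff)
    show ?case unfolding shuffle.simps 1 2 Cons.IH by simp
  qed (simp add: ext_one_def)
qed

lemma ext_mult_embed_Nil: "ext_mult (ext_embed a) b [] = 0"
  by (simp add: ext_mult_def ext_embed_def)

lemma ext_mult_embed_Cons:
  "ext_mult (ext_embed a) b (f # fs) = a f * b fs - ext_mult (ext_embed a) (\<lambda>m. b (f # m)) fs"
proof -
  have 1: "(\<lambda>(l, m). pure_tensor (ext_embed a) b (f # l, m)) = fscale (a f) (pure_tensor ext_one b)"
    and 2: "(\<lambda>(l, m). (-1) ^ length l * pure_tensor (ext_embed a) b (l, f # m)) =
      fscale (-1) (pure_tensor (ext_embed a) (\<lambda>m. b (f # m)))"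
    by (auto simp: ext_one_def ext_embed_def fun_eq_iff split: list.splits)
  show ?thesis
    using ext_one_mult[of b]
    unfolding ext_mult_def shuffle.simps 1 2 shuffle_scale by simp
qed

lemma ext_mult_anticomm:
  "ext_mult (ext_embed a) (ext_embed b) = - ext_mult (ext_embed b) (ext_embed a)"
proof
  fix fs
  have *: "(\<lambda>m. ext_embed a (f # m)) = fscale (a f) ext_one" for a :: "'a \<Rightarrow> complex" and f
    by (auto simp: ext_embed_def ext_one_def fun_eq_iff split: list.splits)
  show "ext_mult (ext_embed a) (ext_embed b) fs = (- ext_mult (ext_embed b) (ext_embed a)) fs"
    by (cases fs) (simp_all add: ext_mult_embed_Nil ext_mult_embed_Cons * ext_mult_scale_right ext_mult_one)
qed

lemma wedge_Nil: "wedge scale [] = ext_one"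
  and wedge_Cons: "wedge scale (v # vs) = ext_mult (ext_embed (vec scale v)) (wedge scale vs)"
  by (simp_all add: wedge_def)

lemma wedge_mem: "wedge scale vs \<in> exterior scale"
  unfolding exterior_def by (rule fspace.span_base) simp

lemma wedge_single: "wedge scale [v] = ext_embed (vec scale v)"
  by (simp add: wedge_Cons wedge_Nil ext_mult_one)

lemma subspace_exterior: "fspace.subspace (exterior scale)"
  unfolding exterior_def by (rule fspace.subspace_span)

lemma ext_mult_vec_mem:
  assumes "\<omega> \<in> exterior scale"
  shows "ext_mult (ext_embed (vec scale v)) \<omega> \<in> exterior scale"
  using assms unfolding exterior_def
proof (induction \<omega> rule: fspace.span_induct_alt)
  case base
  have "ext_mult (ext_embed (vec scale v)) 0 = 0"
    using ext_mult_scale_right[of "ext_embed (vec scale v)" 0 0] by (simp add: fspace.scale_zero_left)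
  then show ?case using fspace.span_zero by metis
next
  case (step c x y)
  then obtain vs where "x = wedge scale vs" by blast
  then have "ext_mult (ext_embed (vec scale v)) (fscale c x + y)
      = fscale c (wedge scale (v # vs)) + ext_mult (ext_embed (vec scale v)) y"
    by (simp add: ext_mult_add_right ext_mult_scale_right wedge_Cons)
  moreover have "fscale c (wedge scale (v # vs)) \<in> fspace.span (range (wedge scale))"
    by (rule fspace.span_scale, rule fspace.span_base) simp
  ultimately show ?case
    using step.IH fspace.span_add by metis
qed

lemma fspace_lincomb_zero: "linear_map_on E f \<Longrightarrow> 0 \<in> E \<Longrightarrow> f 0 = 0"
  unfolding linear_map_on_def by (metis fspace.scale_zero_left)

lemma ext_mult_embed_append:
  "ext_mult (ext_embed a) b (fs @ gs) =
     ext_mult (ext_embed a) (\<lambda>l. b (l @ gs)) fs +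
     (-1) ^ length fs * ext_mult (ext_embed a) (\<lambda>m. b (fs @ m)) gs"
proof (induction fs arbitrary: b)
  case Nil
  then show ?case by (simp add: ext_mult_embed_Nil)
next
  case (Cons f fs)
  show ?case
    unfolding append_Cons ext_mult_embed_Cons Cons.IH by simp
qed

lemma ext_mult_embed_sign:
  "(-1) ^ length fs * ext_mult (ext_embed a) b fs =
     - ext_mult (ext_embed a) (\<lambda>l. (-1) ^ length l * b l) fs"
proof (induction fs arbitrary: b)
  case Nil
  then show ?case by (simp add: ext_mult_embed_Nil)
next
  case (Cons f fs)
  have "(\<lambda>m. (-1) ^ length (f # m) * b (f # m)) = fscale (-1) (\<lambda>m. (-1) ^ length m * b (f # m))"
    by (simp add: fscale_def)
  then have "ext_mult (ext_embed a) (\<lambda>m. (-1) ^ length (f # m) * b (f # m)) fs =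
      - ext_mult (ext_embed a) (\<lambda>m. (-1) ^ length m * b (f # m)) fs"
    by (simp only: ext_mult_scale_right fscale_apply) simp
  also have "\<dots> = (-1) ^ length fs * ext_mult (ext_embed a) (\<lambda>m. b (f # m)) fs"
    using Cons.IH[of "\<lambda>m. b (f # m)"] by simp
  finally have *: "ext_mult (ext_embed a) (\<lambda>m. (-1) ^ length (f # m) * b (f # m)) fs = \<dots>" .
  show ?case
    unfolding ext_mult_embed_Cons * by (simp add: algebra_simps)
qed

lemma wedge_sign: "(-1) ^ length l * wedge scale vs l = (-1) ^ length vs * wedge scale vs l"
proof (induction vs arbitrary: l)
  case Nil
  then show ?case by (simp add: wedge_Nil ext_one_def)
next
  case (Cons v vs)
  have "(\<lambda>l. (-1) ^ length l * wedge scale vs l) = fscale ((-1) ^ length vs) (wedge scale vs)"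
    by (intro ext) (simp only: Cons.IH fscale_apply)
  then show ?case
    by (simp add: wedge_Cons ext_mult_embed_sign ext_mult_scale_right)
qed

definition ext_sign :: "('f list \<Rightarrow> complex) \<Rightarrow> 'f list \<Rightarrow> complex" where
  "ext_sign a = (\<lambda>l. (-1) ^ length l * a l)"

lemma ext_sign_mem:
  assumes "\<omega> \<in> exterior scale"
  shows "ext_sign \<omega> \<in> exterior scale"
  using assms unfolding exterior_def
proof (induction \<omega> rule: fspace.span_induct_alt)
  case base
  have "ext_sign 0 = (0 :: _ \<Rightarrow> complex)"
    by (auto simp: ext_sign_def fun_eq_iff)
  then show ?case using fspace.span_zero by metis
next
  case (step c x y)
  then obtain vs where vs: "x = wedge scale vs" by blast
  have "ext_sign (fscale c x + y) = fscale (c * (-1) ^ length vs) (wedge scale vs) + ext_sign y"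
  proof (intro ext)
    fix l
    have "ext_sign (fscale c x + y) l = c * ((-1) ^ length l * wedge scale vs l) + ext_sign y l"
      by (simp add: vs ext_sign_def algebra_simps)
    also have "\<dots> = (fscale (c * (-1) ^ length vs) (wedge scale vs) + ext_sign y) l"
      by (simp only: wedge_sign) (simp add: algebra_simps)
    finally show "ext_sign (fscale c x + y) l = \<dots>" .
  qed
  moreover have "fscale (c * (-1) ^ length vs) (wedge scale vs) \<in> fspace.span (range (wedge scale))"
    by (rule fspace.span_scale, rule fspace.span_base) simp
  ultimately show ?case
    using step.IH fspace.span_add by metis
qed

lemma split_vec_mem:
  assumes "t \<in> tensor_space (exterior scale) (exterior scale)"
  shows "(\<lambda>(fs, gs). ext_mult (ext_embed (vec scale v)) (\<lambda>l. t (l, gs)) fs +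
     (-1) ^ length fs * ext_mult (ext_embed (vec scale v)) (\<lambda>m. t (fs, m)) gs)
     \<in> tensor_space (exterior scale) (exterior scale)" (is "?L t \<in> ?T")
  using assms unfolding tensor_space_def
proof (induction t rule: fspace.span_induct_alt)
  case base
  have *: "ext_mult (ext_embed (vec scale v)) (\<lambda>l. 0) = (\<lambda>l. 0)"
    using ext_mult_scale_right[of "ext_embed (vec scale v)" 0 0] by (simp add: fscale_def)
  have "?L 0 = 0" by (simp add: zero_fun_def * case_prod_beta')
  then show ?case using fspace.span_zero by metis
next
  case (step c s t)
  then obtain \<alpha> \<beta> where s: "s = pure_tensor \<alpha> \<beta>" "\<alpha> \<in> exterior scale" "\<beta> \<in> exterior scale" by blast
  let ?v = "ext_mult (ext_embed (vec scale v))"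
  have 1: "(\<lambda>l. (fscale c s + t) (l, gs)) = fscale (c * \<beta> gs) \<alpha> + (\<lambda>l. t (l, gs))" for gs
    by (intro ext) (simp add: s)
  have 2: "(\<lambda>m. (fscale c s + t) (fs, m)) = fscale (c * \<alpha> fs) \<beta> + (\<lambda>m. t (fs, m))" for fs
    by (intro ext) (simp add: s)
  have eq: "?L (fscale c s + t) =
      fscale c (pure_tensor (?v \<alpha>) \<beta>) + (fscale c (pure_tensor (ext_sign \<alpha>) (?v \<beta>)) + ?L t)"
    unfolding 1 2 ext_mult_add_right ext_mult_scale_right
    by (intro ext) (simp add: ext_sign_def case_prod_beta' pure_tensor_def algebra_simps)
  have "pure_tensor (?v \<alpha>) \<beta> \<in> ?T" "pure_tensor (ext_sign \<alpha>) (?v \<beta>) \<in> ?T"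
    using s by (auto intro!: pure_tensor_mem ext_mult_vec_mem ext_sign_mem)
  then have "fscale c (pure_tensor (?v \<alpha>) \<beta>) + (fscale c (pure_tensor (ext_sign \<alpha>) (?v \<beta>)) + ?L t) \<in> ?T"
    using step.IH unfolding tensor_space_def
    by (intro fspace.span_add fspace.span_scale)
  then show ?case unfolding eq tensor_space_def .
qed

lemma ext_split_mem:
  assumes "\<omega> \<in> exterior scale"
  shows "(\<lambda>(fs, gs). \<omega> (fs @ gs)) \<in> tensor_space (exterior scale) (exterior scale)"
proof -
  have w: "(\<lambda>(fs, gs). wedge scale vs (fs @ gs)) \<in> tensor_space (exterior scale) (exterior scale)" for vs
  proof (induction vs)
    case Nil
    have "(\<lambda>(fs, gs). wedge scale [] (fs @ gs)) = pure_tensor (wedge scale []) (wedge scale [])"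
      by (auto simp: wedge_Nil ext_one_def pure_tensor_def fun_eq_iff)
    then show ?case using pure_tensor_mem[OF wedge_mem wedge_mem] by metis
  next
    case (Cons v vs)
    have "(\<lambda>(fs, gs). wedge scale (v # vs) (fs @ gs)) = (\<lambda>(fs, gs).
        ext_mult (ext_embed (vec scale v)) (\<lambda>l. wedge scale vs (l @ gs)) fs +
        (-1) ^ length fs * ext_mult (ext_embed (vec scale v)) (\<lambda>m. wedge scale vs (fs @ m)) gs)"
      by (simp only: wedge_Cons ext_mult_embed_append)
    then show ?case using split_vec_mem[OF Cons, of v] by simp
  qed
  show ?thesis
    using assms unfolding exterior_def
  proof (induction \<omega> rule: fspace.span_induct_alt)
    case base
    show ?case
      using fspace.subspace_0[OF subspace_tensor_space]
      by (simp add: zero_fun_def case_prod_beta')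
  next
    case (step c x y)
    then obtain vs where vs: "x = wedge scale vs" by blast
    have "(\<lambda>(fs, gs). (fscale c x + y) (fs @ gs)) =
        fscale c (\<lambda>(fs, gs). wedge scale vs (fs @ gs)) + (\<lambda>(fs, gs). y (fs @ gs))"
      unfolding vs by (intro ext) (simp add: case_prod_beta')
    then show ?case
      using step.IH w[of vs] unfolding exterior_def
      by (metis (no_types, lifting) fspace.subspace_add fspace.subspace_scale subspace_tensor_space)
  qed
qed

subsection \<open>The smash product\<close>

lemma smash_mu_add: "smash_mu G \<rho> (s + t) = smash_mu G \<rho> s + smash_mu G \<rho> t"
proof -
  have "(\<lambda>(l, m). (s + t) ((g, l), h, map (\<lambda>f. f \<circ> \<rho> g) m)) =
    (\<lambda>(l, m). s ((g, l), h, map (\<lambda>f. f \<circ> \<rho> g) m)) + (\<lambda>(l, m). t ((g, l), h, map (\<lambda>f. f \<circ> \<rho> g) m))" for g h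
    by (auto simp: fun_eq_iff)
  then show ?thesis
    unfolding smash_mu_def by (intro ext) (simp only: shuffle_add, simp add: sum.distrib case_prod_beta')
qed

lemma smash_mu_scale: "smash_mu G \<rho> (fscale c t) = fscale c (smash_mu G \<rho> t)"
proof -
  have "(\<lambda>(l, m). (fscale c t) ((g, l), h, map (\<lambda>f. f \<circ> \<rho> g) m)) =
    fscale c (\<lambda>(l, m). t ((g, l), h, map (\<lambda>f. f \<circ> \<rho> g) m))" for g h
    by (auto simp: fun_eq_iff)
  then show ?thesis
    unfolding smash_mu_def by (intro ext) (simp only: shuffle_scale, simp add: sum_distrib_left case_prod_beta')
qed

lemma super_tensor_mult_pure_tensor:
  assumes \<mu>: "\<And>c t. \<mu> (fscale c t) = fscale c (\<mu> t)"
    and b: "\<And>x. b x \<noteq> 0 \<Longrightarrow> p x mod 2 = i" and c: "\<And>x. c x \<noteq> 0 \<Longrightarrow> p x mod 2 = j"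
  shows "super_tensor_mult \<mu> p (pure_tensor a b) (pure_tensor c d) =
    fscale ((-1) ^ (i * j)) (pure_tensor (\<mu> (pure_tensor a c)) (\<mu> (pure_tensor b d)))"
proof -
  have sgn: "(-1) ^ (p y * p x) * (b y * c x) = (-1) ^ (i * j) * (b y * c x)" for x y
  proof (cases "b y = 0 \<or> c x = 0")
    case False
    then have "p y mod 2 = i" "p x mod 2 = j" using b c by blast+
    then have "(-1 :: complex) ^ (p y * p x) = (-1) ^ (i * j)"
      by (metis even_mult_iff mod_mod_trivial even_iff_mod_2_eq_zero neg_one_even_power neg_one_odd_power)
    then show ?thesis by simp
  qed auto
  have "(\<lambda>(y1, y2). (-1) ^ (p y1 * p x2) * pure_tensor a b (x1, y1) * pure_tensor c d (x2, y2)) =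
    fscale ((-1) ^ (i * j) * pure_tensor a c (x1, x2)) (pure_tensor b d)" for x1 x2
  proof (intro ext, clarify)
    fix y1 y2
    have "(-1) ^ (p y1 * p x2) * (a x1 * b y1) * (c x2 * d y2) =
      ((-1) ^ (p y1 * p x2) * (b y1 * c x2)) * (a x1 * d y2)" by (simp add: algebra_simps)
    also have "\<dots> = ((-1) ^ (i * j) * (b y1 * c x2)) * (a x1 * d y2)" by (simp only: sgn)
    finally show "(-1) ^ (p y1 * p x2) * pure_tensor a b (x1, y1) * pure_tensor c d (x2, y2) =
      fscale ((-1) ^ (i * j) * pure_tensor a c (x1, x2)) (pure_tensor b d) (y1, y2)"
      by (simp add: algebra_simps)
  qed
  then have 1: "\<mu> (\<lambda>(y1, y2). (-1) ^ (p y1 * p x2) * pure_tensor a b (x1, y1) * pure_tensor c d (x2, y2)) y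
      = (-1) ^ (i * j) * \<mu> (pure_tensor b d) y * pure_tensor a c (x1, x2)" for x1 x2 y
    by (simp only: \<mu> fscale_apply) simp
  have 2: "(\<lambda>(x1, x2). (-1) ^ (i * j) * \<mu> (pure_tensor b d) y * pure_tensor a c (x1, x2)) =
    fscale ((-1) ^ (i * j) * \<mu> (pure_tensor b d) y) (pure_tensor a c)" for y
    by (auto simp: fun_eq_iff)
  show ?thesis
    unfolding super_tensor_mult_def 1 2 \<mu> by (intro ext) (simp add: case_prod_beta' pure_tensor_def algebra_simps)
qed

definition smash_comult_formula :: "('g, 'v) smash \<Rightarrow> ('g, 'v) smash2" where
  "smash_comult_formula a = (\<lambda>((g, fs), (h, gs)). if g = h then a (g, fs @ gs) else 0)"

lemma at_group_mem: "g \<in> carrier G \<Longrightarrow> \<omega> \<in> exterior scale \<Longrightarrow> at_group g \<omega> \<in> smash_carrier G scale"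
proof -
  have *: "(\<lambda>l. at_group g \<omega> (h, l)) = (if h = g then \<omega> else 0)" for h
    by (auto simp: at_group_def fun_eq_iff)
  show "g \<in> carrier G \<Longrightarrow> \<omega> \<in> exterior scale \<Longrightarrow> ?thesis"
    unfolding smash_carrier_def mem_Collect_eq *
    using fspace.subspace_0[OF subspace_exterior, of scale] by (auto simp: at_group_def)
qed

lemma at_group_lincomb: "at_group g (fscale c x + y) = fscale c (at_group g x) + at_group g y"
  by (auto simp: at_group_def fun_eq_iff)

lemma subspace_smash_carrier: "fspace.subspace (smash_carrier G scale)"
proof (rule fspace.subspaceI)
  show "0 \<in> smash_carrier G scale"
    using fspace.subspace_0[OF subspace_exterior] by (auto simp: smash_carrier_def zero_fun_def)
next
  fix a b assume "a \<in> smash_carrier G scale" "b \<in> smash_carrier G scale"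
  then show "a + b \<in> smash_carrier G scale"
    using fspace.subspace_add[OF subspace_exterior, of _ scale]
    by (auto simp: smash_carrier_def plus_fun_def)
next
  fix c a assume "a \<in> smash_carrier G scale"
  then show "fscale c a \<in> smash_carrier G scale"
    using fspace.subspace_scale[OF subspace_exterior, of _ scale]
    by (auto simp: smash_carrier_def fscale_def)
qed

context finite_group_rep
begin

lemma smash_mult_at_group:
  assumes "g \<in> carrier G" "h \<in> carrier G"
  shows "at_group g \<alpha> \<otimes>\<^bsub>smash_algebra G scale \<rho>\<^esub> at_group h \<beta> =
    at_group (g \<otimes> h) (ext_mult \<alpha> (\<lambda>l. \<beta> (map (\<lambda>f. f \<circ> \<rho> g) l)))"
proof -
  have "smash_mu G \<rho> (pure_tensor (at_group g \<alpha>) (at_group h \<beta>)) (k, fs) =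
    at_group (g \<otimes> h) (ext_mult \<alpha> (\<lambda>l. \<beta> (map (\<lambda>f. f \<circ> \<rho> g) l))) (k, fs)" for k fs
  proof (cases "k \<in> carrier G")
    case True
    have eq: "inv g \<otimes> k = h \<longleftrightarrow> k = g \<otimes> h"
      using assms True by (metis inv_solve_left)
    have "(\<Sum>g'\<in>carrier G. shuffle (\<lambda>(l, m). pure_tensor (at_group g \<alpha>) (at_group h \<beta>)
        ((g', l), (inv g' \<otimes> k, map (\<lambda>f. f \<circ> \<rho> g') m))) fs) =
      (\<Sum>g'\<in>carrier G. if g' = g then shuffle (\<lambda>(l, m). pure_tensor (at_group g \<alpha>) (at_group h \<beta>)
        ((g, l), (inv g \<otimes> k, map (\<lambda>f. f \<circ> \<rho> g) m))) fs else 0)"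
      by (intro sum.cong refl) (auto simp: at_group_def case_prod_beta')
    also have "\<dots> = shuffle (\<lambda>(l, m). pure_tensor (at_group g \<alpha>) (at_group h \<beta>)
        ((g, l), (inv g \<otimes> k, map (\<lambda>f. f \<circ> \<rho> g) m))) fs"
      using assms finite_carrier by simp
    also have "\<dots> = at_group (g \<otimes> h) (ext_mult \<alpha> (\<lambda>l. \<beta> (map (\<lambda>f. f \<circ> \<rho> g) l))) (k, fs)"
      using eq by (auto simp: at_group_def ext_mult_def pure_tensor_def case_prod_beta')
    finally show ?thesis using True by (simp add: smash_mu_def)
  next
    case False
    then show ?thesis using assms by (auto simp: smash_mu_def at_group_def)
  qed
  then show ?thesis by (auto simp: smash_algebra_def fun_eq_iff)
qed

lemma vec_act:
  assumes "g \<in> carrier G"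
  shows "(\<lambda>l. ext_embed (vec scale v) (map (\<lambda>f. f \<circ> \<rho> g) l)) = ext_embed (vec scale (\<rho> g v))"
proof -
  have lin: "Vector_Spaces.linear scale scale (\<rho> g)" "Vector_Spaces.linear scale scale (\<rho> (inv g))"
    using assms rep_linear by auto
  have "f \<circ> \<rho> g \<in> dual_space scale \<longleftrightarrow> f \<in> dual_space scale" for f :: "'v \<Rightarrow> complex"
  proof
    assume "f \<circ> \<rho> g \<in> dual_space scale"
    moreover have "f \<circ> \<rho> g \<circ> \<rho> (inv g) = f"
      using assms rep_mult[of g "inv g"] rep_one by (auto simp: fun_eq_iff)
    ultimately show "f \<in> dual_space scale"
      using Vector_Spaces.linear_compose[OF lin(2), of "(*)" "f \<circ> \<rho> g"] by (simp add: dual_space_def)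
  next
    assume "f \<in> dual_space scale"
    then show "f \<circ> \<rho> g \<in> dual_space scale"
      using Vector_Spaces.linear_compose[OF lin(1)] by (simp add: dual_space_def)
  qed
  then show ?thesis
    by (auto simp: ext_embed_def vec_def fun_eq_iff split: list.splits)
qed

lemma ext_one_act: "(\<lambda>l. ext_one (map h l)) = ext_one"
  by (simp add: ext_one_def)

lemma smash_group_mult:
  assumes "g \<in> carrier G" "h \<in> carrier G"
  shows "smash_group_elem g \<otimes>\<^bsub>smash_algebra G scale \<rho>\<^esub> smash_group_elem h = smash_group_elem (g \<otimes> h)"
  unfolding smash_group_elem_def smash_mult_at_group[OF assms] ext_one_act ext_one_mult ..

lemma smash_vec_anticomm:
  "smash_embed G (vec scale v) \<otimes>\<^bsub>smash_algebra G scale \<rho>\<^esub> smash_embed G (vec scale w) =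
     - (smash_embed G (vec scale w) \<otimes>\<^bsub>smash_algebra G scale \<rho>\<^esub> smash_embed G (vec scale v))"
  unfolding smash_embed_def smash_mult_at_group[OF one_closed one_closed] vec_act[OF one_closed] rep_one
  using ext_mult_anticomm[of "vec scale v" "vec scale w"] by (auto simp: at_group_def fun_eq_iff)

lemma smash_conj:
  assumes "g \<in> carrier G"
  shows "smash_group_elem g \<otimes>\<^bsub>smash_algebra G scale \<rho>\<^esub> smash_embed G (vec scale v)
      \<otimes>\<^bsub>smash_algebra G scale \<rho>\<^esub> smash_group_elem (inv g) = smash_embed G (vec scale (\<rho> g v))"
  using assms
  by (simp add: smash_embed_def smash_group_elem_def smash_mult_at_group vec_act ext_one_act
      ext_one_mult ext_mult_one)

lemma smash_comult_formula_mult: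
  "smash_comult_formula (smash_mu G \<rho> (pure_tensor a b)) =
     super_tensor_mult (smash_mu G \<rho>) smash_parity (smash_comult_formula a) (smash_comult_formula b)"
  (is "?L = ?R")
proof -
  have "?L ((k, fs), (k', gs)) = ?R ((k, fs), (k', gs))" for k fs k' gs
  proof (cases "k \<in> carrier G \<and> k' \<in> carrier G")
    case False
    then show ?thesis by (auto simp: smash_comult_formula_def super_tensor_mult_def smash_mu_def case_prod_beta')
  next
    case True
    define S where "S g h l m = shuffle (\<lambda>(l', m'). (-1) ^ (length l' * length m) *
        smash_comult_formula a ((g, l), (h, l')) *
        smash_comult_formula b ((inv g \<otimes> k, map (\<lambda>f. f \<circ> \<rho> g) m), (inv h \<otimes> k', map (\<lambda>f. f \<circ> \<rho> h) m'))) gs"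
      for g h l m
    have S0: "S g h l m = 0" if "g \<noteq> h" for g h l m
      using that by (simp add: S_def smash_comult_formula_def case_prod_beta')
    have "?R ((k, fs), (k', gs)) =
      (\<Sum>g\<in>carrier G. shuffle (\<lambda>(l, m). \<Sum>h\<in>carrier G. S g h l m) fs)"
      using True by (simp add: super_tensor_mult_def smash_mu_def S_def smash_parity_def case_prod_beta')
    also have "\<dots> = (\<Sum>g\<in>carrier G. shuffle (\<lambda>(l, m). S g g l m) fs)"
    proof (intro sum.cong refl)
      fix g assume g: "g \<in> carrier G"
      have "(\<Sum>h\<in>carrier G. S g h l m) = (\<Sum>h\<in>carrier G. if h = g then S g g l m else 0)" for l m
        by (intro sum.cong refl) (auto simp: S0)
      then show "shuffle (\<lambda>(l, m). \<Sum>h\<in>carrier G. S g h l m) fs = shuffle (\<lambda>(l, m). S g g l m) fs"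
        using g finite_carrier by simp
    qed
    also have "\<dots> = ?L ((k, fs), (k', gs))"
    proof (cases "k = k'")
      case [simp]: True
      have "S g g l m = shuffle (\<lambda>(l', m'). (-1) ^ (length l' * length m) *
          (a (g, l @ l') * b (inv g \<otimes> k, map (\<lambda>f. f \<circ> \<rho> g) (m @ m')))) gs" for g l m
        by (simp add: S_def smash_comult_formula_def case_prod_beta' mult.assoc)
      then show ?thesis
        using \<open>k \<in> carrier G \<and> k' \<in> carrier G\<close>
        by (simp add: smash_comult_formula_def smash_mu_def shuffle_append case_prod_beta')
    next
      case False
      then have "inv g \<otimes> k \<noteq> inv g \<otimes> k'" if "g \<in> carrier G" for g
        using True that by simp
      then have "S g g l m = 0" if "g \<in> carrier G" for g l m
        using that by (simp add: S_def smash_comult_formula_def case_prod_beta')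
      then show ?thesis
        using False by (simp add: smash_comult_formula_def case_prod_beta')
    qed
    finally show ?thesis ..
  qed
  then show ?thesis by (auto simp: fun_eq_iff)
qed

lemma smash_carrier_sum:
  assumes "a \<in> smash_carrier G scale"
  shows "a = (\<Sum>g\<in>carrier G. at_group g (\<lambda>l. a (g, l)))"
proof (intro ext, clarify)
  fix h l
  have "(\<Sum>g\<in>carrier G. at_group g (\<lambda>l. a (g, l)) (h, l)) = (\<Sum>g\<in>carrier G. if g = h then a (h, l) else 0)"
    by (intro sum.cong refl) (auto simp: at_group_def)
  also have "\<dots> = a (h, l)"
    using assms finite_carrier by (auto simp: smash_carrier_def)
  finally show "a (h, l) = (\<Sum>g\<in>carrier G. at_group g (\<lambda>l. a (g, l))) (h, l)"
    by (simp add: fun_sum_apply)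
qed

lemma smash_comult_formula_mem:
  assumes "a \<in> smash_carrier G scale"
  shows "smash_comult_formula a \<in> tensor_space (smash_carrier G scale) (smash_carrier G scale)"
proof -
  let ?T = "tensor_space (smash_carrier G scale) (smash_carrier G scale)"
  define emb where "emb k t = (\<lambda>((g, fs), (h, gs)). if g = k \<and> h = k then t (fs, gs) else 0)"
    for k :: 'a and t :: "('v \<Rightarrow> complex) list \<times> ('v \<Rightarrow> complex) list \<Rightarrow> complex"
  have emb: "emb k t \<in> ?T" if k: "k \<in> carrier G"
    and t: "t \<in> tensor_space (exterior scale) (exterior scale)" for k t
    using t unfolding tensor_space_def[of "exterior scale"]
  proof (induction t rule: fspace.span_induct_alt)
    case base
    have "emb k 0 = 0" by (auto simp: emb_def fun_eq_iff)
    then show ?case using fspace.subspace_0[OF subspace_tensor_space] by metis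
  next
    case (step c x y)
    then obtain \<alpha> \<beta> where x: "x = pure_tensor \<alpha> \<beta>" "\<alpha> \<in> exterior scale" "\<beta> \<in> exterior scale" by blast
    have "emb k (fscale c x + y) = fscale c (pure_tensor (at_group k \<alpha>) (at_group k \<beta>)) + emb k y"
      unfolding x by (intro ext) (auto simp: emb_def at_group_def pure_tensor_def)
    moreover have "pure_tensor (at_group k \<alpha>) (at_group k \<beta>) \<in> ?T"
      using x k by (intro pure_tensor_mem at_group_mem)
    ultimately show ?case
      using step.IH fspace.subspace_add[OF subspace_tensor_space] fspace.subspace_scale[OF subspace_tensor_space]
      by metis
  qed
  have "smash_comult_formula a = (\<Sum>k\<in>carrier G. emb k (\<lambda>(fs, gs). a (k, fs @ gs)))"
  proof (intro ext, clarify)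
    fix g fs h gs
    have "(\<Sum>k\<in>carrier G. emb k (\<lambda>(fs, gs). a (k, fs @ gs)) ((g, fs), (h, gs))) =
      (\<Sum>k\<in>carrier G. if k = g then (if g = h then a (g, fs @ gs) else 0) else 0)"
      by (intro sum.cong refl) (auto simp: emb_def)
    then show "smash_comult_formula a ((g, fs), (h, gs)) =
        (\<Sum>k\<in>carrier G. emb k (\<lambda>(fs, gs). a (k, fs @ gs))) ((g, fs), (h, gs))"
      using assms finite_carrier by (auto simp: fun_sum_apply smash_comult_formula_def smash_carrier_def)
  qed
  moreover have "emb k (\<lambda>(fs, gs). a (k, fs @ gs)) \<in> ?T" if "k \<in> carrier G" for k
    using assms that emb ext_split_mem[of "\<lambda>l. a (k, l)" scale] by (simp add: smash_carrier_def)
  ultimately show ?thesis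
    by (simp only:) (rule fspace.subspace_sum[OF subspace_tensor_space])
qed

lemma is_smash_comult_formula: "is_smash_comult G scale \<rho> smash_comult_formula"
  unfolding is_smash_comult_def
proof (intro conjI ballI allI)
  show "linear_map_on (smash_carrier G scale) smash_comult_formula"
    by (auto simp: linear_map_on_def smash_comult_formula_def fun_eq_iff)
  show "smash_comult_formula \<in> hom (smash_algebra G scale \<rho>) (smash_tensor G scale \<rho>)"
    by (rule homI) (simp_all add: smash_algebra_def smash_tensor_def smash_comult_formula_mem
        smash_comult_formula_mult)
  show "smash_comult_formula (smash_group_elem g) =
      pure_tensor (smash_group_elem g) (smash_group_elem g)" for g
    by (auto simp: smash_comult_formula_def smash_group_elem_def at_group_def ext_one_def fun_eq_iff)
  show "let x = smash_embed G (vec scale v); e = smash_group_elem \<one>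
      in smash_comult_formula x = pure_tensor x e + pure_tensor e x" for v
    by (auto simp: Let_def smash_comult_formula_def smash_group_elem_def smash_embed_def at_group_def
        ext_one_def ext_embed_def fun_eq_iff append_eq_Cons_conv split: list.splits)
qed

lemma is_smash_comult_unique:
  assumes D: "is_smash_comult G scale \<rho> D" and D': "is_smash_comult G scale \<rho> D'"
    and a: "a \<in> smash_carrier G scale"
  shows "D a = D' a"
proof -
  have lin: "linear_map_on (smash_carrier G scale) D" "linear_map_on (smash_carrier G scale) D'"
    using D D' by (simp_all add: is_smash_comult_def)
  have zero: "D 0 = D' 0"
    using lin fspace.subspace_0[OF subspace_smash_carrier] by (metis fspace_lincomb_zero)
  have w: "D (at_group g (wedge scale vs)) = D' (at_group g (wedge scale vs))" if g: "g \<in> carrier G" for g vs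
  proof (induction vs)
    case Nil
    have "D (smash_group_elem g) = D' (smash_group_elem g)"
      using D D' g by (simp add: is_smash_comult_def)
    then show ?case by (simp add: smash_group_elem_def wedge_Nil)
  next
    case (Cons v vs)
    let ?v = "smash_embed G (vec scale v)" and ?w = "at_group g (wedge scale vs)"
    have v: "?v \<in> carrier (smash_algebra G scale \<rho>)"
      unfolding smash_embed_def smash_algebra_def
      using at_group_mem[OF one_closed wedge_mem[of scale "[v]"]] by (simp add: wedge_single)
    have w: "?w \<in> carrier (smash_algebra G scale \<rho>)"
      using at_group_mem[OF g wedge_mem] by (simp add: smash_algebra_def)
    have "map (\<lambda>f. f \<circ> \<rho> \<one>) l = l" for l :: "('v \<Rightarrow> complex) list"
      by (rule map_idI) (simp add: fun_eq_iff rep_one)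
    then have eq: "at_group g (wedge scale (v # vs)) = ?v \<otimes>\<^bsub>smash_algebra G scale \<rho>\<^esub> ?w"
      unfolding smash_embed_def smash_mult_at_group[OF one_closed g] using g
      by (simp add: wedge_Cons)
    have "D ?v = D' ?v"
      using D D' by (simp add: is_smash_comult_def Let_def)
    then show ?case
      unfolding eq using D D' hom_mult[OF _ v w] Cons.IH unfolding is_smash_comult_def by metis
  qed
  have \<omega>: "D (at_group g \<omega>) = D' (at_group g \<omega>)" if g: "g \<in> carrier G" and "\<omega> \<in> exterior scale" for g \<omega>
  proof -
    have "\<omega> \<in> exterior scale \<and> D (at_group g \<omega>) = D' (at_group g \<omega>)"
      using that(2) unfolding exterior_def
    proof (induction \<omega> rule: fspace.span_induct_alt)
      case base
      have "at_group g 0 = 0" by (auto simp: at_group_def fun_eq_iff)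
      then show ?case using zero fspace.span_zero by metis
    next
      case (step c x y)
      then obtain vs where vs: "x = wedge scale vs" by blast
      have xm: "at_group g x \<in> smash_carrier G scale"
        using at_group_mem[OF g wedge_mem] vs by metis
      have ym: "at_group g y \<in> smash_carrier G scale"
        using at_group_mem[OF g] step.IH unfolding exterior_def by blast
      have cxm: "fscale c (at_group g x) \<in> smash_carrier G scale"
        using xm fspace.subspace_scale[OF subspace_smash_carrier] by blast
      have "fscale c x + y \<in> fspace.span (range (wedge scale))"
        using step by (blast intro: fspace.span_add fspace.span_scale fspace.span_base)
      moreover have "D (at_group g (fscale c x + y)) = D' (at_group g (fscale c x + y))"
        unfolding at_group_lincomb
        using lin xm ym cxm step.IH w[OF g, of vs] vs unfolding linear_map_on_def by metis
      ultimately show ?case by blast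
    qed
    then show ?thesis ..
  qed
  have "(\<Sum>g\<in>K. at_group g (\<lambda>l. a (g, l))) \<in> smash_carrier G scale \<and>
     D (\<Sum>g\<in>K. at_group g (\<lambda>l. a (g, l))) = D' (\<Sum>g\<in>K. at_group g (\<lambda>l. a (g, l)))"
    if "finite K" "K \<subseteq> carrier G" for K
    using that
  proof (induction K)
    case empty
    show ?case unfolding sum.empty using zero fspace.subspace_0[OF subspace_smash_carrier] by blast
  next
    case (insert g K)
    let ?x = "at_group g (\<lambda>l. a (g, l))" and ?s = "\<Sum>g\<in>K. at_group g (\<lambda>l. a (g, l))"
    have e: "(\<lambda>l. a (g, l)) \<in> exterior scale" and g: "g \<in> carrier G"
      using a insert by (auto simp: smash_carrier_def)
    have xm: "?x \<in> smash_carrier G scale" and xe: "D ?x = D' ?x"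
      using at_group_mem[OF g e] \<omega>[OF g e] by auto
    have IH: "?s \<in> smash_carrier G scale" "D ?s = D' ?s"
      using insert by auto
    have "?x + ?s \<in> smash_carrier G scale"
      using xm IH fspace.subspace_add[OF subspace_smash_carrier] by blast
    moreover have "D (?x + ?s) = D' (?x + ?s)"
    proof -
      have "D (?x + ?s) = D ?x + D ?s" "D' (?x + ?s) = D' ?x + D' ?s"
        using lin xm IH(1) unfolding linear_map_on_def by blast+
      then show ?thesis by (simp only: xe IH(2))
    qed
    ultimately show ?case
      unfolding sum.insert[OF insert.hyps] by blast
  qed
  from this[OF finite_carrier subset_refl] show ?thesis
    unfolding smash_carrier_sum[OF a, symmetric] by blast
qed

lemma smash_comult_eq:
  assumes "a \<in> smash_carrier G scale"
  shows "smash_comult G scale \<rho> a = smash_comult_formula a"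
proof -
  have "is_smash_comult G scale \<rho> (smash_comult G scale \<rho>)"
    unfolding smash_comult_def by (rule someI[of "is_smash_comult G scale \<rho>", OF is_smash_comult_formula])
  then show ?thesis using is_smash_comult_unique is_smash_comult_formula assms by blast
qed

lemma smash_counit_mult:
  "smash_counit G (a \<otimes>\<^bsub>smash_algebra G scale \<rho>\<^esub> b) = smash_counit G a * smash_counit G b"
proof -
  have "smash_counit G (a \<otimes>\<^bsub>smash_algebra G scale \<rho>\<^esub> b) =
      (\<Sum>k\<in>carrier G. \<Sum>g\<in>carrier G. a (g, []) * b (inv g \<otimes> k, []))"
    by (simp add: smash_counit_def smash_algebra_def smash_mu_def)
  also have "\<dots> = (\<Sum>g\<in>carrier G. \<Sum>k\<in>carrier G. a (g, []) * b (inv g \<otimes> k, []))"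
    by (rule sum.swap)
  also have "\<dots> = (\<Sum>g\<in>carrier G. \<Sum>h\<in>carrier G. a (g, []) * b (h, []))"
  proof (rule sum.cong[OF refl])
    fix g assume g: "g \<in> carrier G"
    show "(\<Sum>k\<in>carrier G. a (g, []) * b (inv g \<otimes> k, [])) = (\<Sum>h\<in>carrier G. a (g, []) * b (h, []))"
      using g by (intro sum.reindex_bij_witness[where i = "\<lambda>h. g \<otimes> h" and j = "\<lambda>k. inv g \<otimes> k"])
        (auto simp: m_assoc[symmetric])
  qed
  finally show ?thesis by (simp add: smash_counit_def sum_product)
qed

lemma smash_counit_group_elem: "g \<in> carrier G \<Longrightarrow> smash_counit G (smash_group_elem g) = 1"
  using finite_carrier
  by (simp add: smash_counit_def smash_group_elem_def at_group_def ext_one_def)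

lemma smash_counit_vec: "smash_counit G (smash_embed G a) = 0"
  by (simp add: smash_counit_def smash_embed_def at_group_def ext_embed_def cong: if_cong)

end

end

theory Submission
  imports Defs
begin

text \<open>
  Elements of \<open>V \<otimes> V\<close> are even, nilpotent and commute with each other inside \<open>\<Lambda>V \<otimes> \<Lambda>V\<close>, so
  \<open>e\<^sup>B\<close> is invertible with inverse \<open>e\<^sup>-\<^sup>B\<close> and \<open>e\<^sup>B\<^sup>+\<^sup>C = e\<^sup>B e\<^sup>C\<close>. If \<open>C\<close> is \<open>G\<close>-invariant,
  then \<open>e\<^sup>C\<close> commutes with all \<open>\<Delta>(x)\<close>, so \<open>B\<close> and \<open>B + C\<close> give the same twisted coproduct. Hence
  a pair \<open>(\<phi>, \<eta>)\<close> as in the theorem induces an isomorphism by transport of structure.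

  Conversely, let \<open>F\<close> be a homomorphism of Hopf algebras and let \<open>I\<close> be the ideal generated by
  \<open>V\<close>. Since \<open>u\<close> is grouplike and \<open>v\<close> is skew primitive with \<open>v\<^sup>2 = 0\<close>, \<open>F\<close> maps \<open>v\<close> into
  \<open>I\<close>, and so it preserves the filtration by powers of \<open>I\<close>. Comparing the coproducts of \<open>F(v)\<close> and
  \<open>F(g)\<close> in bidegrees \<open>(0, 0)\<close>, \<open>(1, 0)\<close> and \<open>(0, 1)\<close> gives \<open>F(g) = \<phi>(g)\<close> and
  \<open>F(v) = \<eta>(v)\<close> modulo \<open>I\<^sup>2\<close>, with \<open>\<phi>(u\<^sub>1) = u\<^sub>2\<close> as soon as \<open>\<eta> \<noteq> 0\<close>. In bidegree
  \<open>(1, 1)\<close> the coproduct of \<open>g\<close> is \<open>g \<cdot> B - B\<close>, up to an antisymmetric term coming from the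
  degree two part of \<open>F(g)\<close>; the symmetric parts yield the invariance of \<open>(\<eta> \<otimes> \<eta>)(B\<^sub>1) - B\<^sub>2\<close>.
\<close>

section \<open>Shuffle products and super multiplications\<close>

text \<open>Elements are functions of a group element and a list of functionals. The component of
  degree d is the value at lists of length d, an element lies in \<open>I^n\<close> iff it vanishes
  on lists shorter than n, and comparing coefficients means evaluating.

  The obstacle is that \<open>F\<close> need not respect any grading, and that a general
  \<open>g\<close> is not grouplike in \<open>A(G, V, u, B)\<close>. Control starts from the
  elements whose coproducts the twist leaves alone: tensors in \<open>V \<otimes> V\<close> are
  even, so they commute with \<open>v \<otimes> 1 + 1 \<otimes> v\<close>, and \<open>u\<close> acts
  on \<open>V \<otimes> V\<close> by \<open>(-1)(-1) = 1\<close>. Only after these have shown that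
  \<open>F\<close> preserves the filtration can the coproduct of \<open>g\<close> be studied modulo
  higher terms.

  The element \<open>u\<close> also separates components: even second factors stay over
  \<open>(k, k)\<close>, odd ones move to \<open>(u k, k)\<close>, and \<open>u k\<close> differs
  from \<open>k\<close>. This removes the degree one part of \<open>F(g)\<close>, whose tensor
  square would otherwise appear in bidegree \<open>(1, 1)\<close>.

  Bijectivity of \<phi> and \<eta> comes from applying the construction to the inverse of
  \<open>F\<close>: modulo \<open>I\<close>, respectively \<open>I^2\<close>, the two results are
  mutually inverse. Injectivity of \<eta> and \<open>V_1 \<noteq> 0\<close> then give \<eta>
  \<noteq> 0.\<close>

lemma shuffle_cong:
  assumes "\<And>l m. length l + length m = length fs \<Longrightarrow> s (l, m) = t (l, m)"
  shows "shuffle s fs = shuffle t fs"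
  using assms
proof (induction fs arbitrary: s t)
  case (Cons f fs)
  have "shuffle (\<lambda>(l, m). s (f # l, m)) fs = shuffle (\<lambda>(l, m). t (f # l, m)) fs"
    by (rule Cons.IH) (simp add: Cons.prems)
  moreover have "shuffle (\<lambda>(l, m). (-1) ^ length l * s (l, f # m)) fs =
      shuffle (\<lambda>(l, m). (-1) ^ length l * t (l, f # m)) fs"
    by (rule Cons.IH) (simp add: Cons.prems)
  ultimately show ?case by simp
qed simp

lemma shuffle_add_apply: "shuffle (\<lambda>p. s p + t p) fs = shuffle s fs + shuffle t fs"
  using shuffle_add[of s t] by (simp add: plus_fun_def)

lemma shuffle_scale_apply: "shuffle (\<lambda>p. c * t p) fs = c * shuffle t fs"
  using shuffle_scale[of c t] by (simp add: fscale_def)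

lemma shuffle_swap:
  "shuffle (\<lambda>i. shuffle (\<lambda>j. s i j) gs) fs = shuffle (\<lambda>j. shuffle (\<lambda>i. s i j) fs) gs"
proof (induction fs arbitrary: s)
  case (Cons f fs)
  show ?case
    by (simp add: case_prod_beta' shuffle_add_apply Cons.IH flip: shuffle_scale_apply)
qed simp

text \<open>Both sides run over the splittings of \<open>fs\<close> into three complementary
  subsequences, with the sign of the permutation from \<open>fs\<close> to
  \<open>l @ m @ n\<close>.\<close>

lemma shuffle_assoc:
  "shuffle (\<lambda>(p, n). shuffle (\<lambda>(l, m). t l m n) p) fs =
   shuffle (\<lambda>(l, q). shuffle (\<lambda>(m, n). t l m n) q) fs"
proof (induction fs arbitrary: t)
  case (Cons f fs)
  \<comment> \<open>An entry that goes to the third part jumps over \<open>p\<close>, whose length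
    is the sum of those of \<open>l\<close> and \<open>m\<close>.\<close>
  have sgn: "(-1) ^ length p * shuffle (\<lambda>(l, m). t l m (f # n)) p =
      shuffle (\<lambda>(l, m). (-1) ^ (length l + length m) * t l m (f # n)) p" for p n
    unfolding shuffle_scale_apply[symmetric] by (rule shuffle_cong) simp
  have "shuffle (\<lambda>(p, n). shuffle (\<lambda>(l, m). t l m n) p) (f # fs) =
      shuffle (\<lambda>(p, n). shuffle (\<lambda>(l, m). t (f # l) m n) p) fs +
      shuffle (\<lambda>(p, n). shuffle (\<lambda>(l, m). (-1) ^ length l * t l (f # m) n) p) fs +
      shuffle (\<lambda>(p, n). shuffle (\<lambda>(l, m). (-1) ^ (length l + length m) * t l m (f # n)) p) fs"
    by (simp only: shuffle.simps prod.case sgn) (simp add: case_prod_beta' shuffle_add_apply)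
  also have "\<dots> = shuffle (\<lambda>(l, q). shuffle (\<lambda>(m, n). t (f # l) m n) q) fs +
      shuffle (\<lambda>(l, q). shuffle (\<lambda>(m, n). (-1) ^ length l * t l (f # m) n) q) fs +
      shuffle (\<lambda>(l, q). shuffle (\<lambda>(m, n). (-1) ^ (length l + length m) * t l m (f # n)) q) fs"
    by (simp only: Cons.IH)
  also have "\<dots> = shuffle (\<lambda>(l, q). shuffle (\<lambda>(m, n). t l m n) q) (f # fs)"
    by (simp add: case_prod_beta' power_add mult.assoc distrib_left shuffle_add_apply shuffle_scale_apply)
  finally show ?case .
qed simp

lemma ext_mult_assoc: "ext_mult (ext_mult a b) c = ext_mult a (ext_mult b c)"
proof
  fix fs
  have "ext_mult (ext_mult a b) c fs = shuffle (\<lambda>(p, n). shuffle (\<lambda>(l, m). c n * (a l * b m)) p) fs"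
    by (simp add: ext_mult_def pure_tensor_def case_prod_beta' shuffle_scale_apply mult.commute[of _ "c _"])
  also have "\<dots> = shuffle (\<lambda>(l, q). shuffle (\<lambda>(m, n). a l * (b m * c n)) q) fs"
    by (subst shuffle_assoc) (simp only: mult_ac)
  also have "\<dots> = ext_mult a (ext_mult b c) fs"
    by (simp add: ext_mult_def pure_tensor_def case_prod_beta' shuffle_scale_apply)
  finally show "ext_mult (ext_mult a b) c fs = ext_mult a (ext_mult b c) fs" .
qed

section \<open>Spans, bilinear maps and tensor products\<close>

lemma span_bilinear_mem:
  assumes add1: "\<And>x y z. m (x + y) z = m x z + m y z" and sc1: "\<And>c x y. m (fscale c x) y = fscale c (m x y)"
    and add2: "\<And>x y z. m x (y + z) = m x y + m x z" and sc2: "\<And>c x y. m x (fscale c y) = fscale c (m x y)"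
    and W: "fspace.subspace W" and S: "\<And>s t. s \<in> S \<Longrightarrow> t \<in> S' \<Longrightarrow> m s t \<in> W"
    and x: "x \<in> fspace.span S" and y: "y \<in> fspace.span S'"
  shows "m x y \<in> W"
proof -
  have m0: "m 0 y = 0" "m x 0 = 0" for x y
    using sc1[of 0 0 y] sc2[of x 0 0] by (simp_all add: fspace.scale_zero_left)
  have *: "m s y \<in> W" if "s \<in> S" for s
    using y
  proof (induction y rule: fspace.span_induct_alt)
    case (step c t z)
    then show ?case
      unfolding add2 sc2 using S[OF that] by (intro fspace.subspace_add[OF W] fspace.subspace_scale[OF W]) auto
  qed (unfold m0, rule fspace.subspace_0[OF W])
  show ?thesis
    using x
  proof (induction x rule: fspace.span_induct_alt)
    case (step c s z)
    then show ?case
      unfolding add1 sc1 using * by (intro fspace.subspace_add[OF W] fspace.subspace_scale[OF W]) auto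
  qed (unfold m0, rule fspace.subspace_0[OF W])
qed

lemma pure_tensor_bilinear:
  "pure_tensor (a + b) c = pure_tensor a c + pure_tensor b c"
  "pure_tensor (fscale k a) c = fscale k (pure_tensor a c)"
  "pure_tensor a (c + d) = pure_tensor a c + pure_tensor a d"
  "pure_tensor a (fscale k c) = fscale k (pure_tensor a c)"
  by (auto simp: fun_eq_iff algebra_simps)

lemma tensor_space_span:
  "tensor_space (fspace.span S) (fspace.span S') = fspace.span {pure_tensor a b | a b. a \<in> S \<and> b \<in> S'}"
  (is "?L = ?R")
proof
  have "pure_tensor a b \<in> ?R" if "a \<in> fspace.span S" "b \<in> fspace.span S'" for a b
  proof (rule span_bilinear_mem[where m = pure_tensor and S = S and S' = S'])
  qed (rule pure_tensor_bilinear fspace.subspace_span that | (rule fspace.span_base, blast))+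
  then show "?L \<subseteq> ?R"
    unfolding tensor_space_def by (intro fspace.span_minimal) auto
  show "?R \<subseteq> ?L"
    unfolding tensor_space_def by (intro fspace.span_mono) (auto intro: fspace.span_base)
qed

section \<open>Associativity of the super tensor product and of the smash product\<close>

context
  fixes \<mu> :: "('x \<times> 'x \<Rightarrow> complex) \<Rightarrow> 'x \<Rightarrow> complex" and p :: "'x \<Rightarrow> nat"
  assumes graded: "\<And>s t z. (\<And>x y. p x + p y = p z \<Longrightarrow> s (x, y) = t (x, y)) \<Longrightarrow> \<mu> s z = \<mu> t z"
    and scale: "\<And>c t z. \<mu> (\<lambda>i. c * t i) z = c * \<mu> t z"
    and swap: "\<And>s x y. \<mu> (\<lambda>i. \<mu> (\<lambda>j. s i j) y) x = \<mu> (\<lambda>j. \<mu> (\<lambda>i. s i j) x) y"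
    and assoc: "\<And>s z. \<mu> (\<lambda>(x, y). \<mu> (\<lambda>(x1, x2). s x1 x2 y) x) z =
      \<mu> (\<lambda>(x, y). \<mu> (\<lambda>(y1, y2). s x y1 y2) y) z"
begin

text \<open>Both sides are sums of the same weight \<open>w\<close>, whose sign records each
  \<open>y_i\<close> passing each \<open>x_j\<close> with \<open>i < j\<close>. Here
  \<open>graded\<close> replaces the degree of a product by the sum of the degrees of its
  factors.\<close>

lemma super_tensor_mult_assoc:
  "super_tensor_mult \<mu> p (super_tensor_mult \<mu> p t t') t'' =
   super_tensor_mult \<mu> p t (super_tensor_mult \<mu> p t' t'')"
proof (intro ext, clarify)
  fix x y
  define w where "w x1 x2 x3 y1 y2 y3 = (-1) ^ (p y1 * p x2 + p y1 * p x3 + p y2 * p x3) *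
    (t (x1, y1) * t' (x2, y2) * t'' (x3, y3))" for x1 x2 x3 y1 y2 y3
  have pull: "c * \<mu> (\<lambda>i. \<mu> (\<lambda>j. s i j) y) x = \<mu> (\<lambda>i. \<mu> (\<lambda>j. c * s i j) y) x" for c s x y
    by (simp add: scale)
  have L1: "(-1) ^ (p y0 * p x3) * super_tensor_mult \<mu> p t t' (x0, y0) * t'' (x3, y3) =
      \<mu> (\<lambda>(x1, x2). \<mu> (\<lambda>(y1, y2). w x1 x2 x3 y1 y2 y3) y0) x0" for x0 x3 y0 y3
  proof -
    have "(-1) ^ (p y0 * p x3) * super_tensor_mult \<mu> p t t' (x0, y0) * t'' (x3, y3) =
      ((-1) ^ (p y0 * p x3) * t'' (x3, y3)) *
        \<mu> (\<lambda>i. \<mu> (\<lambda>j. (-1) ^ (p (fst j) * p (snd i)) * t (fst i, fst j) * t' (snd i, snd j)) y0) x0"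
      by (simp add: super_tensor_mult_def case_prod_beta')
    also have "\<dots> = \<mu> (\<lambda>i. \<mu> (\<lambda>j. ((-1) ^ (p y0 * p x3) * t'' (x3, y3)) *
        ((-1) ^ (p (fst j) * p (snd i)) * t (fst i, fst j) * t' (snd i, snd j))) y0) x0"
      by (rule pull)
    also have "\<dots> = \<mu> (\<lambda>(x1, x2). \<mu> (\<lambda>(y1, y2). w x1 x2 x3 y1 y2 y3) y0) x0"
      unfolding case_prod_beta'
    proof (intro arg_cong[where f = "\<lambda>f. \<mu> f x0"] ext graded)
      fix i y1 y2 assume "p y1 + p y2 = p y0"
      then have "p y0 * p x3 = p y1 * p x3 + p y2 * p x3" by (metis distrib_right)
      then show "(-1) ^ (p y0 * p x3) * t'' (x3, y3) *
         ((-1) ^ (p (fst (y1, y2)) * p (snd i)) * t (fst i, fst (y1, y2)) * t' (snd i, snd (y1, y2))) =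
         w (fst i) (snd i) x3 (fst (y1, y2)) (snd (y1, y2)) y3"
        by (simp add: w_def power_add mult_ac)
    qed
    finally show ?thesis .
  qed
  have R1: "(-1) ^ (p y1 * p x0) * t (x1, y1) * super_tensor_mult \<mu> p t' t'' (x0, y0) =
      \<mu> (\<lambda>(x2, x3). \<mu> (\<lambda>(y2, y3). w x1 x2 x3 y1 y2 y3) y0) x0" for x0 x1 y0 y1
  proof -
    have "(-1) ^ (p y1 * p x0) * t (x1, y1) * super_tensor_mult \<mu> p t' t'' (x0, y0) =
      ((-1) ^ (p y1 * p x0) * t (x1, y1)) *
        \<mu> (\<lambda>i. \<mu> (\<lambda>j. (-1) ^ (p (fst j) * p (snd i)) * t' (fst i, fst j) * t'' (snd i, snd j)) y0) x0"
      by (simp add: super_tensor_mult_def case_prod_beta')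
    also have "\<dots> = \<mu> (\<lambda>i. \<mu> (\<lambda>j. ((-1) ^ (p y1 * p x0) * t (x1, y1)) *
        ((-1) ^ (p (fst j) * p (snd i)) * t' (fst i, fst j) * t'' (snd i, snd j))) y0) x0"
      by (rule pull)
    also have "\<dots> = \<mu> (\<lambda>(x2, x3). \<mu> (\<lambda>(y2, y3). w x1 x2 x3 y1 y2 y3) y0) x0"
      unfolding case_prod_beta'
    proof (rule graded, intro arg_cong[where f = "\<lambda>f. \<mu> f y0"] ext)
      fix x2 x3 j assume "p x2 + p x3 = p x0"
      then have "p y1 * p x0 = p y1 * p x2 + p y1 * p x3" by (metis distrib_left)
      then show "(-1) ^ (p y1 * p x0) * t (x1, y1) *
         ((-1) ^ (p (fst j) * p (snd (x2, x3))) * t' (fst (x2, x3), fst j) * t'' (snd (x2, x3), snd j)) =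
         w x1 (fst (x2, x3)) (snd (x2, x3)) y1 (fst j) (snd j)"
        by (simp add: w_def power_add mult_ac)
    qed
    finally show ?thesis .
  qed
  have "super_tensor_mult \<mu> p (super_tensor_mult \<mu> p t t') t'' (x, y) =
     \<mu> (\<lambda>i. \<mu> (\<lambda>j. \<mu> (\<lambda>i'. \<mu> (\<lambda>j'. w (fst i') (snd i') (snd i) (fst j') (snd j') (snd j)) (fst j)) (fst i)) y) x"
    by (subst super_tensor_mult_def) (simp only: L1 case_prod_beta' fst_conv snd_conv prod.collapse)
  \<comment> \<open>The \<open>x\<close> variables are gathered outside the \<open>y\<close>
    variables, so that associativity can be used once in each tensor factor.\<close>
  also have "\<dots> = \<mu> (\<lambda>i. \<mu> (\<lambda>i'. \<mu> (\<lambda>j. \<mu> (\<lambda>j'. w (fst i') (snd i') (snd i) (fst j') (snd j') (snd j)) (fst j)) y) (fst i)) x"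
    by (subst swap) (rule refl)
  also have "\<dots> = \<mu> (\<lambda>(x0, x3). \<mu> (\<lambda>(x1, x2). \<mu> (\<lambda>(y1, y0). \<mu> (\<lambda>(y2, y3). w x1 x2 x3 y1 y2 y3) y0) y) x0) x"
    using assoc[of "\<lambda>y1 y2 y3. w _ _ _ y1 y2 y3" y] by (simp only: case_prod_beta')
  also have "\<dots> = \<mu> (\<lambda>(x1, x0). \<mu> (\<lambda>(x2, x3). \<mu> (\<lambda>(y1, y0). \<mu> (\<lambda>(y2, y3). w x1 x2 x3 y1 y2 y3) y0) y) x0) x"
    by (rule assoc)
  also have "\<dots> = \<mu> (\<lambda>i. \<mu> (\<lambda>j. \<mu> (\<lambda>i'. \<mu> (\<lambda>j'. w (fst i) (fst i') (snd i') (fst j) (fst j') (snd j')) (snd j)) (snd i)) y) x"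
    unfolding case_prod_beta' by (subst swap) (rule refl)
  also have "\<dots> = super_tensor_mult \<mu> p t (super_tensor_mult \<mu> p t' t'') (x, y)"
    by (subst super_tensor_mult_def) (simp only: R1 case_prod_beta' fst_conv snd_conv prod.collapse)
  finally show "super_tensor_mult \<mu> p (super_tensor_mult \<mu> p t t') t'' (x, y) =
    super_tensor_mult \<mu> p t (super_tensor_mult \<mu> p t' t'') (x, y)" .
qed

end

lemma smash_mu_apply:
  "k \<in> carrier G \<Longrightarrow> smash_mu G \<rho> t (k, fs) =
     (\<Sum>g\<in>carrier G. shuffle (\<lambda>(l, m). t ((g, l), (inv\<^bsub>G\<^esub> g \<otimes>\<^bsub>G\<^esub> k, map (\<lambda>f. f \<circ> \<rho> g) m))) fs)"
  "k \<notin> carrier G \<Longrightarrow> smash_mu G \<rho> t (k, fs) = 0"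
  by (simp_all add: smash_mu_def)

lemma smash_mu_cong:
  assumes "\<And>x y. smash_parity x + smash_parity y = smash_parity z \<Longrightarrow> s (x, y) = t (x, y)"
  shows "smash_mu G \<rho> s z = smash_mu G \<rho> t z"
proof (cases z)
  case (Pair k fs)
  show ?thesis
    unfolding smash_mu_def Pair prod.case using assms
    by (intro if_cong sum.cong refl shuffle_cong) (auto simp: Pair smash_parity_def)
qed

lemma smash_mu_scale_apply: "smash_mu G \<rho> (\<lambda>i. c * t i) z = c * smash_mu G \<rho> t z"
  using smash_mu_scale[of G \<rho> c t] by (simp add: fscale_def)

lemma smash_mu_add_apply: "smash_mu G \<rho> (\<lambda>i. s i + t i) z = smash_mu G \<rho> s z + smash_mu G \<rho> t z"
  using smash_mu_add[of G \<rho> s t] by (simp add: plus_fun_def)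

lemma smash_mu_swap:
  "smash_mu G \<rho> (\<lambda>i. smash_mu G \<rho> (\<lambda>j. s i j) y) x = smash_mu G \<rho> (\<lambda>j. smash_mu G \<rho> (\<lambda>i. s i j) x) y"
proof -
  obtain k fs k' gs where [simp]: "x = (k, fs)" "y = (k', gs)" by fastforce
  show ?thesis
  proof (cases "k \<in> carrier G \<and> k' \<in> carrier G")
    case True
    then show ?thesis
      by (simp add: smash_mu_apply case_prod_beta' shuffle_sum)
        (subst sum.swap, intro sum.cong refl, rule shuffle_swap)
  qed (auto simp: smash_mu_def case_prod_beta')
qed

context finite_group_rep
begin

text \<open>The group sums are matched by substituting \<open>h \<otimes> g\<close> for
  \<open>g\<close>, the lists by \<open>shuffle_assoc\<close>. The form with a function of three
  variables, rather than three elements, is what associativity on the tensor square calls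
  for.\<close>

lemma smash_mu_assoc:
  "smash_mu G \<rho> (\<lambda>(x, y). smash_mu G \<rho> (\<lambda>(x1, x2). s x1 x2 y) x) z =
   smash_mu G \<rho> (\<lambda>(x, y). smash_mu G \<rho> (\<lambda>(y1, y2). s x y1 y2) y) z"
proof (cases z)
  case (Pair k fs)
  show ?thesis
  proof (cases "k \<in> carrier G")
    case k: True
    define r where "r g m = map (\<lambda>f. f \<circ> \<rho> g) m" for g and m :: "('v \<Rightarrow> complex) list"
    \<comment> \<open>Precomposition of functionals is contravariant, so \<open>g\<close> acts on
      the list before \<open>h\<close> does.\<close>
    have r: "r (g \<otimes> h) m = r h (r g m)" if "g \<in> carrier G" "h \<in> carrier G" for g h m
      using that by (simp add: r_def rep_mult fun_eq_iff)
    have "smash_mu G \<rho> (\<lambda>(x, y). smash_mu G \<rho> (\<lambda>(x1, x2). s x1 x2 y) x) z =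
      (\<Sum>g\<in>carrier G. \<Sum>h\<in>carrier G. shuffle (\<lambda>(p, n). shuffle (\<lambda>(l, m).
        s (h, l) (inv h \<otimes> g, r h m) (inv g \<otimes> k, r g n)) p) fs)"
      using k by (simp add: Pair smash_mu_apply case_prod_beta' shuffle_sum r_def)
    also have "\<dots> = (\<Sum>h\<in>carrier G. \<Sum>g\<in>carrier G. shuffle (\<lambda>(l, q). shuffle (\<lambda>(m, n).
        s (h, l) (inv h \<otimes> g, r h m) (inv g \<otimes> k, r g n)) q) fs)"
      unfolding shuffle_assoc by (rule sum.swap)
    also have "\<dots> = (\<Sum>h\<in>carrier G. \<Sum>g\<in>carrier G. shuffle (\<lambda>(l, q). shuffle (\<lambda>(m, n).
        s (h, l) (g, r h m) (inv g \<otimes> (inv h \<otimes> k), r g (r h n))) q) fs)"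
    proof (rule sum.cong[OF refl])
      fix h assume h: "h \<in> carrier G"
      have hh: "inv h \<otimes> (h \<otimes> g) = g" "h \<otimes> (inv h \<otimes> g) = g" if "g \<in> carrier G" for g
        using h that by (simp_all add: m_assoc[symmetric])
      have k': "inv (inv h \<otimes> g) \<otimes> (inv h \<otimes> k) = inv g \<otimes> k" if "g \<in> carrier G" for g
      proof -
        have "inv (inv h \<otimes> g) \<otimes> (inv h \<otimes> k) = inv g \<otimes> (h \<otimes> inv h \<otimes> k)"
          using h k that by (simp only: inv_mult_group m_assoc inv_closed inv_inv m_closed)
        then show ?thesis using h k that by simp
      qed
      have r': "r (inv h \<otimes> g) (r h n) = r g n" if "g \<in> carrier G" for g n
        using h that r[of h "inv h \<otimes> g" n] by (simp add: m_assoc[symmetric])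
      show "(\<Sum>g\<in>carrier G. shuffle (\<lambda>(l, q). shuffle (\<lambda>(m, n).
          s (h, l) (inv h \<otimes> g, r h m) (inv g \<otimes> k, r g n)) q) fs) =
        (\<Sum>g\<in>carrier G. shuffle (\<lambda>(l, q). shuffle (\<lambda>(m, n).
          s (h, l) (g, r h m) (inv g \<otimes> (inv h \<otimes> k), r g (r h n))) q) fs)"
        using h k by (intro sum.reindex_bij_witness[where i = "\<lambda>g. h \<otimes> g" and j = "\<lambda>g. inv h \<otimes> g"])
          (auto simp: k' r' hh)
    qed
    also have "\<dots> = smash_mu G \<rho> (\<lambda>(x, y). smash_mu G \<rho> (\<lambda>(y1, y2). s x y1 y2) y) z"
      using k by (simp add: Pair smash_mu_apply case_prod_beta' shuffle_sum r_def shuffle_map)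
    finally show ?thesis .
  qed (simp add: Pair smash_mu_def)
qed

abbreviation (input) "A \<equiv> smash_algebra G scale \<rho>"
abbreviation (input) "T \<equiv> smash_tensor G scale \<rho>"
abbreviation (input) "e \<equiv> smash_group_elem"

lemma smash_tensor_assoc: "(a \<otimes>\<^bsub>T\<^esub> b) \<otimes>\<^bsub>T\<^esub> c = a \<otimes>\<^bsub>T\<^esub> (b \<otimes>\<^bsub>T\<^esub> c)"
  unfolding smash_tensor_def monoid.simps
  by (rule super_tensor_mult_assoc) (rule smash_mu_cong smash_mu_scale_apply smash_mu_swap smash_mu_assoc, assumption?)+

lemma smash_tensor_add_left: "(a + b) \<otimes>\<^bsub>T\<^esub> c = a \<otimes>\<^bsub>T\<^esub> c + b \<otimes>\<^bsub>T\<^esub> c"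
  and smash_tensor_add_right: "a \<otimes>\<^bsub>T\<^esub> (b + c) = a \<otimes>\<^bsub>T\<^esub> b + a \<otimes>\<^bsub>T\<^esub> c"
  by (auto simp: smash_tensor_def super_tensor_mult_def case_prod_beta' fun_eq_iff algebra_simps smash_mu_add_apply)

lemma smash_tensor_scale_left: "fscale k a \<otimes>\<^bsub>T\<^esub> c = fscale k (a \<otimes>\<^bsub>T\<^esub> c)"
  and smash_tensor_scale_right: "a \<otimes>\<^bsub>T\<^esub> fscale k c = fscale k (a \<otimes>\<^bsub>T\<^esub> c)"
  by (auto simp: smash_tensor_def super_tensor_mult_def case_prod_beta' fun_eq_iff mult.assoc mult.left_commute[of _ k]
      smash_mu_scale_apply)

lemma smash_mult_bilinear:
  "(a + b) \<otimes>\<^bsub>A\<^esub> c = a \<otimes>\<^bsub>A\<^esub> c + b \<otimes>\<^bsub>A\<^esub> c"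
  "a \<otimes>\<^bsub>A\<^esub> (b + c) = a \<otimes>\<^bsub>A\<^esub> b + a \<otimes>\<^bsub>A\<^esub> c"
  "fscale k a \<otimes>\<^bsub>A\<^esub> c = fscale k (a \<otimes>\<^bsub>A\<^esub> c)"
  "a \<otimes>\<^bsub>A\<^esub> fscale k c = fscale k (a \<otimes>\<^bsub>A\<^esub> c)"
  by (simp_all add: smash_algebra_def pure_tensor_bilinear smash_mu_add smash_mu_scale)

lemma smash_carrier_span:
  "smash_carrier G scale = fspace.span {at_group g (wedge scale vs) | g vs. g \<in> carrier G}"
proof
  show "fspace.span {at_group g (wedge scale vs) | g vs. g \<in> carrier G} \<subseteq> smash_carrier G scale"
    by (rule fspace.span_minimal[OF _ subspace_smash_carrier]) (auto intro: at_group_mem wedge_mem)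
  have "at_group g \<omega> \<in> fspace.span {at_group g (wedge scale vs) | g vs. g \<in> carrier G}" (is "_ \<in> ?S")
    if g: "g \<in> carrier G" and "\<omega> \<in> exterior scale" for g \<omega>
    using that(2) unfolding exterior_def
  proof (induction \<omega> rule: fspace.span_induct_alt)
    case base
    have "at_group g 0 = 0" by (auto simp: at_group_def fun_eq_iff)
    then show ?case using fspace.span_zero by metis
  next
    case (step c x y)
    then have "at_group g x \<in> ?S"
      using g by (intro fspace.span_base) blast
    then show ?case
      unfolding at_group_lincomb using step.IH by (intro fspace.span_add fspace.span_scale)
  qed
  then have "(\<Sum>g\<in>carrier G. at_group g (\<lambda>l. a (g, l))) \<in> ?S" if "a \<in> smash_carrier G scale" for a
    using that by (intro fspace.span_sum) (auto simp: smash_carrier_def)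
  then show "smash_carrier G scale \<subseteq> ?S"
    using smash_carrier_sum by fastforce
qed

end

section \<open>Exponential series\<close>

lemma linear_eq_on_span:
  assumes "\<And>x y. f (x + y) = f x + f y" "\<And>c x. f (fscale c x) = fscale c (f x)"
    and "\<And>x y. g (x + y) = g x + g y" "\<And>c x. g (fscale c x) = fscale c (g x)"
    and "\<And>s. s \<in> S \<Longrightarrow> f s = g s" and "x \<in> fspace.span S"
  shows "f x = g x"
  using assms(6)
proof (induction x rule: fspace.span_induct_alt)
  case base
  show ?case using assms(2)[of 0 0] assms(4)[of 0 0] by (simp only: fspace.scale_zero_left)
next
  case (step c s y)
  then show ?case by (simp only: assms(1-4)) (simp add: assms(5))
qed

section \<open>Degrees, products and functoriality in the exterior algebra\<close>

lemma wedge_length: "wedge scale vs l \<noteq> 0 \<Longrightarrow> length l = length vs"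
proof (induction vs arbitrary: l)
  case Nil
  then show ?case by (auto simp: wedge_Nil ext_one_def split: if_splits)
next
  case (Cons v vs)
  show ?case
  proof (rule ccontr)
    assume len: "length l \<noteq> length (v # vs)"
    have "pure_tensor (ext_embed (vec scale v)) (wedge scale vs) (l1, l2) = 0"
      if "length l1 + length l2 = length l" for l1 l2
      using that len Cons.IH[of l2] by (auto simp: ext_embed_def split: list.splits)
    then have "wedge scale (v # vs) l = shuffle (\<lambda>_. 0) l"
      unfolding wedge_Cons ext_mult_def by (intro shuffle_cong) simp
    with Cons.prems show False by simp
  qed
qed

lemma ext_mult_mem:
  assumes "\<alpha> \<in> exterior scale" "\<beta> \<in> exterior scale"
  shows "ext_mult \<alpha> \<beta> \<in> exterior scale"
proof (rule span_bilinear_mem[where m = ext_mult and S = "range (wedge scale)" and S' = "range (wedge scale)"])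
  fix x y z :: "('a \<Rightarrow> complex) list \<Rightarrow> complex" and c
  show "ext_mult (x + y) z = ext_mult x z + ext_mult y z"
    by (simp add: ext_mult_def pure_tensor_bilinear shuffle_add)
  show "ext_mult (fscale c x) y = fscale c (ext_mult x y)"
    by (rule ext_mult_scale_left)
  show "ext_mult x (y + z) = ext_mult x y + ext_mult x z"
    by (rule ext_mult_add_right)
  show "ext_mult x (fscale c y) = fscale c (ext_mult x y)"
    by (rule ext_mult_scale_right)
next
  fix s t assume "s \<in> range (wedge scale)" "t \<in> range (wedge scale)"
  moreover have "ext_mult (wedge scale vs) (wedge scale ws) = wedge scale (vs @ ws)" for vs ws
    by (induction vs) (simp_all add: wedge_Nil wedge_Cons ext_one_mult ext_mult_assoc)
  ultimately show "ext_mult s t \<in> exterior scale"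
    using wedge_mem by fastforce
qed (use assms subspace_exterior in \<open>simp_all add: exterior_def\<close>)

text \<open>Since \<open>vec\<close> extends by zero outside the dual space, pulling back along
  \<eta> is harmless only if membership in the dual space is reflected as well as preserved. The
  one-sided inverse gives this through \<open>f \<circ> \<eta> \<circ> \<eta>' = f\<close>.\<close>

lemma dual_space_comp_iff:
  assumes "Vector_Spaces.linear scale scale' \<eta>" "Vector_Spaces.linear scale' scale \<eta>'"
    and "\<And>w. \<eta> (\<eta>' w) = w"
  shows "f \<circ> \<eta> \<in> dual_space scale \<longleftrightarrow> f \<in> dual_space scale'"
proof
  assume "f \<circ> \<eta> \<in> dual_space scale"
  moreover have "f \<circ> \<eta> \<circ> \<eta>' = f"
    using assms(3) by (simp add: fun_eq_iff)
  ultimately show "f \<in> dual_space scale'"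
    using Vector_Spaces.linear_compose[OF assms(2), of "(*)" "f \<circ> \<eta>"] by (simp add: dual_space_def)
next
  assume "f \<in> dual_space scale'"
  then show "f \<circ> \<eta> \<in> dual_space scale"
    using Vector_Spaces.linear_compose[OF assms(1)] by (simp add: dual_space_def)
qed

lemma wedge_map:
  assumes "Vector_Spaces.linear scale scale' \<eta>" "Vector_Spaces.linear scale' scale \<eta>'"
    and "\<And>w. \<eta> (\<eta>' w) = w"
  shows "wedge scale vs (map (\<lambda>f. f \<circ> \<eta>) l) = wedge scale' (map \<eta> vs) l"
proof (induction vs arbitrary: l)
  case Nil
  then show ?case by (simp add: wedge_Nil ext_one_def)
next
  case (Cons v vs)
  have "vec scale v (f \<circ> \<eta>) = vec scale' (\<eta> v) f" for f
    using dual_space_comp_iff[OF assms] by (simp add: vec_def)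
  then have "ext_embed (vec scale v) (map (\<lambda>f. f \<circ> \<eta>) l) = ext_embed (vec scale' (\<eta> v)) l" for l
    by (auto simp: ext_embed_def split: list.splits)
  then show ?case
    unfolding wedge_Cons list.map ext_mult_def shuffle_map pure_tensor_def case_prod_beta' fst_conv snd_conv Cons.IH
    by (simp only:)
qed

text \<open>Bilinearity is asked of all functions and only the monoid laws are confined to the
  carrier, so sums and scalars move through products without membership conditions.\<close>

locale function_algebra = monoid T for T :: "('x \<Rightarrow> complex) monoid" (structure) +
  assumes subspace_carrier: "fspace.subspace (carrier T)"
    and add_left: "(a + b) \<otimes> c = a \<otimes> c + b \<otimes> c" and add_right: "a \<otimes> (b + c) = a \<otimes> b + a \<otimes> c"
    and scale_left: "fscale k a \<otimes> c = fscale k (a \<otimes> c)" and scale_right: "a \<otimes> fscale k c = fscale k (a \<otimes> c)"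
begin

lemmas carrier_zero [simp] = fspace.subspace_0[OF subspace_carrier]
  and carrier_add [simp] = fspace.subspace_add[OF subspace_carrier]
  and carrier_scale [simp] = fspace.subspace_scale[OF subspace_carrier]
  and carrier_sum = fspace.subspace_sum[OF subspace_carrier]

lemma zero_left [simp]: "0 \<otimes> c = 0" and zero_right [simp]: "a \<otimes> 0 = 0"
  using scale_left[of 0 0 c] scale_right[of a 0 0] by (simp_all only: fspace.scale_zero_left)

lemma sum_left: "(\<Sum>i\<in>I. f i) \<otimes> c = (\<Sum>i\<in>I. f i \<otimes> c)"
  using sum_comp_morphism[of "\<lambda>x. x \<otimes> c" f I] by (simp add: add_left comp_def)

lemma sum_right: "c \<otimes> (\<Sum>i\<in>I. f i) = (\<Sum>i\<in>I. c \<otimes> f i)"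
  using sum_comp_morphism[of "\<lambda>x. c \<otimes> x" f I] by (simp add: add_right comp_def)

text \<open>Divided powers: their binomial formula has no coefficients, and the exponential is their
  plain sum.\<close>

definition divpow :: "nat \<Rightarrow> ('x \<Rightarrow> complex) \<Rightarrow> 'x \<Rightarrow> complex" where
  "divpow n x = fscale (1 / fact n) (x [^] n)"

lemma divpow_closed [simp]: "x \<in> carrier T \<Longrightarrow> divpow n x \<in> carrier T"
  by (simp add: divpow_def)

lemma divpow_Suc: "x \<in> carrier T \<Longrightarrow> divpow n x \<otimes> x = fscale (of_nat (Suc n)) (divpow (Suc n) x)"
  by (simp add: divpow_def scale_left divide_simps del: of_nat_Suc)

lemma divpow_commute:
  assumes "x \<in> carrier T" "y \<in> carrier T" "x \<otimes> y = y \<otimes> x"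
  shows "divpow n x \<otimes> y = y \<otimes> divpow n x"
proof -
  have "x [^] n \<otimes> y = y \<otimes> x [^] n"
  proof (induction n)
    case (Suc n)
    have "x [^] Suc n \<otimes> y = (x [^] n \<otimes> y) \<otimes> x"
      using assms by (simp only: nat_pow_Suc m_assoc nat_pow_closed)
    also have "\<dots> = y \<otimes> x [^] Suc n"
      unfolding Suc using assms by (simp only: nat_pow_Suc m_assoc nat_pow_closed)
    finally show ?case .
  qed (use assms in simp)
  then show ?thesis by (simp add: divpow_def scale_left scale_right)
qed

text \<open>The induction multiplies by \<open>x + y\<close>. In the term of index \<open>i\<close>,
  raising the exponent of \<open>x\<close> contributes the factor \<open>i\<close> and raising that
  of \<open>y\<close> the factor \<open>n + 1 - i\<close>; together they give \<open>n + 1\<close>,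
  which is cancelled at the end.\<close>

lemma divpow_add:
  assumes x: "x \<in> carrier T" and y: "y \<in> carrier T" and comm: "x \<otimes> y = y \<otimes> x"
  shows "divpow n (x + y) = (\<Sum>i\<le>n. divpow i x \<otimes> divpow (n - i) y)"
proof (induction n)
  case 0
  then show ?case using x y by (simp add: divpow_def)
next
  case (Suc n)
  let ?s = "\<lambda>i j. divpow i x \<otimes> divpow j y"
  have "fscale (of_nat (Suc n)) (divpow (Suc n) (x + y)) = divpow n (x + y) \<otimes> (x + y)"
    using x y by (simp add: divpow_Suc)
  also have "\<dots> = (\<Sum>i\<le>n. ?s i (n - i) \<otimes> x) + (\<Sum>i\<le>n. ?s i (n - i) \<otimes> y)"
    by (simp only: Suc add_right sum_left)
  also have "(\<Sum>i\<le>n. ?s i (n - i) \<otimes> x) = (\<Sum>i\<le>n. fscale (of_nat (Suc i)) (?s (Suc i) (n - i)))"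
  proof (rule sum.cong[OF refl])
    fix i
    have "?s i (n - i) \<otimes> x = divpow i x \<otimes> x \<otimes> divpow (n - i) y"
      using x y by (simp only: m_assoc divpow_closed divpow_commute[OF y x comm[symmetric]])
    then show "?s i (n - i) \<otimes> x = fscale (of_nat (Suc i)) (?s (Suc i) (n - i))"
      using x by (simp only: divpow_Suc scale_left)
  qed
  \<comment> \<open>The shifted sum gains a term \<open>i = 0\<close> with coefficient 0; below, the
    second sum likewise gains \<open>i = Suc n\<close> with coefficient 0.\<close>
  also have "\<dots> = (\<Sum>i\<le>Suc n. fscale (of_nat i) (?s i (Suc n - i)))"
    unfolding sum.atMost_Suc_shift[of _ n] by (simp only: of_nat_0 fspace.scale_zero_left add_0_left diff_Suc_Suc)
  also have "(\<Sum>i\<le>n. ?s i (n - i) \<otimes> y) = (\<Sum>i\<le>n. fscale (of_nat (Suc n - i)) (?s i (Suc n - i)))"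
  proof (rule sum.cong[OF refl])
    fix i assume "i \<in> {..n}"
    then have "Suc n - i = Suc (n - i)" by auto
    then show "?s i (n - i) \<otimes> y = fscale (of_nat (Suc n - i)) (?s i (Suc n - i))"
      using x y by (simp only: m_assoc divpow_closed divpow_Suc scale_right)
  qed
  also have "\<dots> = (\<Sum>i\<le>Suc n. fscale (of_nat (Suc n - i)) (?s i (Suc n - i)))"
    by (simp only: sum.atMost_Suc diff_self_eq_0 of_nat_0 fspace.scale_zero_left add_0_right)
  also have "(\<Sum>i\<le>Suc n. fscale (of_nat i) (?s i (Suc n - i))) +
      (\<Sum>i\<le>Suc n. fscale (of_nat (Suc n - i)) (?s i (Suc n - i))) =
      (\<Sum>i\<le>Suc n. fscale (of_nat (Suc n)) (?s i (Suc n - i)))"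
    unfolding sum.distrib[symmetric] fspace.scale_left_distrib[symmetric] of_nat_add[symmetric]
    by (intro sum.cong refl) (simp del: of_nat_Suc)
  finally have "fscale (of_nat (Suc n)) (divpow (Suc n) (x + y)) =
      fscale (of_nat (Suc n)) (\<Sum>i\<le>Suc n. ?s i (Suc n - i))"
    by (simp only: fspace.scale_sum_right)
  then show ?case
    by (rule fspace.scale_left_imp_eq[rotated]) (simp del: of_nat_Suc)
qed

lemma pow_eq_zero_mono: "x \<in> carrier T \<Longrightarrow> x [^] (N :: nat) = 0 \<Longrightarrow> N \<le> n \<Longrightarrow> x [^] n = 0"
  using nat_pow_mult[of x N "n - N"] by simp

lemma divpow_eq_zero: "x \<in> carrier T \<Longrightarrow> x [^] (N :: nat) = 0 \<Longrightarrow> N \<le> n \<Longrightarrow> divpow n x = 0"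
  unfolding divpow_def by (simp only: pow_eq_zero_mono fspace.scale_zero_right)

text \<open>Nilpotence turns the pointwise infinite series into a finite sum of functions, with the
  same bound at every point.\<close>

lemma exp_series_eq:
  assumes "x \<in> carrier T" "x [^] (N :: nat) = 0"
  shows "exp_series T x = (\<Sum>n<N. divpow n x)"
proof
  fix z
  have "(\<Sum>n. (x [^] n) z / fact n) = (\<Sum>n<N. (x [^] n) z / fact n)"
    using pow_eq_zero_mono[OF assms] by (intro suminf_finite) (auto simp: not_less)
  then show "exp_series T x z = (\<Sum>n<N. divpow n x) z"
    by (simp add: exp_series_def fun_sum_apply divpow_def)
qed

lemma exp_series_zero: "exp_series T 0 = \<one>"
  by (subst exp_series_eq[where N = 1]) (simp_all add: divpow_def)

lemma exp_series_closed: "x \<in> carrier T \<Longrightarrow> x [^] (N :: nat) = 0 \<Longrightarrow> exp_series T x \<in> carrier T"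
  by (simp add: exp_series_eq carrier_sum)

lemma exp_series_commute:
  assumes "x \<in> carrier T" "x [^] (N :: nat) = 0" "y \<in> carrier T" "x \<otimes> y = y \<otimes> x"
  shows "exp_series T x \<otimes> y = y \<otimes> exp_series T x"
  using assms by (simp add: exp_series_eq sum_left sum_right divpow_commute)

lemma pow_add_eq_zero:
  assumes x: "x \<in> carrier T" "x [^] (N :: nat) = 0" and y: "y \<in> carrier T" "y [^] (M :: nat) = 0"
    and comm: "x \<otimes> y = y \<otimes> x"
  shows "(x + y) [^] (N + M) = 0"
proof -
  \<comment> \<open>Either \<open>N \<le> i\<close>, or the exponent of \<open>y\<close> is at least
    \<open>M\<close>.\<close>
  have "divpow i x \<otimes> divpow (N + M - i) y = 0" for i
  proof (cases "N \<le> i")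
    case True then show ?thesis by (simp add: divpow_eq_zero[OF x])
  next
    case False then show ?thesis by (simp add: divpow_eq_zero[OF y])
  qed
  then have "divpow (N + M) (x + y) = 0"
    by (simp add: divpow_add[OF x(1) y(1) comm])
  then show ?thesis by (simp add: divpow_def fun_eq_iff)
qed

lemma exp_series_add:
  assumes x: "x \<in> carrier T" "x [^] (N :: nat) = 0" and y: "y \<in> carrier T" "y [^] (M :: nat) = 0"
    and comm: "x \<otimes> y = y \<otimes> x"
  shows "exp_series T (x + y) = exp_series T x \<otimes> exp_series T y"
proof -
  let ?s = "\<lambda>i j. divpow i x \<otimes> divpow j y"
  have "exp_series T (x + y) = (\<Sum>n<N + M. \<Sum>i\<le>n. ?s i (n - i))"
    using exp_series_eq[OF _ pow_add_eq_zero[OF assms]] x y by (simp add: divpow_add[OF x(1) y(1) comm])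
  also have "\<dots> = (\<Sum>(i, j) | i + j < N + M. ?s i j)"
    by (rule sum.triangle_reindex[symmetric])
  \<comment> \<open>The rectangle lies inside the triangle \<open>i + j < N + M\<close>; outside the
    rectangle one of the two divided powers vanishes.\<close>
  also have "\<dots> = (\<Sum>(i, j) \<in> {..<N} \<times> {..<M}. ?s i j)"
  proof (rule sum.mono_neutral_right)
    show "finite {(i, j). i + j < N + M}"
      by (rule finite_subset[of _ "{..<N + M} \<times> {..<N + M}"]) auto
    show "\<forall>p\<in>{(i, j). i + j < N + M} - {..<N} \<times> {..<M}. (case p of (i, j) \<Rightarrow> ?s i j) = 0"
      using divpow_eq_zero[OF x] divpow_eq_zero[OF y] by (auto simp: not_less)
  qed auto
  also have "\<dots> = exp_series T x \<otimes> exp_series T y"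
    by (simp add: exp_series_eq[OF x] exp_series_eq[OF y] sum_left sum_right sum.cartesian_product[symmetric])
      (rule sum.swap)
  finally show ?thesis .
qed

end

section \<open>The twist\<close>

lemma tensor_map_smash_embed:
  "tensor_map (smash_embed G) (smash_embed G) B ((g, l), (h, m)) =
     (if g = \<one>\<^bsub>G\<^esub> \<and> h = \<one>\<^bsub>G\<^esub> then case (l, m) of ([f], [f']) \<Rightarrow> B (f, f') | _ \<Rightarrow> 0 else 0)"
  by (auto simp: tensor_map_def smash_embed_def at_group_def ext_embed_def split: list.splits)

lemma tensor_map_smash_embed_linear:
  "tensor_map (smash_embed G) (smash_embed G) (B + C) =
     tensor_map (smash_embed G) (smash_embed G) B + tensor_map (smash_embed G) (smash_embed G) C"
  "tensor_map (smash_embed G) (smash_embed G) (fscale c B) = fscale c (tensor_map (smash_embed G) (smash_embed G) B)"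
  by (intro ext; clarify; simp add: tensor_map_smash_embed split: list.split)+

lemma tensor_map_smash_embed_zero: "tensor_map (smash_embed G) (smash_embed G) 0 = 0"
  using tensor_map_smash_embed_linear(2)[of G 0 0] by (simp only: fspace.scale_zero_left)

lemma tensor_map_smash_embed_pure:
  "tensor_map (smash_embed G) (smash_embed G) (pure_tensor a b) = pure_tensor (smash_embed G a) (smash_embed G b)"
  by (auto simp: fun_eq_iff tensor_map_smash_embed smash_embed_def at_group_def ext_embed_def split: list.splits)

definition homogeneous :: "nat \<Rightarrow> ('g, 'v) smash \<Rightarrow> bool" where
  "homogeneous i a \<longleftrightarrow> (\<forall>x. a x \<noteq> 0 \<longrightarrow> smash_parity x mod 2 = i)"

context finite_group_rep
begin

abbreviation (input) "VV \<equiv> tensor_space (range (vec scale)) (range (vec scale))"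
abbreviation (input) "emb \<equiv> smash_embed G"
abbreviation (input) "emb2 \<equiv> tensor_map (smash_embed G) (smash_embed G)"
abbreviation (input) "basis \<equiv> {at_group g (wedge scale vs) | g vs. g \<in> carrier G}"

text \<open>In contrast to plain span induction, the remainder \<open>y\<close> is known to lie in
  \<open>VV\<close>, as needed for maps that are linear only there.\<close>

lemma VV_induct [consumes 1, case_names zero step]:
  assumes "C \<in> VV" and "P 0"
    and "\<And>c v w y. y \<in> VV \<Longrightarrow> P y \<Longrightarrow> P (fscale c (pure_tensor (vec scale v) (vec scale w)) + y)"
  shows "P C"
proof -
  have "C \<in> VV \<and> P C"
    using assms(1) unfolding tensor_space_def
  proof (induction C rule: fspace.span_induct_alt)
    case base
    show ?case using assms(2) fspace.span_zero by blast
  next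
    case (step c x y)
    then obtain v w where x: "x = pure_tensor (vec scale v) (vec scale w)" by auto
    have "fscale c x + y \<in> VV"
      unfolding tensor_space_def using step
      by (rule_tac fspace.span_add[OF fspace.span_scale[OF fspace.span_base]]; blast)
    then show ?case
      using assms(3)[of y c v w] step.IH unfolding x tensor_space_def by blast
  qed
  then show ?thesis ..
qed

lemma pure_VV: "pure_tensor (vec scale v) (vec scale w) \<in> VV"
  by (intro pure_tensor_mem) auto

lemma rho_inv:
  assumes "g \<in> carrier G"
  shows "\<rho> g (\<rho> (inv g) v) = v" "\<rho> (inv g) (\<rho> g v) = v"
  using assms rep_mult[of g "inv g" v] rep_mult[of "inv g" g v] by (simp_all add: rep_one)

lemma wedge_act:
  "g \<in> carrier G \<Longrightarrow> wedge scale vs (map (\<lambda>f. f \<circ> \<rho> g) l) = wedge scale (map (\<rho> g) vs) l"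
  using wedge_map[of scale scale "\<rho> g" "\<rho> (inv g)" vs l] by (simp add: rep_linear rho_inv)

lemma smash_mult_closed:
  assumes "a \<in> smash_carrier G scale" "b \<in> smash_carrier G scale"
  shows "a \<otimes>\<^bsub>A\<^esub> b \<in> smash_carrier G scale"
proof (rule span_bilinear_mem[where m = "mult A" and S = basis and S' = basis, OF _ _ _ _ subspace_smash_carrier])
  fix s t assume "s \<in> basis" "t \<in> basis"
  then show "s \<otimes>\<^bsub>A\<^esub> t \<in> smash_carrier G scale"
    by (auto simp: smash_mult_at_group wedge_act intro!: at_group_mem ext_mult_mem wedge_mem)
qed (use assms smash_carrier_span in \<open>simp_all only: smash_mult_bilinear\<close>)

lemma smash_mult_one:
  assumes "a \<in> smash_carrier G scale"
  shows "e \<one> \<otimes>\<^bsub>A\<^esub> a = a" "a \<otimes>\<^bsub>A\<^esub> e \<one> = a"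
proof -
  have s: "e \<one> \<otimes>\<^bsub>A\<^esub> s = s" "s \<otimes>\<^bsub>A\<^esub> e \<one> = s" if "s \<in> basis" for s
    using that
    by (auto simp: smash_group_elem_def smash_mult_at_group ext_one_act ext_mult_one ext_one_mult wedge_act
        map_idI[OF rep_one])
  show "e \<one> \<otimes>\<^bsub>A\<^esub> a = a"
    using linear_eq_on_span[where f = "\<lambda>a. e \<one> \<otimes>\<^bsub>A\<^esub> a" and g = "\<lambda>a. a", OF smash_mult_bilinear(2,4) _ _ s(1) assms[unfolded smash_carrier_span]]
    by simp
  show "a \<otimes>\<^bsub>A\<^esub> e \<one> = a"
    using linear_eq_on_span[where f = "\<lambda>a. a \<otimes>\<^bsub>A\<^esub> e \<one>" and g = "\<lambda>a. a", OF smash_mult_bilinear(1,3) _ _ s(2) assms[unfolded smash_carrier_span]]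
    by simp
qed

lemma homogeneous_at_group_wedge: "homogeneous (length vs mod 2) (at_group g (wedge scale vs))"
  using wedge_length[of scale vs] by (auto simp: homogeneous_def at_group_def smash_parity_def split: if_splits)

lemma homogeneous_group_elem: "homogeneous 0 (e g)"
  by (auto simp: homogeneous_def smash_group_elem_def at_group_def ext_one_def smash_parity_def split: if_splits)

lemma homogeneous_embed: "homogeneous 1 (emb a)"
  by (auto simp: homogeneous_def smash_embed_def at_group_def ext_embed_def smash_parity_def split: if_splits list.splits)

lemma smash_tensor_mult_pure:
  assumes "homogeneous i b" "homogeneous j c"
  shows "pure_tensor a b \<otimes>\<^bsub>T\<^esub> pure_tensor c d = fscale ((-1) ^ (i * j)) (pure_tensor (a \<otimes>\<^bsub>A\<^esub> c) (b \<otimes>\<^bsub>A\<^esub> d))"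
  unfolding smash_tensor_def smash_algebra_def monoid.simps
  using assms unfolding homogeneous_def by (intro super_tensor_mult_pure_tensor[OF smash_mu_scale]) auto

lemma smash_tensor_carrier_span: "carrier T = fspace.span {pure_tensor a b | a b. a \<in> basis \<and> b \<in> basis}"
  unfolding smash_tensor_def partial_object.simps smash_carrier_span tensor_space_span ..

lemma smash_tensor_carrier: "carrier T = tensor_space (smash_carrier G scale) (smash_carrier G scale)"
  by (simp add: smash_tensor_def)

lemma group_elem_mem: "g \<in> carrier G \<Longrightarrow> e g \<in> smash_carrier G scale"
  unfolding smash_group_elem_def by (metis at_group_mem wedge_mem wedge_Nil)

lemma embed_mem: "emb (vec scale v) \<in> smash_carrier G scale"
  unfolding smash_embed_def by (metis at_group_mem wedge_mem wedge_single one_closed)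

lemma smash_tensor_one: "\<one>\<^bsub>T\<^esub> = pure_tensor (e \<one>) (e \<one>)"
  by (simp add: smash_tensor_def)

text \<open>Closure and the unit laws are checked on tensors of monomials. Monomials are
  homogeneous, so the sign rule reduces to a scalar.\<close>

sublocale T: function_algebra T
proof
  show sub: "fspace.subspace (carrier T)"
    unfolding smash_tensor_carrier by (rule subspace_tensor_space)
  fix a b c and k :: complex
  show "\<one>\<^bsub>T\<^esub> \<in> carrier T"
    unfolding smash_tensor_one smash_tensor_carrier by (intro pure_tensor_mem group_elem_mem one_closed)
  show "(a + b) \<otimes>\<^bsub>T\<^esub> c = a \<otimes>\<^bsub>T\<^esub> c + b \<otimes>\<^bsub>T\<^esub> c" "a \<otimes>\<^bsub>T\<^esub> (b + c) = a \<otimes>\<^bsub>T\<^esub> b + a \<otimes>\<^bsub>T\<^esub> c"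
    "fscale k a \<otimes>\<^bsub>T\<^esub> c = fscale k (a \<otimes>\<^bsub>T\<^esub> c)" "a \<otimes>\<^bsub>T\<^esub> fscale k c = fscale k (a \<otimes>\<^bsub>T\<^esub> c)"
    by (rule smash_tensor_add_left smash_tensor_add_right smash_tensor_scale_left smash_tensor_scale_right)+
  show "a \<otimes>\<^bsub>T\<^esub> b \<otimes>\<^bsub>T\<^esub> c = a \<otimes>\<^bsub>T\<^esub> (b \<otimes>\<^bsub>T\<^esub> c)"
    by (rule smash_tensor_assoc)
  show "a \<otimes>\<^bsub>T\<^esub> b \<in> carrier T" if "a \<in> carrier T" "b \<in> carrier T"
  proof (rule span_bilinear_mem[where m = "mult T", OF smash_tensor_add_left smash_tensor_scale_left smash_tensor_add_right smash_tensor_scale_right sub _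
        that[unfolded smash_tensor_carrier_span]])
    fix s t assume "s \<in> {pure_tensor a b | a b. a \<in> basis \<and> b \<in> basis}"
      and "t \<in> {pure_tensor a b | a b. a \<in> basis \<and> b \<in> basis}"
    then obtain a g vs c h ws d where s: "s = pure_tensor a (at_group g (wedge scale vs))"
      and t: "t = pure_tensor (at_group h (wedge scale ws)) d"
      and mem: "a \<in> basis" "g \<in> carrier G" "h \<in> carrier G" "d \<in> basis"
      by blast
    have mem': "at_group g (wedge scale vs) \<in> smash_carrier G scale" "at_group h (wedge scale ws) \<in> smash_carrier G scale"
      using mem by (simp_all add: at_group_mem wedge_mem)
    moreover have "a \<in> smash_carrier G scale" "d \<in> smash_carrier G scale"
      unfolding smash_carrier_span using mem(1,4) by (simp_all only: fspace.span_base)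
    ultimately show "s \<otimes>\<^bsub>T\<^esub> t \<in> carrier T"
      unfolding s t smash_tensor_mult_pure[OF homogeneous_at_group_wedge homogeneous_at_group_wedge] smash_tensor_carrier
      by (intro fspace.subspace_scale[OF subspace_tensor_space] pure_tensor_mem smash_mult_closed)
  qed
  have one: "\<one>\<^bsub>T\<^esub> \<otimes>\<^bsub>T\<^esub> s = s" "s \<otimes>\<^bsub>T\<^esub> \<one>\<^bsub>T\<^esub> = s" if s: "s \<in> {pure_tensor a b | a b. a \<in> basis \<and> b \<in> basis}" for s
  proof -
    obtain g vs h ws where s: "s = pure_tensor (at_group g (wedge scale vs)) (at_group h (wedge scale ws))"
      and "g \<in> carrier G" "h \<in> carrier G" using s by blast
    then have mem: "at_group g (wedge scale vs) \<in> smash_carrier G scale" "at_group h (wedge scale ws) \<in> smash_carrier G scale"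
      by (simp_all add: at_group_mem wedge_mem)
    show "\<one>\<^bsub>T\<^esub> \<otimes>\<^bsub>T\<^esub> s = s" "s \<otimes>\<^bsub>T\<^esub> \<one>\<^bsub>T\<^esub> = s"
      unfolding s smash_tensor_one smash_tensor_mult_pure[OF homogeneous_group_elem homogeneous_at_group_wedge] smash_tensor_mult_pure[OF homogeneous_at_group_wedge homogeneous_group_elem]
      using mem by (simp_all add: smash_mult_one)
  qed
  show "\<one>\<^bsub>T\<^esub> \<otimes>\<^bsub>T\<^esub> a = a" if "a \<in> carrier T"
    by (rule linear_eq_on_span[where g = "\<lambda>a. a", OF smash_tensor_add_right smash_tensor_scale_right _ _ one(1) that[unfolded smash_tensor_carrier_span]]) simp_all
  show "a \<otimes>\<^bsub>T\<^esub> \<one>\<^bsub>T\<^esub> = a" if "a \<in> carrier T"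
    by (rule linear_eq_on_span[where g = "\<lambda>a. a", OF smash_tensor_add_left smash_tensor_scale_left _ _ one(2) that[unfolded smash_tensor_carrier_span]]) simp_all
qed

section \<open>Commutation relations and nilpotence of tensors in
  \<open>V \<otimes> V\<close>\<close>

lemma group_elem_mult_embed:
  assumes "g \<in> carrier G"
  shows "e g \<otimes>\<^bsub>A\<^esub> emb (vec scale v) = emb (vec scale (\<rho> g v)) \<otimes>\<^bsub>A\<^esub> e g"
  using assms
  by (simp add: smash_embed_def smash_group_elem_def smash_mult_at_group vec_act ext_one_act
      ext_one_mult ext_mult_one)

lemma embed_square: "emb (vec scale v) \<otimes>\<^bsub>A\<^esub> emb (vec scale v) = 0"
  using smash_vec_anticomm[of v v] by (simp add: fun_eq_iff)

lemma emb2_mem: "B \<in> VV \<Longrightarrow> emb2 B \<in> carrier T"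
proof (unfold tensor_space_def, induction B rule: fspace.span_induct_alt)
  case base
  show ?case by (simp only: tensor_map_smash_embed_zero T.carrier_zero)
next
  case (step c x y)
  then obtain v w where x: "x = pure_tensor (vec scale v) (vec scale w)" by auto
  have "pure_tensor (emb (vec scale v)) (emb (vec scale w)) \<in> carrier T"
    unfolding smash_tensor_carrier by (intro pure_tensor_mem embed_mem)
  then show ?case
    unfolding x tensor_map_smash_embed_linear tensor_map_smash_embed_pure
    using step.IH by (intro T.carrier_add T.carrier_scale)
qed

lemma emb2_eq_on_VV:
  assumes "\<And>x y. f (x + y) = f x + f y" "\<And>c x. f (fscale c x) = fscale c (f x)"
    and "\<And>x y. g (x + y) = g x + g y" "\<And>c x. g (fscale c x) = fscale c (g x)"
    and "\<And>v w. f (pure_tensor (vec scale v) (vec scale w)) = g (pure_tensor (vec scale v) (vec scale w))"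
    and "B \<in> VV"
  shows "f B = g B"
  using assms(6) unfolding tensor_space_def by (rule linear_eq_on_span[OF assms(1-4), rotated]) (use assms(5) in blast)

text \<open>For decomposable tensors the two products differ by an exchange of vectors in each of
  the two factors, and the two signs cancel.\<close>

lemma emb2_comm:
  assumes B: "B \<in> VV" and C: "C \<in> VV"
  shows "emb2 B \<otimes>\<^bsub>T\<^esub> emb2 C = emb2 C \<otimes>\<^bsub>T\<^esub> emb2 B"
proof (rule emb2_eq_on_VV[where f = "\<lambda>B. emb2 B \<otimes>\<^bsub>T\<^esub> emb2 C" and g = "\<lambda>B. emb2 C \<otimes>\<^bsub>T\<^esub> emb2 B", OF _ _ _ _ _ B])
  fix v w
  show "emb2 (pure_tensor (vec scale v) (vec scale w)) \<otimes>\<^bsub>T\<^esub> emb2 C = emb2 C \<otimes>\<^bsub>T\<^esub> emb2 (pure_tensor (vec scale v) (vec scale w))"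
    by (rule emb2_eq_on_VV[where f = "\<lambda>C. emb2 _ \<otimes>\<^bsub>T\<^esub> emb2 C" and g = "\<lambda>C. emb2 C \<otimes>\<^bsub>T\<^esub> emb2 _", OF _ _ _ _ _ C])
      (simp_all only: tensor_map_smash_embed_linear smash_tensor_add_left smash_tensor_add_right smash_tensor_scale_left smash_tensor_scale_right
        tensor_map_smash_embed_pure smash_tensor_mult_pure[OF homogeneous_embed homogeneous_embed],
       subst smash_vec_anticomm, subst (2) smash_vec_anticomm, auto simp: fun_eq_iff)
qed (simp_all only: tensor_map_smash_embed_linear smash_tensor_add_left smash_tensor_add_right smash_tensor_scale_left smash_tensor_scale_right)

text \<open>Elements of \<open>V \<otimes> V\<close> are even in the supercommutative algebra
  \<Lambda>V \<otimes> \<Lambda>V. Hence twisting does not change the coproduct of a vector.\<close>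

lemma emb2_vec_comm:
  assumes B: "B \<in> VV"
  shows "emb2 B \<otimes>\<^bsub>T\<^esub> (pure_tensor (emb (vec scale v)) (e \<one>) + pure_tensor (e \<one>) (emb (vec scale v))) =
    (pure_tensor (emb (vec scale v)) (e \<one>) + pure_tensor (e \<one>) (emb (vec scale v))) \<otimes>\<^bsub>T\<^esub> emb2 B"
proof (rule emb2_eq_on_VV[where f = "\<lambda>B. emb2 B \<otimes>\<^bsub>T\<^esub> _" and g = "\<lambda>B. _ \<otimes>\<^bsub>T\<^esub> emb2 B", OF _ _ _ _ _ B])
  fix x y
  have *: "emb (vec scale x) \<otimes>\<^bsub>A\<^esub> emb (vec scale y) = fscale (-1) (emb (vec scale y) \<otimes>\<^bsub>A\<^esub> emb (vec scale x))" for x y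
    using smash_vec_anticomm[of x y] by (auto simp: fun_eq_iff)
  show "emb2 (pure_tensor (vec scale x) (vec scale y)) \<otimes>\<^bsub>T\<^esub>
      (pure_tensor (emb (vec scale v)) (e \<one>) + pure_tensor (e \<one>) (emb (vec scale v))) =
    (pure_tensor (emb (vec scale v)) (e \<one>) + pure_tensor (e \<one>) (emb (vec scale v))) \<otimes>\<^bsub>T\<^esub>
      emb2 (pure_tensor (vec scale x) (vec scale y))"
    unfolding smash_tensor_add_left smash_tensor_add_right tensor_map_smash_embed_pure smash_tensor_mult_pure[OF homogeneous_embed homogeneous_embed]
      smash_tensor_mult_pure[OF homogeneous_embed homogeneous_group_elem] smash_tensor_mult_pure[OF homogeneous_group_elem homogeneous_embed]
    by (simp only: smash_mult_one embed_mem *[of x v] *[of v y] pure_tensor_bilinear) (simp add: fun_eq_iff)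
qed (simp_all only: tensor_map_smash_embed_linear smash_tensor_add_left[of "emb2 _"] smash_tensor_add_right[of _ "emb2 _"]
    smash_tensor_scale_left smash_tensor_scale_right)

text \<open>Conjugation by \<open>g \<otimes> g\<close> is the action of \<open>g\<close> on
  \<open>V \<otimes> V\<close>. The defect \<open>g \<cdot> B - B\<close> in the coproduct of
  \<open>g\<close> originates here.\<close>

lemma emb2_group:
  assumes g: "g \<in> carrier G" and B: "B \<in> VV"
  shows "pure_tensor (e g) (e g) \<otimes>\<^bsub>T\<^esub> emb2 B = emb2 (\<lambda>(f, f'). B (f \<circ> \<rho> g, f' \<circ> \<rho> g)) \<otimes>\<^bsub>T\<^esub> pure_tensor (e g) (e g)"
proof -
  define act where "act B = (\<lambda>(f, f'). B (f \<circ> \<rho> g, f' \<circ> \<rho> g))" for B :: "('v \<Rightarrow> complex) \<times> ('v \<Rightarrow> complex) \<Rightarrow> complex"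
  have act: "act (B + C) = act B + act C" "act (fscale c B) = fscale c (act B)" for B C c
    by (auto simp: act_def fun_eq_iff)
  have "vec scale v (f \<circ> \<rho> g) = vec scale (\<rho> g v) f" for v f
    using dual_space_comp_iff[of scale scale "\<rho> g" "\<rho> (inv g)" f] g
    by (simp add: vec_def rep_linear rho_inv)
  then have actp: "act (pure_tensor (vec scale v) (vec scale w)) = pure_tensor (vec scale (\<rho> g v)) (vec scale (\<rho> g w))" for v w
    by (simp add: act_def pure_tensor_def)
  have "pure_tensor (e g) (e g) \<otimes>\<^bsub>T\<^esub> emb2 B = emb2 (act B) \<otimes>\<^bsub>T\<^esub> pure_tensor (e g) (e g)"
    by (rule emb2_eq_on_VV[where f = "\<lambda>B. _ \<otimes>\<^bsub>T\<^esub> emb2 B" and g = "\<lambda>B. emb2 (act B) \<otimes>\<^bsub>T\<^esub> _", OF _ _ _ _ _ B])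
      (simp_all only: tensor_map_smash_embed_linear smash_tensor_add_left smash_tensor_add_right smash_tensor_scale_left smash_tensor_scale_right act actp
        tensor_map_smash_embed_pure smash_tensor_mult_pure[OF homogeneous_embed homogeneous_group_elem] smash_tensor_mult_pure[OF homogeneous_group_elem homogeneous_embed]
        group_elem_mult_embed[OF g] mult_0 mult_0_right)
  then show ?thesis by (simp only: act_def)
qed

text \<open>A decomposable tensor squares to zero because vectors do, and a sum of commuting
  nilpotents is nilpotent; no bound on the degree of \<Lambda>V enters.\<close>

lemma emb2_nilpotent:
  assumes "B \<in> VV"
  shows "\<exists>N :: nat. emb2 B [^]\<^bsub>T\<^esub> N = 0"
proof -
  have "B \<in> VV \<and> (\<exists>N :: nat. emb2 B [^]\<^bsub>T\<^esub> N = 0)"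
    using assms unfolding tensor_space_def
  proof (induction B rule: fspace.span_induct_alt)
    case base
    have "emb2 0 [^]\<^bsub>T\<^esub> (1 :: nat) = 0"
      by (simp only: tensor_map_smash_embed_zero T.nat_pow_eone T.carrier_zero)
    then show ?case using fspace.span_zero by blast
  next
    case (step c x y)
    then obtain v w where x: "x = pure_tensor (vec scale v) (vec scale w)" by auto
    have mem: "fscale c x \<in> VV" "y \<in> VV"
      using step unfolding tensor_space_def by (blast intro: fspace.span_scale fspace.span_base)+
    have sq: "emb2 (fscale c x) [^]\<^bsub>T\<^esub> (2 :: nat) = 0"
      using emb2_mem[OF mem(1)]
      by (simp add: numeral_2_eq_2 T.l_one)
        (simp add: x tensor_map_smash_embed_linear tensor_map_smash_embed_pure smash_tensor_scale_left smash_tensor_scale_right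
          smash_tensor_mult_pure[OF homogeneous_embed homogeneous_embed] embed_square, simp add: fun_eq_iff)
    obtain N :: nat where N: "emb2 y [^]\<^bsub>T\<^esub> N = 0" using step.IH by blast
    have "emb2 (fscale c x + y) [^]\<^bsub>T\<^esub> (2 + N) = 0"
      unfolding tensor_map_smash_embed_linear(1)
      by (rule T.pow_add_eq_zero[OF emb2_mem sq emb2_mem N emb2_comm]) (rule mem)+
    moreover have "fscale c x + y \<in> VV"
      using mem unfolding tensor_space_def by (intro fspace.span_add)
    ultimately show ?case unfolding tensor_space_def by blast
  qed
  then show ?thesis ..
qed

lemma VV_closed: "B \<in> VV \<Longrightarrow> C \<in> VV \<Longrightarrow> B + C \<in> VV" "B \<in> VV \<Longrightarrow> - B \<in> VV" "B \<in> VV \<Longrightarrow> C \<in> VV \<Longrightarrow> B - C \<in> VV"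
  unfolding tensor_space_def by (rule fspace.span_add fspace.span_neg fspace.span_diff; assumption)+

section \<open>The twist and the twisted coproduct\<close>

lemma twist_closed: "B \<in> VV \<Longrightarrow> twist G scale \<rho> B \<in> carrier T"
  unfolding twist_def using emb2_nilpotent emb2_mem T.exp_series_closed by blast

lemma twist_add:
  assumes "B \<in> VV" "C \<in> VV"
  shows "twist G scale \<rho> (B + C) = twist G scale \<rho> B \<otimes>\<^bsub>T\<^esub> twist G scale \<rho> C"
proof -
  obtain N M :: nat where "emb2 B [^]\<^bsub>T\<^esub> N = 0" "emb2 C [^]\<^bsub>T\<^esub> M = 0"
    using emb2_nilpotent assms by blast
  then show ?thesis
    unfolding twist_def tensor_map_smash_embed_linear(1)
    using assms by (intro T.exp_series_add emb2_mem emb2_comm)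
qed

lemma twist_zero: "twist G scale \<rho> 0 = \<one>\<^bsub>T\<^esub>"
proof -
  show ?thesis by (simp only: twist_def tensor_map_smash_embed_zero T.exp_series_zero)
qed

lemma twist_neg:
  assumes "B \<in> VV"
  shows "twist G scale \<rho> B \<otimes>\<^bsub>T\<^esub> twist G scale \<rho> (- B) = \<one>\<^bsub>T\<^esub>"
    "twist G scale \<rho> (- B) \<otimes>\<^bsub>T\<^esub> twist G scale \<rho> B = \<one>\<^bsub>T\<^esub>"
  using twist_add[OF assms VV_closed(2)[OF assms]] twist_add[OF VV_closed(2)[OF assms] assms]
  by (simp_all add: twist_zero)

lemma inv_twist:
  assumes "B \<in> VV"
  shows "inv\<^bsub>T\<^esub> twist G scale \<rho> B = twist G scale \<rho> (- B)"
  using assms by (intro T.inv_unique'[symmetric] twist_closed twist_neg VV_closed)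

lemma twisted_comult_eq:
  assumes "B \<in> VV" "x \<in> smash_carrier G scale"
  shows "twisted_comult G scale \<rho> B x =
    twist G scale \<rho> (- B) \<otimes>\<^bsub>T\<^esub> smash_comult_formula x \<otimes>\<^bsub>T\<^esub> twist G scale \<rho> B"
  using assms by (simp add: twisted_comult_def Let_def inv_twist smash_comult_eq)

lemma comult_formula_closed: "x \<in> smash_carrier G scale \<Longrightarrow> smash_comult_formula x \<in> carrier T"
  unfolding smash_tensor_carrier by (rule smash_comult_formula_mem)

lemma twisted_comult_closed:
  assumes "B \<in> VV" "x \<in> smash_carrier G scale"
  shows "twisted_comult G scale \<rho> B x \<in> carrier T"
  unfolding twisted_comult_eq[OF assms] using assms
  by (intro T.m_closed twist_closed comult_formula_closed VV_closed)

lemma twisted_comult_add_central: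
  assumes B: "B \<in> VV" and C: "C \<in> VV" and x: "x \<in> smash_carrier G scale"
    and comm: "emb2 C \<otimes>\<^bsub>T\<^esub> smash_comult_formula x = smash_comult_formula x \<otimes>\<^bsub>T\<^esub> emb2 C"
  shows "twisted_comult G scale \<rho> (B + C) x = twisted_comult G scale \<rho> B x"
proof -
  let ?J = "twist G scale \<rho>" and ?D = "smash_comult_formula x"
  note mem = twist_closed[OF B] twist_closed[OF C] twist_closed[OF VV_closed(2)[OF B]]
    twist_closed[OF VV_closed(2)[OF C]] comult_formula_closed[OF x]
  obtain N :: nat where "emb2 C [^]\<^bsub>T\<^esub> N = 0" using emb2_nilpotent[OF C] by blast
  from T.exp_series_commute[OF emb2_mem[OF C] this mem(5) comm]
  have comm': "?J C \<otimes>\<^bsub>T\<^esub> ?D = ?D \<otimes>\<^bsub>T\<^esub> ?J C"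
    unfolding twist_def .
  \<comment> \<open>The factors are ordered so that those coming from \<open>C\<close> stand next to
    the coproduct, where they cancel.\<close>
  have BC: "?J (B + C) = ?J C \<otimes>\<^bsub>T\<^esub> ?J B" "?J (- (B + C)) = ?J (- B) \<otimes>\<^bsub>T\<^esub> ?J (- C)"
    using twist_add[OF C B] twist_add[OF VV_closed(2)[OF B] VV_closed(2)[OF C]] by (simp_all add: add.commute)
  have "twisted_comult G scale \<rho> (B + C) x = ?J (- B) \<otimes>\<^bsub>T\<^esub> (?J (- C) \<otimes>\<^bsub>T\<^esub> (?D \<otimes>\<^bsub>T\<^esub> ?J C)) \<otimes>\<^bsub>T\<^esub> ?J B"
    unfolding twisted_comult_eq[OF VV_closed(1)[OF B C] x] BC by (simp only: smash_tensor_assoc)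
  also have "?J (- C) \<otimes>\<^bsub>T\<^esub> (?D \<otimes>\<^bsub>T\<^esub> ?J C) = (?J (- C) \<otimes>\<^bsub>T\<^esub> ?J C) \<otimes>\<^bsub>T\<^esub> ?D"
    by (simp only: comm'[symmetric] smash_tensor_assoc)
  also have "\<dots> = ?D" using mem by (simp add: twist_neg[OF C])
  finally show ?thesis by (simp only: twisted_comult_eq[OF B x])
qed

lemma twisted_comult_central:
  assumes B: "B \<in> VV" and x: "x \<in> smash_carrier G scale"
    and comm: "emb2 B \<otimes>\<^bsub>T\<^esub> smash_comult_formula x = smash_comult_formula x \<otimes>\<^bsub>T\<^esub> emb2 B"
  shows "twisted_comult G scale \<rho> B x = smash_comult_formula x"
proof -
  have 0: "0 \<in> VV" unfolding tensor_space_def by (rule fspace.span_zero)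
  have "twisted_comult G scale \<rho> 0 x = smash_comult_formula x"
    unfolding twisted_comult_eq[OF 0 x] using comult_formula_closed[OF x] by (simp add: twist_zero)
  then show ?thesis using twisted_comult_add_central[OF 0 B x comm] by simp
qed

lemma comult_formula_group: "smash_comult_formula (e g) = pure_tensor (e g) (e g)"
  using is_smash_comult_formula
  by (auto simp: smash_comult_formula_def smash_group_elem_def at_group_def ext_one_def fun_eq_iff)

lemma comult_formula_vec:
  "smash_comult_formula (emb (vec scale v)) = pure_tensor (emb (vec scale v)) (e \<one>) + pure_tensor (e \<one>) (emb (vec scale v))"
  using is_smash_comult_formula by (simp add: is_smash_comult_def Let_def)

lemma comult_formula_mult:
  "smash_comult_formula (a \<otimes>\<^bsub>A\<^esub> b) = smash_comult_formula a \<otimes>\<^bsub>T\<^esub> smash_comult_formula b"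
  by (simp add: smash_algebra_def smash_tensor_def smash_comult_formula_mult)

lemma at_group_wedge_Cons:
  "g \<in> carrier G \<Longrightarrow> at_group g (wedge scale (v # vs)) = emb (vec scale v) \<otimes>\<^bsub>A\<^esub> at_group g (wedge scale vs)"
  by (simp add: smash_embed_def smash_mult_at_group wedge_Cons wedge_act map_idI[OF rep_one])

text \<open>The coproduct is multiplicative and a commutant is closed under products, so the
  generators suffice: invariance handles \<open>g\<close>, evenness handles
  \<open>v\<close>.\<close>

lemma invariant_comm:
  assumes C: "C \<in> VV" and inv: "\<And>g f f'. g \<in> carrier G \<Longrightarrow> C (f \<circ> \<rho> g, f' \<circ> \<rho> g) = C (f, f')"
    and x: "x \<in> smash_carrier G scale"
  shows "emb2 C \<otimes>\<^bsub>T\<^esub> smash_comult_formula x = smash_comult_formula x \<otimes>\<^bsub>T\<^esub> emb2 C"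
proof (rule linear_eq_on_span[OF _ _ _ _ _ x[unfolded smash_carrier_span]])
  have lin: "smash_comult_formula (x + y) = smash_comult_formula x + smash_comult_formula y"
    "smash_comult_formula (fscale c x) = fscale c (smash_comult_formula x)"
    for x y :: "('a, 'v) smash" and c
    by (auto simp: smash_comult_formula_def fun_eq_iff)
  fix x y c
  show "emb2 C \<otimes>\<^bsub>T\<^esub> smash_comult_formula (x + y) =
      emb2 C \<otimes>\<^bsub>T\<^esub> smash_comult_formula x + emb2 C \<otimes>\<^bsub>T\<^esub> smash_comult_formula y"
    "emb2 C \<otimes>\<^bsub>T\<^esub> smash_comult_formula (fscale c x) = fscale c (emb2 C \<otimes>\<^bsub>T\<^esub> smash_comult_formula x)"
    "smash_comult_formula (x + y) \<otimes>\<^bsub>T\<^esub> emb2 C =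
      smash_comult_formula x \<otimes>\<^bsub>T\<^esub> emb2 C + smash_comult_formula y \<otimes>\<^bsub>T\<^esub> emb2 C"
    "smash_comult_formula (fscale c x) \<otimes>\<^bsub>T\<^esub> emb2 C = fscale c (smash_comult_formula x \<otimes>\<^bsub>T\<^esub> emb2 C)"
    by (simp_all only: lin smash_tensor_add_left smash_tensor_add_right smash_tensor_scale_left smash_tensor_scale_right)
next
  fix s assume "s \<in> basis"
  then obtain g vs where s: "s = at_group g (wedge scale vs)" and g: "g \<in> carrier G" by blast
  show "emb2 C \<otimes>\<^bsub>T\<^esub> smash_comult_formula s = smash_comult_formula s \<otimes>\<^bsub>T\<^esub> emb2 C"
    unfolding s
  proof (induction vs)
    case Nil
    have "(\<lambda>(f, f'). C (f \<circ> \<rho> g, f' \<circ> \<rho> g)) = C" using inv[OF g] by auto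
    then show ?case
      unfolding wedge_Nil smash_group_elem_def[symmetric] comult_formula_group emb2_group[OF g C] by (simp only:)
  next
    case (Cons v vs)
    show ?case
      unfolding at_group_wedge_Cons[OF g] comult_formula_mult comult_formula_vec
      by (simp only: smash_tensor_assoc Cons.IH[symmetric]) (simp only: smash_tensor_assoc[symmetric] emb2_vec_comm[OF C])
  qed
qed

end

section \<open>The coproduct in low degrees\<close>

lemma shuffle_ext_one: "shuffle (\<lambda>(l, m). (if l = [] then 1 else 0) * c m) fs = c fs"
  using ext_one_mult[of c] by (simp add: fun_eq_iff ext_mult_def pure_tensor_def ext_one_def)

lemma smash_mu_zero: "smash_mu G \<rho> (\<lambda>_. 0) z = 0"
  using smash_mu_scale_apply[of G \<rho> 0 "\<lambda>_. 0" z] by simp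

context finite_group_rep
begin

section \<open>Values of products in the tensor square\<close>

lemma smash_tensor_mult_apply:
  "k \<in> carrier G \<Longrightarrow> k' \<in> carrier G \<Longrightarrow> (s \<otimes>\<^bsub>T\<^esub> t) ((k, fs), (k', gs)) =
     (\<Sum>g\<in>carrier G. \<Sum>h\<in>carrier G. shuffle (\<lambda>(l1, l2). shuffle (\<lambda>(m1, m2).
        (-1) ^ (length m1 * length l2) * s ((g, l1), (h, m1)) *
        t ((inv g \<otimes> k, map (\<lambda>f. f \<circ> \<rho> g) l2), (inv h \<otimes> k', map (\<lambda>f. f \<circ> \<rho> h) m2))) gs) fs)"
  "k \<notin> carrier G \<or> k' \<notin> carrier G \<Longrightarrow> (s \<otimes>\<^bsub>T\<^esub> t) ((k, fs), (k', gs)) = 0"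
  by (auto simp: smash_tensor_def super_tensor_mult_def smash_mu_apply smash_parity_def case_prod_beta' shuffle_sum
      smash_mu_zero)

lemma smash_tensor_mult_delta_left:
  assumes s: "\<forall>g h l m. s ((g, l), (h, m)) \<noteq> 0 \<longrightarrow> g = a \<and> h = b" and ab: "a \<in> carrier G" "b \<in> carrier G"
    and k: "k \<in> carrier G" "k' \<in> carrier G"
  shows "(s \<otimes>\<^bsub>T\<^esub> t) ((k, fs), (k', gs)) = shuffle (\<lambda>(l1, l2). shuffle (\<lambda>(m1, m2).
        (-1) ^ (length m1 * length l2) * s ((a, l1), (b, m1)) *
        t ((inv a \<otimes> k, map (\<lambda>f. f \<circ> \<rho> a) l2), (inv b \<otimes> k', map (\<lambda>f. f \<circ> \<rho> b) m2))) gs) fs"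
proof -
  define S where "S g h = shuffle (\<lambda>(l1, l2). shuffle (\<lambda>(m1, m2).
        (-1) ^ (length m1 * length l2) * s ((g, l1), (h, m1)) *
        t ((inv g \<otimes> k, map (\<lambda>f. f \<circ> \<rho> g) l2), (inv h \<otimes> k', map (\<lambda>f. f \<circ> \<rho> h) m2))) gs) fs" for g h
  have S0: "S g h = 0" if "\<not> (g = a \<and> h = b)" for g h
  proof -
    have "s ((g, l), (h, m)) = 0" for l m using s that by blast
    then show ?thesis by (simp add: S_def case_prod_beta')
  qed
  have "(\<Sum>h\<in>carrier G. S g h) = (if g = a then S a b else 0)" for g
  proof -
    have "(\<Sum>h\<in>carrier G. S g h) = (\<Sum>h\<in>carrier G. if h = b then if g = a then S a b else 0 else 0)"
      by (intro sum.cong refl) (auto simp: S0)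
    then show ?thesis using ab finite_carrier by simp
  qed
  then have "(\<Sum>g\<in>carrier G. \<Sum>h\<in>carrier G. S g h) = S a b"
    using ab finite_carrier by simp
  then show ?thesis unfolding smash_tensor_mult_apply(1)[OF k] S_def .
qed

lemma smash_tensor_mult_one_left:
  assumes "\<forall>g h l m. s ((g, l), (h, m)) \<noteq> 0 \<longrightarrow> g = \<one> \<and> h = \<one>"
    and k: "k \<in> carrier G" "k' \<in> carrier G"
  shows "(s \<otimes>\<^bsub>T\<^esub> t) ((k, fs), (k', gs)) = shuffle (\<lambda>(l1, l2). shuffle (\<lambda>(m1, m2).
        (-1) ^ (length m1 * length l2) * s ((\<one>, l1), (\<one>, m1)) * t ((k, l2), (k', m2))) gs) fs"
proof -
  have "map (\<lambda>f. f \<circ> \<rho> \<one>) l = l" for l :: "('v \<Rightarrow> complex) list"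
    by (rule map_idI) (simp add: fun_eq_iff rep_one)
  then show ?thesis
    unfolding smash_tensor_mult_delta_left[OF assms(1) one_closed one_closed k] using k by simp
qed

lemma smash_tensor_mult_one_right:
  assumes t: "\<forall>g h l m. t ((g, l), (h, m)) \<noteq> 0 \<longrightarrow> g = \<one> \<and> h = \<one>"
    and k: "k \<in> carrier G" "k' \<in> carrier G"
  shows "(s \<otimes>\<^bsub>T\<^esub> t) ((k, fs), (k', gs)) = shuffle (\<lambda>(l1, l2). shuffle (\<lambda>(m1, m2).
        (-1) ^ (length m1 * length l2) * s ((k, l1), (k', m1)) *
        t ((\<one>, map (\<lambda>f. f \<circ> \<rho> k) l2), (\<one>, map (\<lambda>f. f \<circ> \<rho> k') m2))) gs) fs"
proof -
  define S where "S g h = shuffle (\<lambda>(l1, l2). shuffle (\<lambda>(m1, m2).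
        (-1) ^ (length m1 * length l2) * s ((g, l1), (h, m1)) *
        t ((inv g \<otimes> k, map (\<lambda>f. f \<circ> \<rho> g) l2), (inv h \<otimes> k', map (\<lambda>f. f \<circ> \<rho> h) m2))) gs) fs" for g h
  have S0: "S g h = 0" if "\<not> (g = k \<and> h = k')" "g \<in> carrier G" "h \<in> carrier G" for g h
  proof -
    have "\<not> (inv g \<otimes> k = \<one> \<and> inv h \<otimes> k' = \<one>)"
      using that k by (metis inv_closed inv_equality inv_inv)
    then have "t ((inv g \<otimes> k, l), (inv h \<otimes> k', m)) = 0" for l m using t by blast
    then show ?thesis by (simp add: S_def case_prod_beta')
  qed
  have "(\<Sum>h\<in>carrier G. S g h) = (if g = k then S k k' else 0)" if "g \<in> carrier G" for g
  proof -
    have "(\<Sum>h\<in>carrier G. S g h) = (\<Sum>h\<in>carrier G. if h = k' then if g = k then S k k' else 0 else 0)"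
      using that by (intro sum.cong refl) (auto simp: S0)
    then show ?thesis using k finite_carrier by simp
  qed
  then have "(\<Sum>g\<in>carrier G. \<Sum>h\<in>carrier G. S g h) = S k k'"
    using k finite_carrier by simp
  then show ?thesis unfolding smash_tensor_mult_apply(1)[OF k] using k by (simp add: S_def)
qed

text \<open>The tensor \<open>B\<close> sits over the identity in bidegree \<open>(1, 1)\<close>,
  and bidegrees add up under multiplication.\<close>

lemma emb2_pow_eq_0:
  "\<not> (g = \<one> \<and> h = \<one> \<and> length l = n \<and> length m = n) \<Longrightarrow> (emb2 B [^]\<^bsub>T\<^esub> n) ((g, l), (h, m)) = 0"
proof (induction n arbitrary: g h l m)
  case 0
  then show ?case
    by (auto simp: smash_tensor_one smash_group_elem_def at_group_def ext_one_def split: if_splits)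
next
  case (Suc n)
  let ?b = "emb2 B [^]\<^bsub>T\<^esub> n"
  show ?case
  proof (cases "g \<in> carrier G \<and> h \<in> carrier G")
    case True
    have b: "\<forall>g h l m. ?b ((g, l), (h, m)) \<noteq> 0 \<longrightarrow> g = \<one> \<and> h = \<one>"
      using Suc.IH by blast
    have "(emb2 B [^]\<^bsub>T\<^esub> Suc n) ((g, l), (h, m)) = shuffle (\<lambda>(l1, l2). shuffle (\<lambda>(m1, m2).
          (-1) ^ (length m1 * length l2) * ?b ((\<one>, l1), (\<one>, m1)) * emb2 B ((g, l2), (h, m2))) m) l"
      unfolding T.nat_pow_Suc using True by (intro smash_tensor_mult_one_left[OF b]) auto
    also have "\<dots> = shuffle (\<lambda>_. shuffle (\<lambda>_. 0) m) l"
    proof (intro shuffle_cong, clarify, intro shuffle_cong, clarify)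
      fix l1 l2 m1 m2 :: "('v \<Rightarrow> complex) list"
      assume len: "length l1 + length l2 = length l" "length m1 + length m2 = length m"
      have "?b ((\<one>, l1), (\<one>, m1)) = 0" if "emb2 B ((g, l2), (h, m2)) \<noteq> 0"
      proof -
        have "g = \<one> \<and> h = \<one> \<and> length l2 = 1 \<and> length m2 = 1"
          using that by (auto simp: tensor_map_smash_embed split: if_splits list.splits)
        then show ?thesis using Suc.prems len by (intro Suc.IH) auto
      qed
      then show "(- 1) ^ (length m1 * length l2) * ?b ((\<one>, l1), (\<one>, m1)) * emb2 B ((g, l2), (h, m2)) = 0"
        by auto
    qed
    finally show ?thesis by simp
  qed (simp add: smash_tensor_mult_apply(2))
qed

text \<open>At a list of length n in the second variable only the n-th term of the exponential
  survives; if the first list has another length, that term is zero as well.\<close>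

lemma twist_apply:
  "twist G scale \<rho> B ((g, l), (h, m)) = (emb2 B [^]\<^bsub>T\<^esub> length m) ((g, l), (h, m)) / fact (length m)"
proof -
  have "(\<Sum>n. (emb2 B [^]\<^bsub>T\<^esub> n) ((g, l), (h, m)) / fact n) =
      (\<Sum>n\<in>{length m}. (emb2 B [^]\<^bsub>T\<^esub> n) ((g, l), (h, m)) / fact n)"
    by (intro suminf_finite) (auto simp: emb2_pow_eq_0)
  then show ?thesis by (simp add: twist_def exp_series_def)
qed

lemma twist_support: "\<forall>g h l m. twist G scale \<rho> B ((g, l), (h, m)) \<noteq> 0 \<longrightarrow> g = \<one> \<and> h = \<one>"
  unfolding twist_apply using emb2_pow_eq_0[of _ _ _ _ _ B] by fastforce

lemma twist_low:
  "twist G scale \<rho> B ((\<one>, []), (\<one>, [])) = 1"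
  "twist G scale \<rho> B ((\<one>, f # l), (\<one>, [])) = 0"
  "twist G scale \<rho> B ((\<one>, []), (\<one>, [f'])) = 0"
  "B \<in> VV \<Longrightarrow> twist G scale \<rho> B ((\<one>, [f]), (\<one>, [f'])) = B (f, f')"
proof -
  have "(emb2 B [^]\<^bsub>T\<^esub> length [f']) ((\<one>, []), (\<one>, [f'])) = 0"
    by (rule emb2_pow_eq_0) simp
  then show "twist G scale \<rho> B ((\<one>, []), (\<one>, [f'])) = 0"
    by (simp only: twist_apply) simp
  have "emb2 B [^]\<^bsub>T\<^esub> length [f'] = emb2 B" if "B \<in> VV"
    using emb2_mem[OF that] by (simp add: T.l_one)
  then show "twist G scale \<rho> B ((\<one>, [f]), (\<one>, [f'])) = B (f, f')" if "B \<in> VV"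
    unfolding twist_apply using that by (simp add: tensor_map_smash_embed)
qed (simp_all add: twist_apply smash_tensor_one smash_group_elem_def at_group_def ext_one_def)

text \<open>Up to bidegree \<open>(1, 1)\<close> only the constant and linear terms of the two
  exponentials matter. The left one contributes \<open>-B\<close>; the right one stands behind the
  group element \<open>k\<close>, so it contributes \<open>B\<close> acted on by
  \<open>k\<close>.\<close>

lemma twisted_comult_low:
  assumes B: "B \<in> VV" and x: "x \<in> smash_carrier G scale" and k: "k \<in> carrier G" "k' \<in> carrier G"
  shows "twisted_comult G scale \<rho> B x ((k, []), (k', [])) = (if k = k' then x (k, []) else 0)"
    and "twisted_comult G scale \<rho> B x ((k, [f]), (k', [])) = (if k = k' then x (k, [f]) else 0)"
    and "twisted_comult G scale \<rho> B x ((k, []), (k', [f'])) = (if k = k' then x (k, [f']) else 0)"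
    and "twisted_comult G scale \<rho> B x ((k, [f]), (k', [f'])) =
      (if k = k' then x (k, [f, f']) + (B (f \<circ> \<rho> k, f' \<circ> \<rho> k) - B (f, f')) * x (k, []) else 0)"
  unfolding twisted_comult_eq[OF B x] smash_tensor_mult_one_right[OF twist_support k] smash_tensor_mult_one_left[OF twist_support k] shuffle.simps
  by (simp_all add: twist_low B VV_closed(2)[OF B] smash_tensor_mult_one_left[OF twist_support k] smash_comult_formula_def algebra_simps)

lemma u_mult_apply:
  assumes "u \<in> carrier G" "k \<in> carrier G" "k' \<in> carrier G"
  shows "(pure_tensor (e u) (e \<one>) \<otimes>\<^bsub>T\<^esub> t) ((k, fs), (k', gs)) = t ((inv u \<otimes> k, map (\<lambda>f. f \<circ> \<rho> u) fs), (k', gs))"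
proof -
  have id: "map (\<lambda>f. f \<circ> \<rho> \<one>) l = l" for l :: "('v \<Rightarrow> complex) list"
    by (rule map_idI) (simp add: fun_eq_iff rep_one)
  have supp: "\<forall>g h l m. pure_tensor (e u) (e \<one>) ((g, l), (h, m :: ('v \<Rightarrow> complex) list)) \<noteq> 0 \<longrightarrow> g = u \<and> h = \<one>"
    by (auto simp: smash_group_elem_def at_group_def split: if_splits)
  have eq: "(-1) ^ (length m1 * length l2) * pure_tensor (e u) (e \<one>) ((u, l1), (\<one>, m1)) * z =
      (if l1 = [] then 1 else 0) * ((if m1 = [] then 1 else 0) * z)"
    for z and l1 l2 m1 :: "('v \<Rightarrow> complex) list"
    by (simp add: smash_group_elem_def at_group_def ext_one_def)
  have "(pure_tensor (e u) (e \<one>) \<otimes>\<^bsub>T\<^esub> t) ((k, fs), (k', gs)) =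
    shuffle (\<lambda>(l1, l2). shuffle (\<lambda>(m1, m2). (-1) ^ (length m1 * length l2) *
        pure_tensor (e u) (e \<one>) ((u, l1), (\<one>, m1)) *
        t ((inv u \<otimes> k, map (\<lambda>f. f \<circ> \<rho> u) l2), (inv \<one> \<otimes> k', map (\<lambda>f. f \<circ> \<rho> \<one>) m2))) gs) fs"
    using assms by (intro smash_tensor_mult_delta_left[OF supp]) auto
  also have "\<dots> = shuffle (\<lambda>(l1, l2). (if l1 = [] then 1 else 0) * shuffle (\<lambda>(m1, m2).
        (if m1 = [] then 1 else 0) * t ((inv u \<otimes> k, map (\<lambda>f. f \<circ> \<rho> u) l2), (k', m2))) gs) fs"
    using assms unfolding case_prod_beta' eq id shuffle_scale_apply by simp
  also have "\<dots> = t ((inv u \<otimes> k, map (\<lambda>f. f \<circ> \<rho> u) fs), (k', gs))"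
    by (simp only: shuffle_ext_one)
  finally show ?thesis .
qed

section \<open>Parity components and closure of the bosonised coproduct\<close>

lemma parity_part_linear:
  "parity_part p k (a + b) = parity_part p k a + parity_part p k b"
  "parity_part p k (fscale c a) = fscale c (parity_part p k a)"
  by (auto simp: parity_part_def fun_eq_iff)

lemma parity_part_mem:
  assumes "x \<in> smash_carrier G scale"
  shows "parity_part smash_parity k x \<in> smash_carrier G scale"
  using assms[unfolded smash_carrier_span]
proof (induction x rule: fspace.span_induct_alt)
  case base
  have "parity_part smash_parity k 0 = 0" by (auto simp: parity_part_def fun_eq_iff)
  then show ?case using fspace.subspace_0[OF subspace_smash_carrier] by metis
next
  case (step c s y)
  then obtain g vs where s: "s = at_group g (wedge scale vs)" "g \<in> carrier G" by blast
  have "parity_part smash_parity k s = (if length vs mod 2 = k then s else 0)"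
    using homogeneous_at_group_wedge[of vs g] unfolding homogeneous_def s(1)[symmetric]
    by (intro ext) (force simp: parity_part_def)
  then have "parity_part smash_parity k s \<in> smash_carrier G scale"
    unfolding s by (cases "length vs mod 2 = k")
      (simp_all only: at_group_mem[OF s(2) wedge_mem] if_True if_False simp_thms fspace.subspace_0[OF subspace_smash_carrier])
  then show ?case
    unfolding parity_part_linear using step.IH
    by (intro fspace.subspace_add[OF subspace_smash_carrier] fspace.subspace_scale[OF subspace_smash_carrier])
qed

lemma parity_part_T_mem:
  assumes "t \<in> carrier T"
  shows "parity_part (\<lambda>(_, z). smash_parity z) k t \<in> carrier T"
  using assms[unfolded smash_tensor_carrier tensor_space_def]
proof (induction t rule: fspace.span_induct_alt)
  case base
  have "parity_part (\<lambda>(_, z). smash_parity z) k 0 = 0" by (auto simp: parity_part_def fun_eq_iff)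
  then show ?case using T.carrier_zero by metis
next
  case (step c s y)
  then obtain a b where s: "s = pure_tensor a b" and ab: "a \<in> smash_carrier G scale" "b \<in> smash_carrier G scale" by blast
  have "parity_part (\<lambda>(_, z). smash_parity z) k s = pure_tensor a (parity_part smash_parity k b)"
    by (auto simp: parity_part_def s fun_eq_iff)
  then have "parity_part (\<lambda>(_, z). smash_parity z) k s \<in> carrier T"
    unfolding smash_tensor_carrier using ab by (simp only: pure_tensor_mem parity_part_mem)
  then show ?case
    unfolding parity_part_linear using step.IH by (intro T.carrier_add T.carrier_scale)
qed

lemma bosonised_comult_closed:
  assumes "B \<in> VV" "u \<in> carrier G" "x \<in> smash_carrier G scale"
  shows "bosonised_comult G scale \<rho> u B x \<in> carrier T"
proof -
  have "pure_tensor (e u) (e \<one>) \<in> carrier T"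
    unfolding smash_tensor_carrier using assms by (intro pure_tensor_mem group_elem_mem) auto
  then show ?thesis
    unfolding bosonised_comult_def Let_def using assms
    by (intro T.carrier_sum fspace.subspace_diff[OF T.subspace_carrier] T.carrier_scale T.m_closed parity_part_T_mem
        twisted_comult_closed parity_part_mem)
qed

end

section \<open>Low degrees and the filtration by powers of the ideal generated by
  \<open>V\<close>\<close>

lemma exterior_antisym:
  assumes "\<omega> \<in> exterior scale"
  shows "\<omega> [f', f] = - \<omega> [f, f']"
  using assms unfolding exterior_def
proof (induction \<omega> rule: fspace.span_induct_alt)
  case (step c s y)
  then obtain vs where s: "s = wedge scale vs" by blast
  have "s [f', f] = - s [f, f']"
  proof (cases "length vs = 2")
    case True
    then obtain v w where "vs = [v, w]" by (auto simp: numeral_2_eq_2 length_Suc_conv)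
    then have "s [f, f'] = vec scale v f * vec scale w f' - vec scale v f' * vec scale w f" for f f'
      by (simp only: s wedge_Cons wedge_Nil ext_mult_one ext_mult_embed_Cons ext_mult_embed_Nil)
        (simp add: ext_embed_def)
    then show ?thesis by simp
  next
    case False
    then have "wedge scale vs [f', f] = 0" "wedge scale vs [f, f'] = 0"
      using wedge_length[of scale vs] by fastforce+
    then show ?thesis by (simp add: s)
  qed
  then show ?case using step.IH by simp
qed simp

lemma exterior_single:
  assumes "\<omega> \<in> exterior scale"
  shows "\<exists>w. \<forall>f. \<omega> [f] = vec scale w f"
  using assms unfolding exterior_def
proof (induction \<omega> rule: fspace.span_induct_alt)
  case base
  \<comment> \<open>The vector \<open>scale 0 0\<close> has value zero at every \<open>f\<close> by
    \<open>vec_scale\<close> alone, for any \<open>scale\<close>.\<close>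
  have "\<forall>f. 0 = vec scale (scale 0 0) f" by (simp add: vec_scale)
  then show ?case by (auto intro: exI[of _ "scale 0 0"])
next
  case (step c s y)
  then obtain vs where s: "s = wedge scale vs" by blast
  have "\<exists>v. \<forall>f. s [f] = vec scale v f"
  proof (cases "length vs = 1")
    case True
    then obtain v where "vs = [v]" by (auto simp: length_Suc_conv)
    then show ?thesis by (auto simp: s wedge_single ext_embed_def)
  next
    case False
    then have "s [f] = 0" for f
      using wedge_length[of scale vs "[f]"] by (auto simp: s)
    then have "\<forall>f. s [f] = vec scale (scale 0 0) f" by (simp add: vec_scale)
    then show ?thesis ..
  qed
  then obtain v where "\<forall>f. s [f] = vec scale v f" ..
  moreover obtain w where "\<forall>f. y [f] = vec scale w f" using step.IH ..
  ultimately have "\<forall>f. (fscale c s + y) [f] = vec scale (scale c v + w) f"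
    by (simp add: vec_add vec_scale)
  then show ?case ..
qed

text \<open>On the carrier this is membership in \<open>I^n\<close>, where \<open>I\<close> is the
  ideal generated by \<open>V\<close>.\<close>

definition vanishing :: "nat \<Rightarrow> ('g, 'v) smash \<Rightarrow> bool" where
  "vanishing n x \<longleftrightarrow> (\<forall>g l. length l < n \<longrightarrow> x (g, l) = 0)"

lemma vanishingD: "vanishing n x \<Longrightarrow> length l < n \<Longrightarrow> x (g, l) = 0"
  by (simp add: vanishing_def)

lemma vanishing_lincomb: "vanishing n x \<Longrightarrow> vanishing n y \<Longrightarrow> vanishing n (fscale c x + y)"
  by (simp add: vanishing_def)

lemma parity_part_zero: "parity_part p k 0 = 0"
  by (simp add: parity_part_def fun_eq_iff)

lemma parity_part_homogeneous: "homogeneous i a \<Longrightarrow> parity_part smash_parity k a = (if k = i then a else 0)"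
  by (intro ext) (auto simp: parity_part_def homogeneous_def)

lemma parity_part_pure_tensor:
  "homogeneous i b \<Longrightarrow> parity_part (\<lambda>(_, z). smash_parity z) k (pure_tensor a b) = (if k = i then pure_tensor a b else 0)"
  unfolding parity_part_def homogeneous_def pure_tensor_def by (intro ext) (clarsimp, metis)

context finite_group_rep
begin

lemma vec_comp:
  assumes "g \<in> carrier G"
  shows "vec scale v (f \<circ> \<rho> g) = vec scale (\<rho> g v) f"
  using dual_space_comp_iff[of scale scale "\<rho> g" "\<rho> (inv g)" f] assms
  by (simp add: vec_def rep_linear rho_inv)

lemma vec_uminus: "vec scale (- v) f = - vec scale v f"
  using fun_cong[OF vec_scale[of scale "-1" v], of f] by (simp add: scale_minus_left)

lemma vec_inject:
  assumes "\<And>f. vec scale v f = vec scale w f"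
  shows "v = w"
proof (rule ccontr)
  assume "v \<noteq> w"
  interpret vector_space_pair scale "(*) :: complex \<Rightarrow> complex \<Rightarrow> complex"
    by unfold_locales (simp_all add: algebra_simps)
  have "independent {v - w}"
    using \<open>v \<noteq> w\<close> by simp
  then obtain f where f: "Vector_Spaces.linear scale (*) f" "f (v - w) = (1 :: complex)"
    using linear_independent_extend[of "{v - w}" "\<lambda>_. 1"] by auto
  have "vec scale (v + - w) f = 0"
    using fun_cong[OF vec_add[of scale v "- w"], of f] assms[of f] vec_uminus[of w f] by simp
  then show False using f by (simp add: vec_def dual_space_def)
qed

lemma smash_mult_Nil:
  "k \<in> carrier G \<Longrightarrow> (a \<otimes>\<^bsub>A\<^esub> b) (k, []) = (\<Sum>g\<in>carrier G. a (g, []) * b (inv g \<otimes> k, []))"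
  by (simp add: smash_algebra_def smash_mu_apply)

lemma smash_mult_single:
  "k \<in> carrier G \<Longrightarrow> (a \<otimes>\<^bsub>A\<^esub> b) (k, [f]) =
     (\<Sum>g\<in>carrier G. a (g, [f]) * b (inv g \<otimes> k, []) + a (g, []) * b (inv g \<otimes> k, [f \<circ> \<rho> g]))"
  by (simp add: smash_algebra_def smash_mu_apply)

lemma vanishing_mult:
  assumes "vanishing m a" "vanishing n b"
  shows "vanishing (m + n) (a \<otimes>\<^bsub>A\<^esub> b)"
  unfolding vanishing_def
proof (intro allI impI)
  fix k and l :: "('v \<Rightarrow> complex) list" assume l: "length l < m + n"
  show "(a \<otimes>\<^bsub>A\<^esub> b) (k, l) = 0"
  proof (cases "k \<in> carrier G")
    case True
    have "shuffle (\<lambda>(l1, l2). pure_tensor a b ((g, l1), (inv g \<otimes> k, map (\<lambda>f. f \<circ> \<rho> g) l2))) l = shuffle (\<lambda>_. 0) l" for g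
    proof (rule shuffle_cong, unfold prod.case)
      fix l1 l2 :: "('v \<Rightarrow> complex) list" assume "length l1 + length l2 = length l"
      then have "length l1 < m \<or> length l2 < n" using l by linarith
      then show "pure_tensor a b ((g, l1), (inv g \<otimes> k, map (\<lambda>f. f \<circ> \<rho> g) l2)) = 0"
        using assms by (auto simp: vanishing_def)
    qed
    then show ?thesis using True by (simp add: smash_algebra_def smash_mu_apply)
  qed (simp add: smash_algebra_def smash_mu_def)
qed

text \<open>A monomial lives in a single degree, so the linear truncation \<open>pr\<close> sends it
  to itself or to zero, while it fixes \<open>x\<close>. Thus \<open>I^n\<close> is spanned by
  monomials with at least \<open>n\<close> vectors, to which multiplicativity of \<open>F\<close>
  applies.\<close>

lemma vanishing_span:
  assumes x: "x \<in> smash_carrier G scale" and van: "vanishing n x"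
  shows "x \<in> fspace.span {at_group g (wedge scale vs) | g vs. g \<in> carrier G \<and> n \<le> length vs}" (is "_ \<in> ?S")
proof -
  define pr where "pr y = (\<lambda>(g, l). if length l < n then 0 else y (g, l))" for y :: "('a, 'v) smash"
  have "pr x \<in> ?S"
    using x[unfolded smash_carrier_span]
  proof (induction x rule: fspace.span_induct_alt)
    case base
    have eq: "pr 0 = 0" by (auto simp: pr_def fun_eq_iff)
    show ?case unfolding eq by (rule fspace.span_zero)
  next
    case (step c s y)
    then obtain g vs where s: "s = at_group g (wedge scale vs)" and g: "g \<in> carrier G" by blast
    have "pr s = (if n \<le> length vs then s else 0)"
    proof (intro ext, clarify)
      fix h and l :: "('v \<Rightarrow> complex) list"
      have "s (h, l) = 0" if "length l \<noteq> length vs"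
        using that wedge_length[of scale vs l] by (auto simp: s at_group_def)
      then show "pr s (h, l) = (if n \<le> length vs then s else 0) (h, l)"
        by (cases "length l = length vs") (auto simp: pr_def)
    qed
    moreover have "s \<in> ?S" if "n \<le> length vs"
      using that s g by (intro fspace.span_base) blast
    ultimately have "pr s \<in> ?S"
      using fspace.span_zero by (cases "n \<le> length vs") simp_all
    moreover have eq: "pr (fscale c s + y) = fscale c (pr s) + pr y"
      by (auto simp: pr_def fun_eq_iff)
    ultimately show ?case
      unfolding eq using step.IH by (intro fspace.span_add fspace.span_scale)
  qed
  moreover have "pr x = x"
    using van by (auto simp: pr_def vanishing_def fun_eq_iff)
  ultimately show ?thesis by simp
qed

lemma single_decomp:
  assumes "x \<in> smash_carrier G scale" "k \<in> carrier G"
  shows "\<exists>w. \<forall>f. x (k, [f]) = vec scale w f"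
  using assms exterior_single[of "\<lambda>l. x (k, l)" scale] by (simp add: smash_carrier_def)

lemma smash_antisym:
  assumes "x \<in> smash_carrier G scale" "k \<in> carrier G"
  shows "x (k, [f', f]) = - x (k, [f, f'])"
proof -
  have "(\<lambda>l. x (k, l)) \<in> exterior scale" using assms by (simp add: smash_carrier_def)
  then show ?thesis by (rule exterior_antisym)
qed

lemma smash_carrier_outside: "x \<in> smash_carrier G scale \<Longrightarrow> k \<notin> carrier G \<Longrightarrow> x (k, l) = 0"
  by (simp add: smash_carrier_def)

end

section \<open>The bosonised coproduct\<close>

locale twisted_supergroup = finite_group_rep G scale \<rho>
  for G :: "('g, 'm) monoid_scheme" (structure) and scale :: "complex \<Rightarrow> 'v::ab_group_add \<Rightarrow> 'v"
    and \<rho> :: "'g \<Rightarrow> 'v \<Rightarrow> 'v" +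
  fixes u :: 'g and B :: "('v \<Rightarrow> complex) \<times> ('v \<Rightarrow> complex) \<Rightarrow> complex"
  assumes u_closed: "u \<in> carrier G" and u_central: "g \<in> carrier G \<Longrightarrow> g \<otimes> u = u \<otimes> g"
    and u_ord: "ord u = 2" and u_act: "\<rho> u v = - v"
    and B_sym: "B \<in> sym_square scale"
begin

abbreviation (input) "D \<equiv> bosonised_comult G scale \<rho> u B"

lemma u_square: "u \<otimes> u = \<one>"
  using pow_ord_eq_1[OF u_closed] u_closed by (simp add: u_ord numeral_2_eq_2)

lemma inv_u: "inv u = u"
  using u_square u_closed by (simp add: inv_equality)

lemma u_neq_one: "u \<noteq> \<one>"
  using u_ord by auto

lemma u_mult_neq: "k \<in> carrier G \<Longrightarrow> u \<otimes> k \<noteq> k"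
  using u_neq_one u_closed by (simp add: r_cancel_one)

lemma u_eq_iff: "k \<in> carrier G \<Longrightarrow> k' \<in> carrier G \<Longrightarrow> u \<otimes> k = k' \<longleftrightarrow> k = u \<otimes> k'"
proof -
  have "u \<otimes> (u \<otimes> k) = k" if "k \<in> carrier G" for k
    using that u_closed by (simp add: m_assoc[symmetric] u_square)
  then show "k \<in> carrier G \<Longrightarrow> k' \<in> carrier G \<Longrightarrow> ?thesis" by auto
qed

lemma B_mem: "B \<in> VV" and B_swap: "B (f', f) = B (f, f')"
  using B_sym by (simp_all add: sym_square_def)

text \<open>This holds for arbitrary functions \<open>f\<close>, although
  \<open>f \<circ> \<rho> u\<close> is \<open>-f\<close> only for suitable ones: both sides vanish
  off the dual space.\<close>

lemma VV_neg_left: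
  assumes "C \<in> VV"
  shows "C (f \<circ> \<rho> u, f') = - C (f, f')" "C (f', f \<circ> \<rho> u) = - C (f', f)"
  using assms unfolding tensor_space_def
  by (induction C rule: fspace.span_induct_alt)
    (auto simp: vec_comp[OF u_closed] u_act vec_uminus algebra_simps)

lemma smash_neg_left:
  assumes "x \<in> smash_carrier G scale"
  shows "x (k, [f \<circ> \<rho> u, f']) = - x (k, [f, f'])"
proof -
  define h where "h = f \<circ> \<rho> u"
  have h: "vec scale v h = - vec scale v f" for v
    by (simp add: h_def vec_comp[OF u_closed] u_act vec_uminus)
  have "x (k, [h, f']) = - x (k, [f, f'])"
    using assms[unfolded smash_carrier_span]
  proof (induction x rule: fspace.span_induct_alt)
    case (step c s y)
    then obtain g vs where s: "s = at_group g (wedge scale vs)" by blast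
    have "wedge scale vs [h, f'] = - wedge scale vs [f, f']"
    proof (cases "length vs = 2")
      case True
      then obtain v w where vs: "vs = [v, w]" by (auto simp: numeral_2_eq_2 length_Suc_conv)
      have "wedge scale vs [f, f'] = vec scale v f * vec scale w f' - vec scale v f' * vec scale w f" for f f'
        by (simp only: vs wedge_Cons wedge_Nil ext_mult_one ext_mult_embed_Cons ext_mult_embed_Nil)
          (simp add: ext_embed_def)
      then show ?thesis by (simp add: h)
    next
      case False
      then have "wedge scale vs [h, f'] = 0" "wedge scale vs [f, f'] = 0"
        using wedge_length[of scale vs] by fastforce+
      then show ?thesis by simp
    qed
    then show ?case using step.IH by (simp add: s at_group_def)
  qed simp
  then show ?thesis by (simp only: h_def)
qed

lemma rho_u_comm: "g \<in> carrier G \<Longrightarrow> f \<circ> \<rho> u \<circ> \<rho> g = f \<circ> \<rho> g \<circ> \<rho> u"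
  using u_central[of g] u_closed by (simp add: fun_eq_iff rep_mult[symmetric])

lemma D_closed: "x \<in> smash_carrier G scale \<Longrightarrow> D x \<in> carrier T"
  by (intro bosonised_comult_closed B_mem u_closed)

lemma D_apply:
  assumes "k \<in> carrier G" "k' \<in> carrier G"
  shows "D x ((k, fs), (k', gs)) =
    (if length gs mod 2 = 0
     then twisted_comult G scale \<rho> B (parity_part smash_parity 0 x) ((k, fs), (k', gs)) +
       twisted_comult G scale \<rho> B (parity_part smash_parity 1 x) ((k, fs), (k', gs))
     else twisted_comult G scale \<rho> B (parity_part smash_parity 1 x) ((u \<otimes> k, map (\<lambda>f. f \<circ> \<rho> u) fs), (k', gs)) -
       twisted_comult G scale \<rho> B (parity_part smash_parity 0 x) ((u \<otimes> k, map (\<lambda>f. f \<circ> \<rho> u) fs), (k', gs)))"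
proof -
  have "parity_part (\<lambda>(_, z). smash_parity z) i t (y, (k', gs)) = (if length gs mod 2 = i then t (y, (k', gs)) else 0)"
    for i t and y :: "'g \<times> ('v \<Rightarrow> complex) list"
    by (simp add: parity_part_def smash_parity_def)
  then show ?thesis
    by (simp add: bosonised_comult_def Let_def u_mult_apply[OF u_closed assms] inv_u)
qed

text \<open>For an odd second factor, multiplication by \<open>u \<otimes> 1\<close> moves the first
  group element from \<open>k'\<close> to \<open>u \<otimes> k'\<close>. In bidegree
  \<open>(0, 1)\<close> the element is odd and the sign \<open>-(-1)^1\<close> is positive. In
  bidegree \<open>(1, 1)\<close> it is even; the sign \<open>-1\<close> cancels against the action
  of \<open>u\<close> on the first functional.\<close>

lemma D_low:
  assumes x: "x \<in> smash_carrier G scale" and k: "k \<in> carrier G" "k' \<in> carrier G"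
  shows "D x ((k, []), (k', [])) = (if k = k' then x (k, []) else 0)"
    and "D x ((k, [f]), (k', [])) = (if k = k' then x (k, [f]) else 0)"
    and "D x ((k, []), (k', [f'])) = (if k = u \<otimes> k' then x (k', [f']) else 0)"
    and "D x ((k, [f]), (k', [f'])) =
      (if k = u \<otimes> k' then x (k', [f, f']) + (B (f \<circ> \<rho> k', f' \<circ> \<rho> k') - B (f, f')) * x (k', []) else 0)"
proof -
  have uk: "u \<otimes> k \<in> carrier G" using u_closed k by simp
  have pp: "parity_part smash_parity i x (k, l) = (if length l mod 2 = i then x (k, l) else 0)" for i k l
    by (simp add: parity_part_def smash_parity_def)
  note low = twisted_comult_low[OF B_mem parity_part_mem[OF x] k] twisted_comult_low[OF B_mem parity_part_mem[OF x] uk k(2)]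
  have uk': "u \<otimes> k = k' \<longleftrightarrow> k = u \<otimes> k'" using k by (rule u_eq_iff)
  show "D x ((k, []), (k', [])) = (if k = k' then x (k, []) else 0)"
    and "D x ((k, [f]), (k', [])) = (if k = k' then x (k, [f]) else 0)"
    by (simp_all add: D_apply[OF k] low pp)
  show "D x ((k, []), (k', [f'])) = (if k = u \<otimes> k' then x (k', [f']) else 0)"
    using uk' by (auto simp add: D_apply[OF k] low pp)
  have "D x ((k, [f]), (k', [f'])) = (if u \<otimes> k = k' then - x (u \<otimes> k, [f \<circ> \<rho> u, f']) -
      (B (f \<circ> \<rho> u \<circ> \<rho> (u \<otimes> k), f' \<circ> \<rho> (u \<otimes> k)) - B (f \<circ> \<rho> u, f')) * x (u \<otimes> k, []) else 0)"
    by (simp add: D_apply[OF k] low pp)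
  also have "\<dots> = (if u \<otimes> k = k' then x (k', [f, f']) +
      (B (f \<circ> \<rho> k', f' \<circ> \<rho> k') - B (f, f')) * x (k', []) else 0)"
    by (cases "u \<otimes> k = k'")
      (simp_all only: if_True if_False smash_neg_left[OF x] rho_u_comm[OF k(2)] VV_neg_left[OF B_mem], simp add: algebra_simps)
  finally show "D x ((k, [f]), (k', [f'])) =
      (if k = u \<otimes> k' then x (k', [f, f']) + (B (f \<circ> \<rho> k', f' \<circ> \<rho> k') - B (f, f')) * x (k', []) else 0)"
    unfolding uk' .
qed

lemma twisted_comult_zero: "twisted_comult G scale \<rho> B 0 = 0"
proof -
  have "smash_comult_formula (0 :: ('g, 'v) smash) = 0"
    by (auto simp: smash_comult_formula_def fun_eq_iff)
  then show ?thesis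
    unfolding twisted_comult_eq[OF B_mem fspace.subspace_0[OF subspace_smash_carrier]]
    by (simp only: T.zero_left T.zero_right)
qed

text \<open>\<open>B\<close> is invariant under \<open>u\<close>, which acts by -1 in both factors,
  so \<open>u\<close> stays grouplike whatever \<open>B\<close> is.\<close>

lemma D_u: "D (e u) = pure_tensor (e u) (e u)"
proof -
  have "(\<lambda>(f, f'). B (f \<circ> \<rho> u, f' \<circ> \<rho> u)) = B"
    by (auto simp: VV_neg_left[OF B_mem])
  then have tw: "twisted_comult G scale \<rho> B (e u) = pure_tensor (e u) (e u)"
    using emb2_group[OF u_closed B_mem]
    by (subst twisted_comult_central[OF B_mem group_elem_mem[OF u_closed]]) (simp_all only: comult_formula_group)
  show ?thesis
    unfolding bosonised_comult_def Let_def
    by (simp add: parity_part_homogeneous[OF homogeneous_group_elem] parity_part_pure_tensor[OF homogeneous_group_elem] tw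
        twisted_comult_zero parity_part_zero T.zero_right fspace.scale_zero_right)
qed

lemma D_vec: "D (emb (vec scale v)) = pure_tensor (emb (vec scale v)) (e \<one>) + pure_tensor (e u) (emb (vec scale v))"
proof -
  let ?v = "emb (vec scale v)"
  have tw: "twisted_comult G scale \<rho> B ?v = pure_tensor ?v (e \<one>) + pure_tensor (e \<one>) ?v"
    using emb2_vec_comm[OF B_mem]
    by (subst twisted_comult_central[OF B_mem embed_mem]) (simp_all only: comult_formula_vec)
  have "pure_tensor (e u) (e \<one>) \<otimes>\<^bsub>T\<^esub> pure_tensor (e \<one>) ?v = pure_tensor (e u) ?v"
    unfolding smash_tensor_mult_pure[OF homogeneous_group_elem homogeneous_group_elem]
    using embed_mem group_elem_mem[OF u_closed] by (simp add: smash_mult_one)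
  then show ?thesis
    unfolding bosonised_comult_def Let_def
    by (simp add: parity_part_homogeneous[OF homogeneous_embed] parity_part_pure_tensor[OF homogeneous_group_elem]
        parity_part_pure_tensor[OF homogeneous_embed] tw parity_part_linear
        twisted_comult_zero parity_part_zero T.zero_right fspace.scale_zero_right)
qed

end

section \<open>Homomorphisms of the Hopf algebras\<close>

text \<open>In a group algebra the product condition says that the element with coefficients
  \<open>c\<close> is grouplike: the values are idempotents, distinct ones are orthogonal, and the
  sum 1 leaves exactly one.\<close>

lemma grouplike_function:
  fixes c :: "'g \<Rightarrow> complex"
  assumes "finite K" "sum c K = 1" and mult: "\<And>k k'. k \<in> K \<Longrightarrow> k' \<in> K \<Longrightarrow> c k * c k' = (if k = k' then c k else 0)"
  shows "\<exists>\<gamma>\<in>K. \<forall>k\<in>K. c k = (if k = \<gamma> then 1 else 0)"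
proof -
  obtain \<gamma> where \<gamma>: "\<gamma> \<in> K" "c \<gamma> \<noteq> 0"
    using assms(2) sum.neutral[of K c] by fastforce
  have "c \<gamma> = 1" using mult[OF \<gamma>(1) \<gamma>(1)] \<gamma>(2) by simp
  moreover have "c k = 0" if "k \<in> K" "k \<noteq> \<gamma>" for k
    using mult[OF \<gamma>(1) that(1)] that(2) \<gamma>(2) by simp
  ultimately show ?thesis using \<gamma>(1) by auto
qed

lemma length_less_2: "length l < 2 \<longleftrightarrow> l = [] \<or> (\<exists>f. l = [f])"
  by (cases l rule: remdups_adj.cases) auto

lemma eq_if_add_eq_diff_eq: "a + x = y \<Longrightarrow> - a + x = y \<Longrightarrow> x = y" for x y :: complex
  by (simp add: complex_eq_iff)

text \<open>An isomorphism yields two instances of this locale, itself and its inverse, which are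
  compared later on.\<close>

locale hopf_hom = S1: twisted_supergroup G1 scale1 \<rho>1 u1 B1 + S2: twisted_supergroup G2 scale2 \<rho>2 u2 B2
  for G1 :: "('g1, 'm1) monoid_scheme" and scale1 :: "complex \<Rightarrow> 'v1::ab_group_add \<Rightarrow> 'v1"
    and \<rho>1 :: "'g1 \<Rightarrow> 'v1 \<Rightarrow> 'v1" and u1 B1
    and G2 :: "('g2, 'm2) monoid_scheme" and scale2 :: "complex \<Rightarrow> 'v2::ab_group_add \<Rightarrow> 'v2"
    and \<rho>2 :: "'g2 \<Rightarrow> 'v2 \<Rightarrow> 'v2" and u2 B2 +
  fixes F :: "('g1, 'v1) smash \<Rightarrow> ('g2, 'v2) smash"
  assumes F_linear: "linear_map_on (smash_carrier G1 scale1) F"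
    and F_closed: "x \<in> smash_carrier G1 scale1 \<Longrightarrow> F x \<in> smash_carrier G2 scale2"
    and F_mult: "x \<in> smash_carrier G1 scale1 \<Longrightarrow> y \<in> smash_carrier G1 scale1 \<Longrightarrow>
      F (x \<otimes>\<^bsub>smash_algebra G1 scale1 \<rho>1\<^esub> y) = F x \<otimes>\<^bsub>smash_algebra G2 scale2 \<rho>2\<^esub> F y"
    and F_one: "F (smash_group_elem \<one>\<^bsub>G1\<^esub>) = smash_group_elem \<one>\<^bsub>G2\<^esub>"
    and F_comult: "x \<in> smash_carrier G1 scale1 \<Longrightarrow>
      bosonised_comult G2 scale2 \<rho>2 u2 B2 (F x) = tensor_map F F (bosonised_comult G1 scale1 \<rho>1 u1 B1 x)"
    and F_counit: "x \<in> smash_carrier G1 scale1 \<Longrightarrow> smash_counit G2 (F x) = smash_counit G1 x"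
begin

abbreviation (input) "C1 \<equiv> smash_carrier G1 scale1"
abbreviation (input) "C2 \<equiv> smash_carrier G2 scale2"
abbreviation (input) "e1 \<equiv> smash_group_elem :: 'g1 \<Rightarrow> ('g1, 'v1) smash"
abbreviation (input) "x1 v \<equiv> smash_embed G1 (vec scale1 v)"

lemma F_lincomb: "x \<in> C1 \<Longrightarrow> y \<in> C1 \<Longrightarrow> F (fscale c x + y) = fscale c (F x) + F y"
  using F_linear fspace.subspace_scale[OF subspace_smash_carrier, of x G1 scale1 c] unfolding linear_map_on_def by metis

lemma F_zero: "F 0 = 0"
  using fspace_lincomb_zero[OF F_linear] fspace.subspace_0[OF subspace_smash_carrier] by blast

lemma tensor_F_pure: "x \<in> C1 \<Longrightarrow> y \<in> C1 \<Longrightarrow> tensor_map F F (pure_tensor x y) = pure_tensor (F x) (F y)"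
  by (rule tensor_map_pure_tensor[OF F_linear F_linear])

lemma tensor_F_add:
  "s \<in> carrier (smash_tensor G1 scale1 \<rho>1) \<Longrightarrow> t \<in> carrier (smash_tensor G1 scale1 \<rho>1) \<Longrightarrow>
    tensor_map F F (s + t) = tensor_map F F s + tensor_map F F t"
  using tensor_map_linear[OF subspace_smash_carrier subspace_smash_carrier F_linear F_linear]
  unfolding linear_map_on_def S1.smash_tensor_carrier by blast

lemma tensor_F_scale:
  "t \<in> carrier (smash_tensor G1 scale1 \<rho>1) \<Longrightarrow> tensor_map F F (fscale c t) = fscale c (tensor_map F F t)"
  using tensor_map_linear[OF subspace_smash_carrier subspace_smash_carrier F_linear F_linear]
  unfolding linear_map_on_def S1.smash_tensor_carrier by blast

lemma pure_T1: "x \<in> C1 \<Longrightarrow> y \<in> C1 \<Longrightarrow> pure_tensor x y \<in> carrier (smash_tensor G1 scale1 \<rho>1)"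
  unfolding S1.smash_tensor_carrier by (rule pure_tensor_mem)

lemma one_Nil: "(smash_group_elem \<one>\<^bsub>G2\<^esub> :: ('g2, 'v2) smash) (k, l) = (if k = \<one>\<^bsub>G2\<^esub> \<and> l = [] then 1 else 0)"
  by (simp add: smash_group_elem_def at_group_def ext_one_def)

section \<open>Preservation of the filtration\<close>

lemma F_u_degree0:
  "\<exists>\<gamma>\<in>carrier G2. \<forall>k\<in>carrier G2. F (e1 u1) (k, []) = (if k = \<gamma> then 1 else 0)"
proof (rule grouplike_function[OF S2.finite_carrier])
  have u: "e1 u1 \<in> C1" by (rule S1.group_elem_mem[OF S1.u_closed])
  show "(\<Sum>k\<in>carrier G2. F (e1 u1) (k, [])) = 1"
    using F_counit[OF u] S1.smash_counit_group_elem[OF S1.u_closed] by (simp add: smash_counit_def)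
  fix k k' assume k: "k \<in> carrier G2" "k' \<in> carrier G2"
  have "S2.D (F (e1 u1)) = pure_tensor (F (e1 u1)) (F (e1 u1))"
    by (simp only: F_comult[OF u] S1.D_u tensor_F_pure[OF u u])
  then show "F (e1 u1) (k, []) * F (e1 u1) (k', []) = (if k = k' then F (e1 u1) (k, []) else 0)"
    using S2.D_low(1)[OF F_closed[OF u] k] by simp
qed

lemma D_F_vec: "S2.D (F (x1 v)) = pure_tensor (F (x1 v)) (smash_group_elem \<one>\<^bsub>G2\<^esub>) + pure_tensor (F (e1 u1)) (F (x1 v))"
proof -
  note mem = S1.embed_mem S1.group_elem_mem[OF S1.u_closed] S1.group_elem_mem[OF S1.one_closed]
  show ?thesis
    by (simp only: F_comult[OF S1.embed_mem] S1.D_vec tensor_F_add pure_T1 mem tensor_F_pure F_one)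
qed

text \<open>Modulo the radical, the image of a vector is skew primitive in a group algebra, hence a multiple
  \<open>c (1 - \<gamma>)\<close>; since its square vanishes, \<open>c = 0\<close>.\<close>

lemma vanishing_F_vec: "vanishing 1 (F (x1 v))"
proof -
  define z where "z k = F (x1 v) (k, [])" for k
  note v = S1.embed_mem[of v] and u = S1.group_elem_mem[OF S1.u_closed]
  obtain \<gamma> where \<gamma>: "\<gamma> \<in> carrier G2" and \<gamma>_eq: "\<And>k. k \<in> carrier G2 \<Longrightarrow> F (e1 u1) (k, []) = (if k = \<gamma> then 1 else 0)"
    using F_u_degree0 by blast
  \<comment> \<open>Coefficient of \<open>k \<otimes> k'\<close> in
    \<open>\<Delta>(z) = z \<otimes> 1 + \<gamma> \<otimes> z\<close>, the bidegree
    \<open>(0, 0)\<close> part of the relation for \<open>F(v)\<close>.\<close>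
  have rel: "(if k = k' then z k else 0) = (if k' = \<one>\<^bsub>G2\<^esub> then z k else 0) + (if k = \<gamma> then z k' else 0)"
    if k: "k \<in> carrier G2" "k' \<in> carrier G2" for k k'
  proof -
    have if_mult: "x * (if P then 1 else 0) = (if P then x else 0)" "(if P then 1 else 0) * x = (if P then x else 0)"
      for P and x :: complex by simp_all
    have "S2.D (F (x1 v)) ((k, []), (k', [])) = F (x1 v) (k, []) * (smash_group_elem \<one>\<^bsub>G2\<^esub> :: ('g2, 'v2) smash) (k', []) +
        F (e1 u1) (k, []) * F (x1 v) (k', [])"
      by (simp add: D_F_vec)
    then show ?thesis
      unfolding S2.D_low(1)[OF F_closed[OF v] k] one_Nil \<gamma>_eq[OF k(1)] by (simp only: if_mult z_def simp_thms)
  qed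
  have z0: "z k = 0" if "k \<in> carrier G2" "k \<noteq> \<gamma>" "k \<noteq> \<one>\<^bsub>G2\<^esub>" for k
    using rel[of k k] that by simp
  have "z k = 0" if "k \<in> carrier G2" for k
  proof (cases "\<gamma> = \<one>\<^bsub>G2\<^esub>")
    case True
    then have "z \<gamma> = 0" using rel[OF \<gamma> \<gamma>] by simp
    then show ?thesis using z0 that True by (cases "k = \<gamma>") auto
  next
    case False
    have "z \<gamma> + z \<one>\<^bsub>G2\<^esub> = 0"
      using rel[OF \<gamma> S2.one_closed] False by simp
    then have z\<gamma>: "z \<gamma> = - z \<one>\<^bsub>G2\<^esub>"
      by (simp only: eq_neg_iff_add_eq_0)
    \<comment> \<open>Since \<open>u1\<close> is an involution, so is \<gamma>. The coefficient of
      the identity in the square of \<open>z\<close> is therefore the sum of the squares of the two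
      opposite coefficients of \<open>z\<close>.\<close>
    have "e1 \<one>\<^bsub>G1\<^esub> = e1 u1 \<otimes>\<^bsub>smash_algebra G1 scale1 \<rho>1\<^esub> e1 u1"
      using S1.smash_group_mult[OF S1.u_closed S1.u_closed] by (simp add: S1.u_square)
    then have "smash_group_elem \<one>\<^bsub>G2\<^esub> = F (e1 u1) \<otimes>\<^bsub>smash_algebra G2 scale2 \<rho>2\<^esub> F (e1 u1)"
      using F_one F_mult[OF u u] by simp
    then have "1 = (\<Sum>g\<in>carrier G2. F (e1 u1) (g, []) * F (e1 u1) (inv\<^bsub>G2\<^esub> g \<otimes>\<^bsub>G2\<^esub> \<one>\<^bsub>G2\<^esub>, []))"
      using S2.smash_mult_Nil[OF S2.one_closed] one_Nil[of "\<one>\<^bsub>G2\<^esub>" "[]"] by simp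
    also have "\<dots> = (\<Sum>g\<in>carrier G2. if g = \<gamma> then if inv\<^bsub>G2\<^esub> \<gamma> = \<gamma> then 1 else 0 else 0)"
      by (intro sum.cong refl) (auto simp: \<gamma>_eq)
    finally have inv\<gamma>: "inv\<^bsub>G2\<^esub> \<gamma> = \<gamma>"
      using \<gamma> S2.finite_carrier by (simp split: if_splits)
    have "F (x1 v) \<otimes>\<^bsub>smash_algebra G2 scale2 \<rho>2\<^esub> F (x1 v) = 0"
      using F_mult[OF v v] by (simp only: S1.embed_square F_zero)
    then have "0 = (\<Sum>g\<in>carrier G2. z g * z (inv\<^bsub>G2\<^esub> g))"
      using S2.smash_mult_Nil[OF S2.one_closed, of "F (x1 v)" "F (x1 v)"] by (simp add: z_def)
    also have "\<dots> = (\<Sum>g\<in>{\<one>\<^bsub>G2\<^esub>, \<gamma>}. z g * z (inv\<^bsub>G2\<^esub> g))"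
      using S2.finite_carrier \<gamma> z0 by (intro sum.mono_neutral_right) auto
    also have "\<dots> = 2 * (z \<one>\<^bsub>G2\<^esub> * z \<one>\<^bsub>G2\<^esub>)"
      using False by (simp add: inv\<gamma> z\<gamma>)
    finally have z1: "z \<one>\<^bsub>G2\<^esub> = 0" by simp
    then have "z \<gamma> = 0" using z\<gamma> by (simp only: neg_0_equal_iff_equal minus_zero)
    with z1 show ?thesis using z0 that by metis
  qed
  then show ?thesis
    using S2.smash_carrier_outside[OF F_closed[OF v]] by (auto simp: vanishing_def z_def)
qed

lemma at_group_wedge_mem: "g \<in> carrier G1 \<Longrightarrow> at_group g (wedge scale1 vs) \<in> C1"
  by (rule at_group_mem[OF _ wedge_mem])

lemma vanishing_F_wedge: "g \<in> carrier G1 \<Longrightarrow> vanishing (length vs) (F (at_group g (wedge scale1 vs)))"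
proof (induction vs)
  case Nil
  show ?case by (simp add: vanishing_def)
next
  case (Cons v vs)
  show ?case
    unfolding S1.at_group_wedge_Cons[OF Cons.prems] F_mult[OF S1.embed_mem at_group_wedge_mem[OF Cons.prems]]
    using S2.vanishing_mult[OF vanishing_F_vec Cons.IH[OF Cons.prems]] by simp
qed

lemma vanishing_F:
  assumes "x \<in> C1" "vanishing n x"
  shows "vanishing n (F x)"
proof -
  have "x \<in> C1 \<and> vanishing n (F x)"
    using S1.vanishing_span[OF assms]
  proof (induction x rule: fspace.span_induct_alt)
    case base
    have "vanishing n 0" by (simp add: vanishing_def)
    then show ?case unfolding F_zero using fspace.subspace_0[OF subspace_smash_carrier] by blast
  next
    case (step c s y)
    then obtain g vs where s: "s = at_group g (wedge scale1 vs)" and g: "g \<in> carrier G1" and n: "n \<le> length vs"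
      by blast
    have mem: "s \<in> C1" "y \<in> C1" using step.IH at_group_wedge_mem[OF g] s by auto
    have "vanishing n (F s)"
      using vanishing_F_wedge[OF g, of vs] n by (auto simp: vanishing_def s)
    then show ?case
      unfolding F_lincomb[OF mem] using step.IH mem vanishing_lincomb
        fspace.subspace_add[OF subspace_smash_carrier] fspace.subspace_scale[OF subspace_smash_carrier] by blast
  qed
  then show ?thesis ..
qed

text \<open>So \<open>F\<close> induces maps modulo \<open>I^n\<close>; leading terms of a composite
  can be computed from leading terms of its factors.\<close>

lemma F_eq_below:
  assumes "x \<in> C1" "y \<in> C1" "vanishing n (x - y)" "length l < n"
  shows "F x (k, l) = F y (k, l)"
proof -
  have mem: "x - y \<in> C1" using fspace.subspace_diff[OF subspace_smash_carrier assms(1,2)] .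
  have "F x = F (fscale 1 (x - y) + y)" by simp
  also have "\<dots> = fscale 1 (F (x - y)) + F y" by (rule F_lincomb[OF mem assms(2)])
  finally show ?thesis using vanishingD[OF vanishing_F[OF mem assms(3)] assms(4)] by simp
qed

text \<open>The assumption places \<open>t\<close> in
  \<open>I^2 \<otimes> A + A \<otimes> I^2\<close>, and \<open>F \<otimes> F\<close> preserves this
  space. One variable is treated at a time: a slice of \<open>t\<close> at a short first list lies
  in \<open>I^2\<close> and is kept there by \<open>F\<close>, so the function \<open>h\<close> of
  the first variable lies in \<open>I^2\<close> as well.\<close>

lemma tensor_F_low_zero:
  assumes t: "t \<in> carrier (smash_tensor G1 scale1 \<rho>1)"
    and low: "\<And>k l k' m. k \<in> carrier G1 \<Longrightarrow> k' \<in> carrier G1 \<Longrightarrow> length l < 2 \<Longrightarrow> length m < 2 \<Longrightarrow> t ((k, l), (k', m)) = 0"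
    and len: "length l < 2" "length m < 2"
  shows "tensor_map F F t ((j, l), (j', m)) = 0"
proof -
  note slices = tensor_slices[OF subspace_smash_carrier subspace_smash_carrier F_linear t[unfolded S1.smash_tensor_carrier]]
  define h where "h = (\<lambda>x. F (\<lambda>y. t (x, y)) (j', m))"
  have h: "h \<in> C1" using slices by (simp add: h_def)
  have "h (k, l) = 0" if l: "length l < 2" for k l
  proof (cases "k \<in> carrier G1")
    case True
    have mem: "(\<lambda>y. t ((k, l), y)) \<in> C1" using slices by blast
    have "vanishing 2 (\<lambda>y. t ((k, l), y))"
      unfolding vanishing_def
    proof (intro allI impI)
      fix k' and m' :: "('v1 \<Rightarrow> complex) list" assume "length m' < 2"
      then show "t ((k, l), (k', m')) = 0"
        using low[OF True _ l] S1.smash_carrier_outside[OF mem] by (cases "k' \<in> carrier G1") auto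
    qed
    from vanishingD[OF vanishing_F[OF mem this] len(2)] show ?thesis by (simp add: h_def)
  qed (rule S1.smash_carrier_outside[OF h])
  then have "vanishing 2 h" by (simp add: vanishing_def)
  from vanishingD[OF vanishing_F[OF h this] len(1)] show ?thesis by (simp add: h_def tensor_map_def)
qed

text \<open>For \<open>C = g \<cdot> B - B\<close> this is the component of bidegree \<open>(1, 1)\<close> of the coproduct of \<open>g\<close>.\<close>

definition quad :: "'g1 \<Rightarrow> (('v1 \<Rightarrow> complex) \<times> ('v1 \<Rightarrow> complex) \<Rightarrow> complex) \<Rightarrow> ('g1, 'v1) smash2" where
  "quad g C = (\<lambda>((k, l), (k', m)). if k = u1 \<otimes>\<^bsub>G1\<^esub> g \<and> k' = g then case (l, m) of ([f], [f']) \<Rightarrow> C (f, f') | _ \<Rightarrow> 0 else 0)"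

lemma quad_linear: "quad g (fscale c C + C') = fscale c (quad g C) + quad g C'"
  by (intro ext; clarify; simp add: quad_def split: list.split)

lemma quad_pure: "quad g (pure_tensor a b) = pure_tensor (at_group (u1 \<otimes>\<^bsub>G1\<^esub> g) (ext_embed a)) (at_group g (ext_embed b))"
  by (intro ext) (auto simp: quad_def at_group_def ext_embed_def split: list.splits)

lemma quad_zero: "quad g 0 = 0"
  by (intro ext; clarify; simp add: quad_def split: list.split)

lemma at_group_embed_mem: "g \<in> carrier G1 \<Longrightarrow> at_group g (ext_embed (vec scale1 v)) \<in> C1"
  using at_group_wedge_mem[of g "[v]"] by (simp add: wedge_single)

lemma quad_mem:
  assumes g: "g \<in> carrier G1" and C: "C \<in> S1.VV"
  shows "quad g C \<in> carrier (smash_tensor G1 scale1 \<rho>1)"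
  using C unfolding tensor_space_def
proof (induction C rule: fspace.span_induct_alt)
  case base
  show ?case by (simp only: quad_zero S1.T.carrier_zero)
next
  case (step c x y)
  then obtain v w where x: "x = pure_tensor (vec scale1 v) (vec scale1 w)" by auto
  have "quad g x \<in> carrier (smash_tensor G1 scale1 \<rho>1)"
    unfolding x quad_pure using g S1.u_closed by (intro pure_T1 at_group_embed_mem) auto
  then show ?case
    unfolding quad_linear using step.IH by (intro S1.T.carrier_add S1.T.carrier_scale)
qed

lemma tensor_F_quad_lincomb:
  assumes "g \<in> carrier G1" "x \<in> S1.VV" "y \<in> S1.VV"
  shows "tensor_map F F (quad g (fscale c x + y)) = fscale c (tensor_map F F (quad g x)) + tensor_map F F (quad g y)"
  using assms by (simp only: quad_linear tensor_F_add tensor_F_scale quad_mem S1.T.carrier_scale)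

lemma tensor_F_quad_pure:
  "g \<in> carrier G1 \<Longrightarrow> tensor_map F F (quad g (pure_tensor (vec scale1 v) (vec scale1 w))) =
     pure_tensor (F (at_group (u1 \<otimes>\<^bsub>G1\<^esub> g) (ext_embed (vec scale1 v)))) (F (at_group g (ext_embed (vec scale1 w))))"
  unfolding quad_pure using S1.u_closed by (intro tensor_F_pure at_group_embed_mem) auto

lemma tensor_F_zero: "tensor_map F F 0 = 0"
  using tensor_F_scale[OF S1.T.carrier_zero, of 0] by (simp only: fspace.scale_zero_left)

text \<open>\<open>quad g C\<close> lies in \<open>I \<otimes> I\<close>, and \<open>F\<close> maps
  \<open>I\<close> to \<open>I\<close>; the correction is thus invisible in bidegrees
  \<open>(0, 0)\<close>, \<open>(1, 0)\<close> and \<open>(0, 1)\<close>.\<close>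

lemma tensor_F_quad_Nil:
  assumes g: "g \<in> carrier G1" and C: "C \<in> S1.VV"
  shows "tensor_map F F (quad g C) ((j, []), (j', m)) = 0" "tensor_map F F (quad g C) ((j, l), (j', [])) = 0"
proof -
  have van: "F (at_group h (ext_embed (vec scale1 v))) (k, []) = 0" if "h \<in> carrier G1" for h v k
    using vanishingD[OF vanishing_F_wedge[OF that, of "[v]"], of "[]"] by (simp add: wedge_single)
  have ug: "u1 \<otimes>\<^bsub>G1\<^esub> g \<in> carrier G1" using g S1.u_closed by simp
  from C have "tensor_map F F (quad g C) ((j, []), (j', m)) = 0 \<and> tensor_map F F (quad g C) ((j, l), (j', [])) = 0"
  proof (induction C rule: S1.VV_induct)
    case zero
    show ?case by (simp only: quad_zero tensor_F_zero) simp
  next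
    case (step c v w y)
    show ?case
      unfolding tensor_F_quad_lincomb[OF g S1.pure_VV step.hyps(1)] tensor_F_quad_pure[OF g] using step.IH van[OF g] van[OF ug]
      by simp
  qed
  then show "tensor_map F F (quad g C) ((j, []), (j', m)) = 0" "tensor_map F F (quad g C) ((j, l), (j', [])) = 0"
    by auto
qed

definition dB :: "'g1 \<Rightarrow> ('v1 \<Rightarrow> complex) \<times> ('v1 \<Rightarrow> complex) \<Rightarrow> complex" where
  "dB g = (\<lambda>(f, f'). B1 (f \<circ> \<rho>1 g, f' \<circ> \<rho>1 g)) - B1"

lemma dB_mem:
  assumes g: "g \<in> carrier G1"
  shows "dB g \<in> S1.VV"
proof -
  define act where "act C = (\<lambda>(f, f'). C (f \<circ> \<rho>1 g, f' \<circ> \<rho>1 g))" for C :: "('v1 \<Rightarrow> complex) \<times> ('v1 \<Rightarrow> complex) \<Rightarrow> complex"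
  have "act C \<in> S1.VV" if "C \<in> S1.VV" for C
    using that
  proof (induction C rule: S1.VV_induct)
    case zero
    have "act 0 = 0" by (auto simp: act_def)
    then show ?case using fspace.subspace_0[OF subspace_tensor_space] by (simp only:)
  next
    case (step c v w y)
    have "act (fscale c (pure_tensor (vec scale1 v) (vec scale1 w)) + y) =
        fscale c (pure_tensor (vec scale1 (\<rho>1 g v)) (vec scale1 (\<rho>1 g w))) + act y"
      by (intro ext) (simp add: act_def case_prod_beta' pure_tensor_def S1.vec_comp[OF g])
    then show ?case
      using step.IH S1.pure_VV by (simp only: fspace.subspace_add[OF subspace_tensor_space]
          fspace.subspace_scale[OF subspace_tensor_space])
  qed
  then show ?thesis
    unfolding dB_def act_def[symmetric] using S1.B_mem by (intro S1.VV_closed)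
qed

text \<open>After \<open>g \<otimes> g\<close> and the quadratic term are subtracted, the coproduct
  of \<open>g\<close> vanishes in all bidegrees up to \<open>(1, 1)\<close>. By
  \<open>tensor_F_low_zero\<close> the image of this remainder does so too.\<close>

lemma D_F_group:
  assumes g: "g \<in> carrier G1" and len: "length l < 2" "length m < 2"
  shows "S2.D (F (e1 g)) ((j, l), (j', m)) =
    F (e1 g) (j, l) * F (e1 g) (j', m) + tensor_map F F (quad g (dB g)) ((j, l), (j', m))"
proof -
  note eg = S1.group_elem_mem[OF g]
  let ?t = "pure_tensor (e1 g) (e1 g)" and ?q = "quad g (dB g)"
  have mem: "?t \<in> carrier (smash_tensor G1 scale1 \<rho>1)" "?q \<in> carrier (smash_tensor G1 scale1 \<rho>1)"
    "S1.D (e1 g) \<in> carrier (smash_tensor G1 scale1 \<rho>1)"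
    using pure_T1[OF eg eg] quad_mem[OF g dB_mem[OF g]] S1.D_closed[OF eg] by auto
  have r: "S1.D (e1 g) - (?t + ?q) \<in> carrier (smash_tensor G1 scale1 \<rho>1)"
    using mem by (intro fspace.subspace_diff[OF S1.T.subspace_carrier] S1.T.carrier_add)
  have ex: "e1 g (k, l) = (if k = g \<and> l = [] then 1 else 0)" for k and l :: "('v1 \<Rightarrow> complex) list"
    by (simp add: smash_group_elem_def at_group_def ext_one_def)
  have "(S1.D (e1 g) - (?t + ?q)) ((k, l), (k', m)) = 0"
    if k: "k \<in> carrier G1" "k' \<in> carrier G1" and len: "length l < 2" "length m < 2" for k l k' m
    using len unfolding length_less_2 by (elim disjE exE; simp add: S1.D_low[OF eg k] ex quad_def dB_def)
  then have "tensor_map F F (S1.D (e1 g) - (?t + ?q)) ((j, l), (j', m)) = 0"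
    by (intro tensor_F_low_zero[OF r] len)
  moreover have "S1.D (e1 g) = (S1.D (e1 g) - (?t + ?q)) + (?t + ?q)" by simp
  then have "tensor_map F F (S1.D (e1 g)) = tensor_map F F (S1.D (e1 g) - (?t + ?q)) + (pure_tensor (F (e1 g)) (F (e1 g)) + tensor_map F F ?q)"
    using tensor_F_add[OF r S1.T.carrier_add[OF mem(1,2)]] tensor_F_add[OF mem(1,2)] tensor_F_pure[OF eg eg] by (simp only:)
  ultimately show ?thesis
    unfolding F_comult[OF eg] by simp
qed

section \<open>The induced group homomorphism\<close>

lemma F_group_exists: "\<exists>\<phi>. \<forall>g\<in>carrier G1. \<phi> g \<in> carrier G2 \<and> (\<forall>k. F (e1 g) (k, []) = (if k = \<phi> g then 1 else 0))"
proof (rule bchoice, rule ballI)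
  fix g assume g: "g \<in> carrier G1"
  note eg = S1.group_elem_mem[OF g]
  have "\<exists>\<gamma>\<in>carrier G2. \<forall>k\<in>carrier G2. F (e1 g) (k, []) = (if k = \<gamma> then 1 else 0)"
  proof (rule grouplike_function[OF S2.finite_carrier])
    show "(\<Sum>k\<in>carrier G2. F (e1 g) (k, [])) = 1"
      using F_counit[OF eg] S1.smash_counit_group_elem[OF g] by (simp add: smash_counit_def)
    fix k k' assume k: "k \<in> carrier G2" "k' \<in> carrier G2"
    show "F (e1 g) (k, []) * F (e1 g) (k', []) = (if k = k' then F (e1 g) (k, []) else 0)"
      using D_F_group[OF g, of "[]" "[]" k k'] S2.D_low(1)[OF F_closed[OF eg] k]
      by (simp add: tensor_F_quad_Nil[OF g dB_mem[OF g]])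
  qed
  then obtain \<gamma> where "\<gamma> \<in> carrier G2" "\<forall>k\<in>carrier G2. F (e1 g) (k, []) = (if k = \<gamma> then 1 else 0)" by blast
  then show "\<exists>\<gamma>. \<gamma> \<in> carrier G2 \<and> (\<forall>k. F (e1 g) (k, []) = (if k = \<gamma> then 1 else 0))"
    using S2.smash_carrier_outside[OF F_closed[OF eg]] by metis
qed

definition gmap :: "'g1 \<Rightarrow> 'g2" where
  "gmap = (SOME \<phi>. \<forall>g\<in>carrier G1. \<phi> g \<in> carrier G2 \<and> (\<forall>k. F (e1 g) (k, []) = (if k = \<phi> g then 1 else 0)))"

lemma gmap_closed: "g \<in> carrier G1 \<Longrightarrow> gmap g \<in> carrier G2"
  and F_group_Nil: "g \<in> carrier G1 \<Longrightarrow> F (e1 g) (k, []) = (if k = gmap g then 1 else 0)"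
  using someI_ex[OF F_group_exists] unfolding gmap_def by blast+

lemma sum_delta_left:
  "x \<in> carrier G2 \<Longrightarrow> (\<Sum>g\<in>carrier G2. (if g = x then 1 else 0) * h g) = (h x :: complex)"
  using S2.finite_carrier by (simp add: if_distrib[of "\<lambda>a. a * _"] cong: if_cong)

lemma gmap_mult:
  assumes "g \<in> carrier G1" "h \<in> carrier G1"
  shows "gmap (g \<otimes>\<^bsub>G1\<^esub> h) = gmap g \<otimes>\<^bsub>G2\<^esub> gmap h"
proof -
  let ?k = "gmap g \<otimes>\<^bsub>G2\<^esub> gmap h"
  have k: "?k \<in> carrier G2" using assms gmap_closed by simp
  have "F (e1 (g \<otimes>\<^bsub>G1\<^esub> h)) (?k, []) = (F (e1 g) \<otimes>\<^bsub>smash_algebra G2 scale2 \<rho>2\<^esub> F (e1 h)) (?k, [])"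
    using assms by (simp only: S1.smash_group_mult[symmetric] F_mult S1.group_elem_mem)
  also have "\<dots> = 1"
    unfolding S2.smash_mult_Nil[OF k] F_group_Nil[OF assms(1)] sum_delta_left[OF gmap_closed[OF assms(1)]] F_group_Nil[OF assms(2)]
    using assms gmap_closed by (simp add: S2.m_assoc[symmetric])
  finally show ?thesis
    using F_group_Nil[of "g \<otimes>\<^bsub>G1\<^esub> h" ?k] assms by (simp split: if_splits)
qed

section \<open>The induced map of representations\<close>

lemma F_vec_Nil: "F (x1 v) (k, []) = 0"
  using vanishingD[OF vanishing_F_vec, of "[]"] by simp

lemma F_vec_exists: "\<exists>\<eta>. \<forall>v f. F (x1 v) (\<one>\<^bsub>G2\<^esub>, [f]) = vec scale2 (\<eta> v) f"
proof (rule choice, rule allI)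
  show "\<exists>w. \<forall>f. F (x1 v) (\<one>\<^bsub>G2\<^esub>, [f]) = vec scale2 w f" for v
    by (rule S2.single_decomp[OF F_closed[OF S1.embed_mem] S2.one_closed])
qed

definition vmap :: "'v1 \<Rightarrow> 'v2" where
  "vmap = (SOME \<eta>. \<forall>v f. F (x1 v) (\<one>\<^bsub>G2\<^esub>, [f]) = vec scale2 (\<eta> v) f)"

text \<open>In bidegree \<open>(1, 0)\<close> at \<open>(k, k)\<close> with \<open>k\<close> not the
  identity, the left side of \<open>D_F_vec\<close> is the value of \<open>F(v)\<close> at
  \<open>k\<close>, while on the right the unit vanishes at \<open>k\<close> and \<open>F(v)\<close>
  has no degree zero part.\<close>

lemma F_vec_single: "F (x1 v) (k, [f]) = (if k = \<one>\<^bsub>G2\<^esub> then vec scale2 (vmap v) f else 0)"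
proof -
  have "F (x1 v) (k, [f]) = 0" if "k \<noteq> \<one>\<^bsub>G2\<^esub>"
  proof (cases "k \<in> carrier G2")
    case True
    then show ?thesis
      using S2.D_low(2)[OF F_closed[OF S1.embed_mem] True True, of v f] that
      by (simp add: D_F_vec F_vec_Nil one_Nil)
  qed (rule S2.smash_carrier_outside[OF F_closed[OF S1.embed_mem]])
  moreover have "\<forall>v f. F (x1 v) (\<one>\<^bsub>G2\<^esub>, [f]) = vec scale2 (vmap v) f"
    unfolding vmap_def by (rule someI_ex[OF F_vec_exists])
  ultimately show ?thesis by simp
qed

text \<open>In bidegree \<open>(0, 1)\<close> the definition of the coproduct puts the degree one
  part of \<open>F(v)\<close> behind \<open>u2\<close>, while skew primitivity puts it behind the
  image of \<open>u1\<close>.\<close>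

lemma gmap_u:
  assumes "vmap v \<noteq> 0"
  shows "gmap u1 = u2"
proof (rule ccontr)
  assume neq: "gmap u1 \<noteq> u2"
  have "vec scale2 (vmap v) f = 0" for f
    using S2.D_low(3)[OF F_closed[OF S1.embed_mem] S2.u_closed S2.one_closed, of v f] neq S2.u_closed
    by (simp add: D_F_vec F_vec_single F_vec_Nil one_Nil F_group_Nil[OF S1.u_closed])
  moreover have "vec scale2 0 f = 0" for f
    using fun_cong[OF vec_scale[of scale2 0 0], of f] by simp
  ultimately have "vmap v = 0"
    by (intro S2.vec_inject) simp
  then show False using assms by simp
qed

text \<open>At \<open>k = gmap g\<close>, bidegree \<open>(0, 1)\<close> over
  \<open>(u2 k, k)\<close> expresses this value as a multiple of the degree zero part of
  \<open>F(g)\<close> at \<open>u2 k\<close>, which vanishes because \<open>u2 k\<close> differs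
  from \<open>k\<close>. At any other \<open>k\<close>, bidegree \<open>(1, 0)\<close> over
  \<open>(k, k)\<close> does the same with the degree zero part at \<open>k\<close>.\<close>

lemma F_group_single:
  assumes g: "g \<in> carrier G1"
  shows "F (e1 g) (k, [f]) = 0"
proof (cases "k \<in> carrier G2")
  case k: True
  note eg = F_closed[OF S1.group_elem_mem[OF g]] and q = tensor_F_quad_Nil[OF g dB_mem[OF g]]
  show ?thesis
  proof (cases "k = gmap g")
    case True
    then show ?thesis
      using D_F_group[OF g, of "[]" "[f]" "u2 \<otimes>\<^bsub>G2\<^esub> k" k] S2.D_low(3)[OF eg _ k, of "u2 \<otimes>\<^bsub>G2\<^esub> k" f] k S2.u_closed
        S2.u_mult_neq[OF k]
      by (simp add: q F_group_Nil[OF g])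
  next
    case False
    then show ?thesis
      using D_F_group[OF g, of "[f]" "[]" k k] S2.D_low(2)[OF eg k k, of f]
      by (simp add: q F_group_Nil[OF g])
  qed
qed (rule S2.smash_carrier_outside[OF F_closed[OF S1.group_elem_mem[OF g]]])

lemma F_at_group_embed_single:
  assumes g: "g \<in> carrier G1"
  shows "F (at_group g (ext_embed (vec scale1 v))) (gmap g, [f]) = vec scale2 (vmap v) f"
proof -
  have "at_group g (ext_embed (vec scale1 v)) = x1 v \<otimes>\<^bsub>smash_algebra G1 scale1 \<rho>1\<^esub> e1 g"
    using S1.at_group_wedge_Cons[OF g, of v "[]"] by (simp add: wedge_single wedge_Nil smash_group_elem_def)
  then have "F (at_group g (ext_embed (vec scale1 v))) = F (x1 v) \<otimes>\<^bsub>smash_algebra G2 scale2 \<rho>2\<^esub> F (e1 g)"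
    by (simp only: F_mult[OF S1.embed_mem S1.group_elem_mem[OF g]])
  then show ?thesis
    using S2.finite_carrier gmap_closed[OF g]
    by (simp add: S2.smash_mult_single F_vec_single F_vec_Nil F_group_Nil[OF g] if_distrib[of "\<lambda>a. a * _"] cong: if_cong)
qed

lemma vmap_linear: "Vector_Spaces.linear scale1 scale2 vmap"
proof -
  have lincomb: "vec scale2 (vmap (scale1 c v + w)) f = vec scale2 (scale2 c (vmap v) + vmap w) f" for c v w f
  proof -
    have "x1 (scale1 c v + w) = fscale c (x1 v) + x1 w"
      by (intro ext) (auto simp: smash_embed_def at_group_def ext_embed_def vec_add vec_scale split: list.splits)
    then have "F (x1 (scale1 c v + w)) (\<one>\<^bsub>G2\<^esub>, [f]) = c * F (x1 v) (\<one>\<^bsub>G2\<^esub>, [f]) + F (x1 w) (\<one>\<^bsub>G2\<^esub>, [f])"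
      by (simp only: F_lincomb[OF S1.embed_mem S1.embed_mem]) simp
    then show ?thesis
      unfolding F_vec_single by (simp only: if_True simp_thms) (simp add: vec_add vec_scale)
  qed
  have 1: "vmap (scale1 c v + w) = scale2 c (vmap v) + vmap w" for c v w
    by (rule S2.vec_inject[OF lincomb])
  have 0: "vmap 0 = 0" using 1[of 1 0 0] by simp
  show ?thesis
    using 1[of 1] 1[of _ _ 0] 0 by unfold_locales simp_all
qed

text \<open>Degree one part over \<open>gmap g\<close> of the image of the relation
  \<open>g v = (g \<cdot> v) g\<close>.\<close>

lemma vmap_equivariant:
  assumes g: "g \<in> carrier G1"
  shows "vmap (\<rho>1 g v) = \<rho>2 (gmap g) (vmap v)"
proof (rule S2.vec_inject)
  fix f
  note gm = gmap_closed[OF g]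
  have "F (e1 g) \<otimes>\<^bsub>smash_algebra G2 scale2 \<rho>2\<^esub> F (x1 v) = F (x1 (\<rho>1 g v)) \<otimes>\<^bsub>smash_algebra G2 scale2 \<rho>2\<^esub> F (e1 g)"
    using F_mult[OF S1.group_elem_mem[OF g] S1.embed_mem] F_mult[OF S1.embed_mem S1.group_elem_mem[OF g]]
    by (simp only: S1.group_elem_mult_embed[OF g])
  then have "(F (e1 g) \<otimes>\<^bsub>smash_algebra G2 scale2 \<rho>2\<^esub> F (x1 v)) (gmap g, [f]) =
      (F (x1 (\<rho>1 g v)) \<otimes>\<^bsub>smash_algebra G2 scale2 \<rho>2\<^esub> F (e1 g)) (gmap g, [f])" by (simp only:)
  then show "vec scale2 (vmap (\<rho>1 g v)) f = vec scale2 (\<rho>2 (gmap g) (vmap v)) f"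
    using S2.finite_carrier gm
    by (simp add: S2.smash_mult_single F_vec_single F_vec_Nil F_group_Nil[OF g] F_group_single[OF g] S2.vec_comp
        if_distrib[of "\<lambda>a. a * _"] cong: if_cong)
qed

lemma tensor_F_quad_single:
  assumes g: "g \<in> carrier G1" and C: "C \<in> S1.VV" and f: "f \<in> dual_space scale2" "f' \<in> dual_space scale2"
  shows "tensor_map F F (quad g C) ((gmap (u1 \<otimes>\<^bsub>G1\<^esub> g), [f]), (gmap g, [f'])) = C (f \<circ> vmap, f' \<circ> vmap)"
proof -
  have "f \<circ> vmap \<in> dual_space scale1" if "f \<in> dual_space scale2" for f
    using Vector_Spaces.linear_compose[OF vmap_linear] that by (simp add: dual_space_def)
  then have vec: "vec scale1 v (f \<circ> vmap) = vec scale2 (vmap v) f" if "f \<in> dual_space scale2" for v f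
    using that by (simp add: vec_def)
  define h h' where "h = f \<circ> vmap" and "h' = f' \<circ> vmap"
  have vec': "vec scale1 v h = vec scale2 (vmap v) f" "vec scale1 v h' = vec scale2 (vmap v) f'" for v
    using vec[OF f(1)] vec[OF f(2)] by (simp_all only: h_def h'_def)
  have ug: "u1 \<otimes>\<^bsub>G1\<^esub> g \<in> carrier G1" using g S1.u_closed by simp
  from C have "tensor_map F F (quad g C) ((gmap (u1 \<otimes>\<^bsub>G1\<^esub> g), [f]), (gmap g, [f'])) = C (h, h')"
  proof (induction C rule: S1.VV_induct)
    case zero
    show ?case by (simp only: quad_zero tensor_F_zero) simp
  next
    case (step c v w y)
    show ?case
      unfolding tensor_F_quad_lincomb[OF g S1.pure_VV step.hyps(1)] tensor_F_quad_pure[OF g]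
      using step.IH F_at_group_embed_single[OF g] F_at_group_embed_single[OF ug] by (simp add: vec')
  qed
  then show ?thesis by (simp only: h_def h'_def)
qed

text \<open>The unknown degree two part of \<open>F g\<close> contributes an antisymmetric term to the component of bidegree
  \<open>(1, 1)\<close>, while the twists contribute symmetric ones.\<close>

lemma B_invariance:
  assumes u: "gmap u1 = u2" and g: "g \<in> carrier G1"
    and f: "f \<in> dual_space scale2" "f' \<in> dual_space scale2"
  shows "B2 (f \<circ> \<rho>2 (gmap g), f' \<circ> \<rho>2 (gmap g)) - B2 (f, f') =
    B1 (f \<circ> vmap \<circ> \<rho>1 g, f' \<circ> vmap \<circ> \<rho>1 g) - B1 (f \<circ> vmap, f' \<circ> vmap)"
proof -
  let ?k = "gmap g"
  have k: "?k \<in> carrier G2" "u2 \<otimes>\<^bsub>G2\<^esub> ?k \<in> carrier G2" and ug: "gmap (u1 \<otimes>\<^bsub>G1\<^esub> g) = u2 \<otimes>\<^bsub>G2\<^esub> ?k"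
    using gmap_closed[OF g] S2.u_closed gmap_mult[OF S1.u_closed g] u by auto
  note eg = F_closed[OF S1.group_elem_mem[OF g]]
  \<comment> \<open>Bidegree \<open>(1, 1)\<close> over \<open>(u2 \<otimes> k, k)\<close> with
    \<open>k = gmap g\<close>. The product term of \<open>D_F_group\<close> drops out by
    \<open>F_group_single\<close>, and \<open>gmap u1 = u2\<close> places the quadratic term over
    the same pair.\<close>
  have *: "F (e1 g) (?k, [f, f']) + (B2 (f \<circ> \<rho>2 ?k, f' \<circ> \<rho>2 ?k) - B2 (f, f')) = dB g (f \<circ> vmap, f' \<circ> vmap)"
    if "f \<in> dual_space scale2" "f' \<in> dual_space scale2" for f f'
    using D_F_group[OF g, of "[f]" "[f']" "u2 \<otimes>\<^bsub>G2\<^esub> ?k" ?k] S2.D_low(4)[OF eg k(2,1), of f f']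
      tensor_F_quad_single[OF g dB_mem[OF g] that]
    by (simp add: ug F_group_Nil[OF g] F_group_single[OF g])
  let ?x = "B2 (f \<circ> \<rho>2 ?k, f' \<circ> \<rho>2 ?k) - B2 (f, f')" and ?y = "dB g (f \<circ> vmap, f' \<circ> vmap)"
  \<comment> \<open>Exchanging \<open>f\<close> and \<open>f'\<close> changes only the sign of the
    degree two part of \<open>F(g)\<close>.\<close>
  have "- F (e1 g) (?k, [f, f']) + ?x = ?y"
    using *[OF f(2,1)] S2.smash_antisym[OF eg k(1), of f' f] by (simp add: dB_def S1.B_swap S2.B_swap)
  with *[OF f] have "?x = ?y" by (rule eq_if_add_eq_diff_eq)
  then show ?thesis by (simp add: dB_def)
qed

end

section \<open>Transport of structure\<close>

lemma tensor_map_vec_map: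
  "tensor_map (vec_map scale \<eta>) (vec_map scale \<eta>) B (f, f') =
     (if f \<in> dual_space scale \<and> f' \<in> dual_space scale then B (f \<circ> \<eta>, f' \<circ> \<eta>) else 0)"
  by (simp add: tensor_map_def vec_map_def)

lemma tensor_vec_outside:
  assumes "C \<in> tensor_space (range (vec scale)) (range (vec scale))"
    and "\<not> (f \<in> dual_space scale \<and> f' \<in> dual_space scale)"
  shows "C (f, f') = 0"
  using assms unfolding tensor_space_def
  by (induction C rule: fspace.span_induct_alt) (auto simp: vec_def)

lemma tensor_map_vec_map_mem:
  assumes \<eta>: "Vector_Spaces.linear scale scale' \<eta>"
    and "C \<in> tensor_space (range (vec scale)) (range (vec scale))"
  shows "tensor_map (vec_map scale' \<eta>) (vec_map scale' \<eta>) C \<in> tensor_space (range (vec scale')) (range (vec scale'))"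
    (is "?t C \<in> _")
  using assms(2) unfolding tensor_space_def
proof (induction C rule: fspace.span_induct_alt)
  case base
  have "?t 0 = 0"
    by (intro ext) (auto simp: tensor_map_vec_map)
  then show ?case using fspace.span_zero by metis
next
  case (step c s y)
  then obtain v w where s: "s = pure_tensor (vec scale v) (vec scale w)" by auto
  have vec: "vec scale v (f \<circ> \<eta>) = vec scale' (\<eta> v) f" if "f \<in> dual_space scale'" for v f
    using that Vector_Spaces.linear_compose[OF \<eta>, of "(*)" f] by (simp add: vec_def dual_space_def)
  have eq: "?t (fscale c s + y) = fscale c (pure_tensor (vec scale' (\<eta> v)) (vec scale' (\<eta> w))) + ?t y"
  proof (intro ext, clarify)
    fix f f'
    show "?t (fscale c s + y) (f, f') = (fscale c (pure_tensor (vec scale' (\<eta> v)) (vec scale' (\<eta> w))) + ?t y) (f, f')"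
      by (cases "f \<in> dual_space scale' \<and> f' \<in> dual_space scale'")
        (auto simp: tensor_map_vec_map s vec, auto simp: vec_def)
  qed
  have "pure_tensor (vec scale' (\<eta> v)) (vec scale' (\<eta> w)) \<in>
      fspace.span {pure_tensor a b | a b. a \<in> range (vec scale') \<and> b \<in> range (vec scale')}"
    by (rule fspace.span_base) blast
  then show ?case
    unfolding eq using step.IH by (intro fspace.span_add fspace.span_scale)
qed

lemma hopf_iso_hopf_A:
  "hopf_iso (hopf_A G scale \<rho> u B) (hopf_A G' scale' \<rho>' u' B') F \<longleftrightarrow>
     linear_map_on (smash_carrier G scale) F \<and> bij_betw F (smash_carrier G scale) (smash_carrier G' scale') \<and>
     (\<forall>x\<in>smash_carrier G scale. \<forall>y\<in>smash_carrier G scale.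
        F (x \<otimes>\<^bsub>smash_algebra G scale \<rho>\<^esub> y) = F x \<otimes>\<^bsub>smash_algebra G' scale' \<rho>'\<^esub> F y) \<and>
     F (smash_group_elem \<one>\<^bsub>G\<^esub>) = smash_group_elem \<one>\<^bsub>G'\<^esub> \<and>
     (\<forall>x\<in>smash_carrier G scale.
        bosonised_comult G' scale' \<rho>' u' B' (F x) = tensor_map F F (bosonised_comult G scale \<rho> u B x) \<and>
        smash_counit G' (F x) = smash_counit G x)"
proof -
  have hom: "F \<in> hom (hopf_A G scale \<rho> u B) (hopf_A G' scale' \<rho>' u' B') \<longleftrightarrow>
      F \<in> smash_carrier G scale \<rightarrow> smash_carrier G' scale' \<and>
      (\<forall>x\<in>smash_carrier G scale. \<forall>y\<in>smash_carrier G scale.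
        F (x \<otimes>\<^bsub>smash_algebra G scale \<rho>\<^esub> y) = F x \<otimes>\<^bsub>smash_algebra G' scale' \<rho>'\<^esub> F y)"
    by (simp add: hom_def hopf_A_def monoid.extend_def smash_algebra_def)
  have simps: "carrier (hopf_A G scale \<rho> u B) = smash_carrier G scale" "\<one>\<^bsub>hopf_A G scale \<rho> u B\<^esub> = smash_group_elem \<one>\<^bsub>G\<^esub>"
    "comult (hopf_A G scale \<rho> u B) = bosonised_comult G scale \<rho> u B" "counit (hopf_A G scale \<rho> u B) = smash_counit G"
    for G :: "('x, 'y) monoid_scheme" and scale :: "complex \<Rightarrow> 'z::ab_group_add \<Rightarrow> 'z" and \<rho> u B
    by (simp_all add: hopf_A_def monoid.extend_def smash_algebra_def)
  show ?thesis
    unfolding hopf_iso_def iso_def mem_Collect_eq hom simps using bij_betw_imp_funcset by blast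
qed

context finite_group_rep
begin

text \<open>The action through \<open>vec_map\<close> restricts to linear functionals. As
  \<open>C\<close> vanishes off them and composition with \<open>\<rho> g\<close> reflects
  linearity, invariance holds at all functions.\<close>

lemma sym_square_invariants_apply:
  assumes C: "C \<in> sym_square_invariants G scale \<rho>" and g: "g \<in> carrier G"
  shows "C (f \<circ> \<rho> g, f' \<circ> \<rho> g) = C (f, f')"
proof -
  have mem: "C \<in> VV" using C by (simp add: sym_square_invariants_def sym_square_def)
  have dual: "f \<circ> \<rho> g \<in> dual_space scale \<longleftrightarrow> f \<in> dual_space scale" for f
    using dual_space_comp_iff[of scale scale "\<rho> g" "\<rho> (inv g)" f] g by (simp add: rep_linear rho_inv)
  have "tensor_map (vec_map scale (\<rho> g)) (vec_map scale (\<rho> g)) C (f, f') = C (f, f')"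
    using C g by (simp add: sym_square_invariants_def)
  then show ?thesis
    unfolding tensor_map_vec_map
    using tensor_vec_outside[OF mem, of f f'] tensor_vec_outside[OF mem, of "f \<circ> \<rho> g" "f' \<circ> \<rho> g"]
    by (cases "f \<in> dual_space scale \<and> f' \<in> dual_space scale") (simp_all only: dual if_True if_False simp_thms)
qed

lemma sym_square_invariantsI:
  assumes sym: "C \<in> sym_square scale"
    and inv: "\<And>g f f'. g \<in> carrier G \<Longrightarrow> f \<in> dual_space scale \<Longrightarrow> f' \<in> dual_space scale \<Longrightarrow>
      C (f \<circ> \<rho> g, f' \<circ> \<rho> g) = C (f, f')"
  shows "C \<in> sym_square_invariants G scale \<rho>"
proof -
  have mem: "C \<in> VV" using sym by (simp add: sym_square_def)
  have "tensor_map (vec_map scale (\<rho> g)) (vec_map scale (\<rho> g)) C (f, f') = C (f, f')" if "g \<in> carrier G" for g f f'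
    unfolding tensor_map_vec_map using inv[OF that] tensor_vec_outside[OF mem, of f f'] by auto
  then show ?thesis using sym by (simp add: sym_square_invariants_def fun_eq_iff)
qed

end

lemma rep_iso_inverse:
  assumes "rep_iso G scale \<rho> scale' \<rho>' \<eta>"
  shows "Vector_Spaces.linear scale scale' \<eta>" "Vector_Spaces.linear scale' scale (inv_into UNIV \<eta>)"
    "\<eta> (inv_into UNIV \<eta> w) = w" "inv_into UNIV \<eta> (\<eta> v) = v"
proof -
  show lin: "Vector_Spaces.linear scale scale' \<eta>" and
    inv: "\<eta> (inv_into UNIV \<eta> w) = w" "inv_into UNIV \<eta> (\<eta> v) = v" for v w
    using assms by (auto simp: rep_iso_def bij_is_surj surj_f_inv_f bij_is_inj)
  interpret Vector_Spaces.linear scale scale' \<eta> by (rule lin)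
  have "inv_into UNIV \<eta> (x + y) = inv_into UNIV \<eta> x + inv_into UNIV \<eta> y" for x y
    using add[of "inv_into UNIV \<eta> x" "inv_into UNIV \<eta> y"] by (metis inv)
  moreover have "inv_into UNIV \<eta> (scale' c x) = scale c (inv_into UNIV \<eta> x)" for c x
    using scale[of c "inv_into UNIV \<eta> x"] by (metis inv)
  ultimately show "Vector_Spaces.linear scale' scale (inv_into UNIV \<eta>)"
    by unfold_locales
qed

section \<open>The isomorphism induced by \<open>\<phi>\<close> and \<open>\<eta>\<close>\<close>

locale transport = S1: twisted_supergroup G1 scale1 \<rho>1 u1 B1 + S2: twisted_supergroup G2 scale2 \<rho>2 u2 B2
  for G1 :: "('g1, 'm1) monoid_scheme" and scale1 :: "complex \<Rightarrow> 'v1::ab_group_add \<Rightarrow> 'v1"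
    and \<rho>1 :: "'g1 \<Rightarrow> 'v1 \<Rightarrow> 'v1" and u1 B1
    and G2 :: "('g2, 'm2) monoid_scheme" and scale2 :: "complex \<Rightarrow> 'v2::ab_group_add \<Rightarrow> 'v2"
    and \<rho>2 :: "'g2 \<Rightarrow> 'v2 \<Rightarrow> 'v2" and u2 B2 +
  fixes \<phi> :: "'g1 \<Rightarrow> 'g2" and \<eta> :: "'v1 \<Rightarrow> 'v2"
  assumes \<phi>: "\<phi> \<in> iso G1 G2" and \<phi>_u: "\<phi> u1 = u2"
    and \<eta>: "rep_iso G1 scale1 \<rho>1 scale2 (\<rho>2 \<circ> \<phi>) \<eta>"
    and inv: "tensor_map (vec_map scale2 \<eta>) (vec_map scale2 \<eta>) B1 - B2 \<in> sym_square_invariants G2 scale2 \<rho>2"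
begin

definition \<psi> :: "'g2 \<Rightarrow> 'g1" where "\<psi> = inv_into (carrier G1) \<phi>"
definition \<eta>' :: "'v2 \<Rightarrow> 'v1" where "\<eta>' = inv_into UNIV \<eta>"
definition tr :: "('v2 \<Rightarrow> complex) list \<Rightarrow> ('v1 \<Rightarrow> complex) list" where "tr = map (\<lambda>f. f \<circ> \<eta>)"
text \<open>The map \<open>g \<omega> \<mapsto> \<phi>(g) \<eta>(\<omega>)\<close>. Elements being
  functions of group elements and functionals, it is pullback along the inverse of \<phi> and the
  transpose of \<eta>, and no basis is involved.\<close>

definition F :: "('g1, 'v1) smash \<Rightarrow> ('g2, 'v2) smash" where
  "F x = (\<lambda>(k, l). if k \<in> carrier G2 then x (\<psi> k, tr l) else 0)"
definition B' :: "('v2 \<Rightarrow> complex) \<times> ('v2 \<Rightarrow> complex) \<Rightarrow> complex" where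
  "B' = (\<lambda>(f, f'). B1 (f \<circ> \<eta>, f' \<circ> \<eta>))"

abbreviation (input) "FF \<equiv> tensor_map F F"

lemma \<phi>_closed: "g \<in> carrier G1 \<Longrightarrow> \<phi> g \<in> carrier G2"
  and \<psi>_closed: "k \<in> carrier G2 \<Longrightarrow> \<psi> k \<in> carrier G1"
  and \<phi>_\<psi>: "k \<in> carrier G2 \<Longrightarrow> \<phi> (\<psi> k) = k"
  and \<psi>_\<phi>: "g \<in> carrier G1 \<Longrightarrow> \<psi> (\<phi> g) = g"
  using \<phi> by (auto simp: \<psi>_def iso_def bij_betw_def hom_in_carrier inv_into_into f_inv_into_f)

lemma \<psi>_bij: "bij_betw \<psi> (carrier G2) (carrier G1)"
  using \<phi> unfolding \<psi>_def iso_def by (simp add: bij_betw_inv_into)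

lemma \<psi>_mult: "k \<in> carrier G2 \<Longrightarrow> k' \<in> carrier G2 \<Longrightarrow> \<psi> (k \<otimes>\<^bsub>G2\<^esub> k') = \<psi> k \<otimes>\<^bsub>G1\<^esub> \<psi> k'"
  using \<phi> hom_mult[of \<phi> G1 G2 "\<psi> k" "\<psi> k'"] \<psi>_\<phi>[of "\<psi> k \<otimes>\<^bsub>G1\<^esub> \<psi> k'"]
  by (simp add: \<psi>_closed \<phi>_\<psi> iso_def)

lemma \<psi>_one: "\<psi> \<one>\<^bsub>G2\<^esub> = \<one>\<^bsub>G1\<^esub>"
  using \<psi>_mult[of "\<one>\<^bsub>G2\<^esub>" "\<one>\<^bsub>G2\<^esub>"] \<psi>_closed[of "\<one>\<^bsub>G2\<^esub>"] S1.l_cancel_one' by simp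

lemma \<psi>_inv: "k \<in> carrier G2 \<Longrightarrow> \<psi> (inv\<^bsub>G2\<^esub> k) = inv\<^bsub>G1\<^esub> \<psi> k"
  using \<psi>_mult[of "inv\<^bsub>G2\<^esub> k" k] by (intro S1.inv_equality[symmetric]) (simp_all add: \<psi>_one \<psi>_closed)

lemma \<psi>_eq_iff: "k \<in> carrier G2 \<Longrightarrow> g \<in> carrier G1 \<Longrightarrow> \<psi> k = g \<longleftrightarrow> k = \<phi> g"
  using \<phi>_\<psi> \<psi>_\<phi> by auto

lemmas \<eta>_linear = rep_iso_inverse(1)[OF \<eta>]
lemmas \<eta>'_linear = rep_iso_inverse(2)[OF \<eta>, folded \<eta>'_def]
lemmas \<eta>_\<eta>' = rep_iso_inverse(3)[OF \<eta>, folded \<eta>'_def]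
lemmas \<eta>'_\<eta> = rep_iso_inverse(4)[OF \<eta>, folded \<eta>'_def]

lemma \<rho>2_\<eta>: "k \<in> carrier G2 \<Longrightarrow> f \<circ> \<rho>2 k \<circ> \<eta> = f \<circ> \<eta> \<circ> \<rho>1 (\<psi> k)"
  using \<eta> \<psi>_closed[of k] \<phi>_\<psi>[of k] by (auto simp: rep_iso_def fun_eq_iff)

lemma length_tr [simp]: "length (tr l) = length l"
  by (simp add: tr_def)

lemma tr_simps: "tr [] = []" "tr (f # l) = (f \<circ> \<eta>) # tr l" "tr (l @ m) = tr l @ tr m"
  by (simp_all add: tr_def)

lemma tr_Nil_iff [simp]: "tr l = [] \<longleftrightarrow> l = []"
  by (simp add: tr_def)

lemma tr_act: "k \<in> carrier G2 \<Longrightarrow> tr (map (\<lambda>f. f \<circ> \<rho>2 k) l) = map (\<lambda>f. f \<circ> \<rho>1 (\<psi> k)) (tr l)"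
  by (simp add: tr_def \<rho>2_\<eta>)

lemma F_apply: "F x (k, l) = (if k \<in> carrier G2 then x (\<psi> k, tr l) else 0)"
  by (simp add: F_def)

lemma FF_apply: "FF t ((k, l), (k', m)) =
    (if k \<in> carrier G2 \<and> k' \<in> carrier G2 then t ((\<psi> k, tr l), (\<psi> k', tr m)) else 0)"
  by (simp add: tensor_map_def F_def)

text \<open>Stated for all functions \<open>t\<close>: the multiplication of the tensor square
  applies \<open>smash_mu\<close> to functions that are not pure tensors.\<close>

lemma smash_mu_FF: "smash_mu G2 \<rho>2 (FF t) = F (smash_mu G1 \<rho>1 t)"
proof (intro ext, clarify)
  fix k and fs :: "('v2 \<Rightarrow> complex) list"
  show "smash_mu G2 \<rho>2 (FF t) (k, fs) = F (smash_mu G1 \<rho>1 t) (k, fs)"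
  proof (cases "k \<in> carrier G2")
    case True
    have "smash_mu G2 \<rho>2 (FF t) (k, fs) = (\<Sum>g\<in>carrier G2. shuffle (\<lambda>(l, m).
        t ((\<psi> g, tr l), (inv\<^bsub>G1\<^esub> \<psi> g \<otimes>\<^bsub>G1\<^esub> \<psi> k, map (\<lambda>f. f \<circ> \<rho>1 (\<psi> g)) (tr m)))) fs)"
      unfolding smash_mu_apply(1)[OF True] using True
      by (intro sum.cong refl) (simp add: FF_apply tr_act \<psi>_mult \<psi>_inv cong: sum.cong)
    also have "\<dots> = (\<Sum>h\<in>carrier G1. shuffle (\<lambda>(l, m).
        t ((h, tr l), (inv\<^bsub>G1\<^esub> h \<otimes>\<^bsub>G1\<^esub> \<psi> k, map (\<lambda>f. f \<circ> \<rho>1 h) (tr m)))) fs)"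
      by (rule sum.reindex_bij_betw[OF \<psi>_bij])
    also have "\<dots> = F (smash_mu G1 \<rho>1 t) (k, fs)"
      using True by (simp add: F_apply smash_mu_apply \<psi>_closed tr_def shuffle_map case_prod_beta')
    finally show ?thesis .
  qed (simp add: F_apply smash_mu_apply)
qed

lemma FF_pure: "FF (pure_tensor a b) = pure_tensor (F a) (F b)"
  by (intro ext) (auto simp: FF_apply F_apply)

lemma F_mult: "F (a \<otimes>\<^bsub>smash_algebra G1 scale1 \<rho>1\<^esub> b) = F a \<otimes>\<^bsub>smash_algebra G2 scale2 \<rho>2\<^esub> F b"
  by (simp add: smash_algebra_def flip: FF_pure smash_mu_FF)

lemma FF_linear: "FF (s + t) = FF s + FF t" "FF (s - t) = FF s - FF t" "FF (fscale c t) = fscale c (FF t)"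
  by (intro ext; clarify; simp add: FF_apply)+

lemma F_linear: "F (x + y) = F x + F y" "F (fscale c x) = fscale c (F x)"
  by (intro ext; clarify; simp add: F_apply)+

lemma FF_mult: "FF (s \<otimes>\<^bsub>smash_tensor G1 scale1 \<rho>1\<^esub> t) = FF s \<otimes>\<^bsub>smash_tensor G2 scale2 \<rho>2\<^esub> FF t"
proof (intro ext, clarify)
  fix k l k' m
  define r where "r x1 x2 = (\<lambda>(y1, y2). (-1) ^ (smash_parity y1 * smash_parity x2) * s (x1, y1) * t (x2, y2))" for x1 x2
  \<comment> \<open>The inner multiplication sees \<open>x1\<close> and \<open>x2\<close> only as
    parameters; the scalar 0 or 1 records that \<open>FF\<close> vanishes when their group elements
    lie outside \<open>G2\<close>.\<close>
  have "(\<lambda>(y1, y2). (-1) ^ (smash_parity y1 * smash_parity x2) * FF s (x1, y1) * FF t (x2, y2)) =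
     fscale (if fst x1 \<in> carrier G2 \<and> fst x2 \<in> carrier G2 then 1 else 0)
       (FF (r (\<psi> (fst x1), tr (snd x1)) (\<psi> (fst x2), tr (snd x2))))" for x1 x2
    by (intro ext, cases x1, cases x2) (auto simp: FF_apply r_def smash_parity_def)
  then have inner: "smash_mu G2 \<rho>2 (\<lambda>(y1, y2). (-1) ^ (smash_parity y1 * smash_parity x2) * FF s (x1, y1) * FF t (x2, y2)) y =
     FF (\<lambda>(x1, x2). F (smash_mu G1 \<rho>1 (r x1 x2)) y) (x1, x2)" for x1 x2 y
    by (cases x1; cases x2) (simp add: smash_mu_scale smash_mu_FF FF_apply)
  have "(FF s \<otimes>\<^bsub>smash_tensor G2 scale2 \<rho>2\<^esub> FF t) ((k, l), (k', m)) =
      smash_mu G2 \<rho>2 (FF (\<lambda>(x1, x2). F (smash_mu G1 \<rho>1 (r x1 x2)) (k', m))) (k, l)"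
    by (simp add: smash_tensor_def super_tensor_mult_def inner)
  also have "\<dots> = FF (s \<otimes>\<^bsub>smash_tensor G1 scale1 \<rho>1\<^esub> t) ((k, l), (k', m))"
    unfolding smash_mu_FF
    by (simp add: F_apply FF_apply smash_tensor_def super_tensor_mult_def r_def smash_mu_zero case_prod_beta')
  finally show "FF (s \<otimes>\<^bsub>smash_tensor G1 scale1 \<rho>1\<^esub> t) ((k, l), (k', m)) =
      (FF s \<otimes>\<^bsub>smash_tensor G2 scale2 \<rho>2\<^esub> FF t) ((k, l), (k', m))" ..
qed

lemma F_at_group:
  assumes "g \<in> carrier G1"
  shows "F (at_group g \<omega>) = at_group (\<phi> g) (\<lambda>l. \<omega> (tr l))"
  using assms by (intro ext) (auto simp: F_apply at_group_def \<psi>_eq_iff \<phi>_closed)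

lemma F_group: "g \<in> carrier G1 \<Longrightarrow> F (smash_group_elem g) = smash_group_elem (\<phi> g)"
  by (simp add: smash_group_elem_def F_at_group) (simp add: ext_one_def)

lemma F_wedge: "g \<in> carrier G1 \<Longrightarrow> F (at_group g (wedge scale1 vs)) = at_group (\<phi> g) (wedge scale2 (map \<eta> vs))"
  using wedge_map[OF \<eta>_linear \<eta>'_linear \<eta>_\<eta>', of vs] by (simp add: F_at_group tr_def)

lemma F_closed:
  assumes "x \<in> smash_carrier G1 scale1"
  shows "F x \<in> smash_carrier G2 scale2"
  using assms[unfolded S1.smash_carrier_span]
proof (induction x rule: fspace.span_induct_alt)
  case base
  have "F 0 = 0" using F_linear(2)[of 0 0] by (simp only: fspace.scale_zero_left)
  then show ?case using fspace.subspace_0[OF subspace_smash_carrier] by (simp only:)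
next
  case (step c s y)
  then obtain g vs where s: "s = at_group g (wedge scale1 vs)" "g \<in> carrier G1" by blast
  then have "F s \<in> smash_carrier G2 scale2"
    by (simp only: F_wedge at_group_mem[OF \<phi>_closed wedge_mem])
  then show ?case
    unfolding F_linear using step.IH
    by (intro fspace.subspace_add[OF subspace_smash_carrier] fspace.subspace_scale[OF subspace_smash_carrier])
qed

lemma F_bij: "bij_betw F (smash_carrier G1 scale1) (smash_carrier G2 scale2)"
proof (rule bij_betw_imageI)
  show "inj_on F (smash_carrier G1 scale1)"
  proof (rule inj_onI, intro ext, clarify)
    fix x y h and l :: "('v1 \<Rightarrow> complex) list"
    assume xy: "x \<in> smash_carrier G1 scale1" "y \<in> smash_carrier G1 scale1" and eq: "F x = F y"
    show "x (h, l) = y (h, l)"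
    proof (cases "h \<in> carrier G1")
      case True
      have "tr (map (\<lambda>f. f \<circ> \<eta>') l) = l"
        unfolding tr_def map_map by (rule map_idI) (simp add: fun_eq_iff \<eta>'_\<eta>)
      then show ?thesis
        using fun_cong[OF eq, of "(\<phi> h, map (\<lambda>f. f \<circ> \<eta>') l)"] True by (simp add: F_apply \<phi>_closed \<psi>_\<phi>)
    qed (simp add: xy S1.smash_carrier_outside)
  qed
  have "y \<in> F ` smash_carrier G1 scale1" if "y \<in> smash_carrier G2 scale2" for y
    using that[unfolded S2.smash_carrier_span]
  proof (induction y rule: fspace.span_induct_alt)
    case base
    have "F 0 = 0" using F_linear(2)[of 0 0] by (simp only: fspace.scale_zero_left)
    then show ?case using fspace.subspace_0[OF subspace_smash_carrier] by (metis image_eqI)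
  next
    case (step c s y)
    then obtain k ws where s: "s = at_group k (wedge scale2 ws)" and k: "k \<in> carrier G2" by blast
    let ?s = "at_group (\<psi> k) (wedge scale1 (map \<eta>' ws))"
    have "map (\<lambda>w. \<eta> (\<eta>' w)) ws = ws" by (rule map_idI) (rule \<eta>_\<eta>')
    then have "F ?s = s"
      using k by (simp add: F_wedge \<psi>_closed \<phi>_\<psi> s comp_def)
    moreover obtain x where x: "x \<in> smash_carrier G1 scale1" "F x = y" using step.IH by blast
    ultimately have "fscale c s + y = F (fscale c ?s + x)" by (simp only: F_linear)
    moreover have "fscale c ?s + x \<in> smash_carrier G1 scale1"
      using x at_group_mem[OF \<psi>_closed[OF k] wedge_mem]
      by (intro fspace.subspace_add[OF subspace_smash_carrier] fspace.subspace_scale[OF subspace_smash_carrier])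
    ultimately show ?case by blast
  qed
  then show "F ` smash_carrier G1 scale1 = smash_carrier G2 scale2"
    using F_closed by blast
qed

lemma FF_emb2: "FF (tensor_map (smash_embed G1) (smash_embed G1) C) =
    tensor_map (smash_embed G2) (smash_embed G2) (\<lambda>(f, f'). C (f \<circ> \<eta>, f' \<circ> \<eta>))"
proof (intro ext, clarify)
  fix k l k' m
  have *: "k \<in> carrier G2 \<and> \<psi> k = \<one>\<^bsub>G1\<^esub> \<longleftrightarrow> k = \<one>\<^bsub>G2\<^esub>" for k
    using \<psi>_eq_iff[of k "\<psi> \<one>\<^bsub>G2\<^esub>"] \<psi>_closed[of "\<one>\<^bsub>G2\<^esub>"] by (auto simp: \<psi>_one \<phi>_\<psi>[of "\<one>\<^bsub>G2\<^esub>", unfolded \<psi>_one])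
  have "FF (tensor_map (smash_embed G1) (smash_embed G1) C) ((k, l), (k', m)) =
    (if (k \<in> carrier G2 \<and> \<psi> k = \<one>\<^bsub>G1\<^esub>) \<and> (k' \<in> carrier G2 \<and> \<psi> k' = \<one>\<^bsub>G1\<^esub>)
     then case (tr l, tr m) of ([f], [f']) \<Rightarrow> C (f, f') | _ \<Rightarrow> 0 else 0)"
    by (simp add: FF_apply tensor_map_smash_embed)
  also have "\<dots> = tensor_map (smash_embed G2) (smash_embed G2) (\<lambda>(f, f'). C (f \<circ> \<eta>, f' \<circ> \<eta>)) ((k, l), (k', m))"
    unfolding * tensor_map_smash_embed by (auto simp: tr_simps split: list.splits)
  finally show "FF (tensor_map (smash_embed G1) (smash_embed G1) C) ((k, l), (k', m)) =
    tensor_map (smash_embed G2) (smash_embed G2) (\<lambda>(f, f'). C (f \<circ> \<eta>, f' \<circ> \<eta>)) ((k, l), (k', m))" .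
qed

lemma \<phi>_one: "\<phi> \<one>\<^bsub>G1\<^esub> = \<one>\<^bsub>G2\<^esub>"
  using \<phi>_\<psi>[OF S2.one_closed] by (simp add: \<psi>_one)

lemma FF_one: "FF \<one>\<^bsub>smash_tensor G1 scale1 \<rho>1\<^esub> = \<one>\<^bsub>smash_tensor G2 scale2 \<rho>2\<^esub>"
  by (simp add: S1.smash_tensor_one S2.smash_tensor_one FF_pure F_group \<phi>_one)

lemma FF_pow: "FF (b [^]\<^bsub>smash_tensor G1 scale1 \<rho>1\<^esub> (n :: nat)) = FF b [^]\<^bsub>smash_tensor G2 scale2 \<rho>2\<^esub> n"
  by (induction n) (simp_all only: S1.T.nat_pow_0 S2.T.nat_pow_0 S1.T.nat_pow_Suc S2.T.nat_pow_Suc FF_one FF_mult)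

lemma FF_exp: "FF (exp_series (smash_tensor G1 scale1 \<rho>1) b) = exp_series (smash_tensor G2 scale2 \<rho>2) (FF b)"
  by (intro ext) (auto simp: exp_series_def FF_apply simp flip: FF_pow)

lemma FF_twist: "FF (twist G1 scale1 \<rho>1 C) = twist G2 scale2 \<rho>2 (\<lambda>(f, f'). C (f \<circ> \<eta>, f' \<circ> \<eta>))"
  by (simp only: twist_def FF_exp FF_emb2)

lemma FF_comult_formula: "FF (smash_comult_formula x) = smash_comult_formula (F x)"
proof (intro ext, clarify)
  fix k k' and l m :: "('v2 \<Rightarrow> complex) list"
  have "\<psi> k = \<psi> k' \<longleftrightarrow> k = k'" if "k \<in> carrier G2" "k' \<in> carrier G2"
    using that by (metis \<phi>_\<psi>)
  then show "FF (smash_comult_formula x) ((k, l), (k', m)) = smash_comult_formula (F x) ((k, l), (k', m))"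
    by (auto simp: FF_apply F_apply smash_comult_formula_def tr_simps)
qed

lemma B'_eq: "tensor_map (vec_map scale2 \<eta>) (vec_map scale2 \<eta>) B1 = B'"
proof -
  have "B1 (f \<circ> \<eta>, f' \<circ> \<eta>) = 0" if "\<not> (f \<in> dual_space scale2 \<and> f' \<in> dual_space scale2)" for f f'
    using that dual_space_comp_iff[OF \<eta>_linear \<eta>'_linear \<eta>_\<eta>'] by (intro tensor_vec_outside[OF S1.B_mem]) blast
  then show ?thesis
    by (intro ext) (auto simp: tensor_map_vec_map B'_def)
qed

lemma B'_mem: "B' \<in> S2.VV"
  using tensor_map_vec_map_mem[OF \<eta>_linear S1.B_mem] by (simp only: B'_eq)

lemma FF_twisted_comult:
  assumes x: "x \<in> smash_carrier G1 scale1"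
  shows "FF (twisted_comult G1 scale1 \<rho>1 B1 x) = twisted_comult G2 scale2 \<rho>2 B' (F x)"
proof -
  have "(\<lambda>(f, f'). (- B1) (f \<circ> \<eta>, f' \<circ> \<eta>)) = - B'"
    by (auto simp: B'_def fun_eq_iff)
  then show ?thesis
    by (simp only: S1.twisted_comult_eq[OF S1.B_mem x] S2.twisted_comult_eq[OF B'_mem F_closed[OF x]]
        FF_mult FF_twist FF_comult_formula B'_def[symmetric])
qed

text \<open>Transport alone leads to the twist by \<open>B'\<close>. Here the invariance of
  \<open>B' - B2\<close> enters, through which both tensors give the same twisted coproduct.\<close>

lemma twisted_comult_B2:
  assumes y: "y \<in> smash_carrier G2 scale2"
  shows "twisted_comult G2 scale2 \<rho>2 B' y = twisted_comult G2 scale2 \<rho>2 B2 y"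
proof -
  have C: "B' - B2 \<in> sym_square_invariants G2 scale2 \<rho>2" using inv by (simp only: B'_eq)
  then have mem: "B' - B2 \<in> S2.VV" by (simp only: sym_square_invariants_def sym_square_def mem_Collect_eq)
  have "twisted_comult G2 scale2 \<rho>2 (B2 + (B' - B2)) y = twisted_comult G2 scale2 \<rho>2 B2 y"
    by (intro S2.twisted_comult_add_central S2.B_mem mem y S2.invariant_comm S2.sym_square_invariants_apply[OF C])
  then show ?thesis by simp
qed

lemma FF_parity_part: "FF (parity_part (\<lambda>(_, z). smash_parity z) i t) = parity_part (\<lambda>(_, z). smash_parity z) i (FF t)"
  by (intro ext) (auto simp: parity_part_def FF_apply smash_parity_def)

lemma F_parity_part: "F (parity_part smash_parity i x) = parity_part smash_parity i (F x)"
  by (intro ext) (auto simp: parity_part_def F_apply smash_parity_def)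

lemma FF_bosonised_comult:
  assumes x: "x \<in> smash_carrier G1 scale1"
  shows "FF (bosonised_comult G1 scale1 \<rho>1 u1 B1 x) = bosonised_comult G2 scale2 \<rho>2 u2 B2 (F x)"
proof -
  have tw: "FF (twisted_comult G1 scale1 \<rho>1 B1 (parity_part smash_parity i x)) =
      twisted_comult G2 scale2 \<rho>2 B2 (parity_part smash_parity i (F x))" for i
    using FF_twisted_comult[OF S1.parity_part_mem[OF x]]
      twisted_comult_B2[OF F_closed[OF S1.parity_part_mem[OF x]]] by (simp only: F_parity_part)
  have u: "F (smash_group_elem u1) = smash_group_elem u2" "F (smash_group_elem \<one>\<^bsub>G1\<^esub>) = smash_group_elem \<one>\<^bsub>G2\<^esub>"
    using S1.u_closed by (simp_all add: F_group \<phi>_u \<phi>_one)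
  have "FF 0 = 0" using FF_linear(3)[of 0 0] by (simp only: fspace.scale_zero_left)
  then have "FF (\<Sum>i\<in>I. h i) = (\<Sum>i\<in>I. FF (h i))" for h and I :: "nat set"
    using sum_comp_morphism[of FF h I] by (simp add: FF_linear comp_def)
  then show ?thesis
    unfolding bosonised_comult_def Let_def
    by (simp only: FF_linear FF_mult FF_parity_part FF_pure tw u)
qed

lemma hopf_iso_F: "hopf_iso (hopf_A G1 scale1 \<rho>1 u1 B1) (hopf_A G2 scale2 \<rho>2 u2 B2) F"
proof -
  have counit: "smash_counit G2 (F x) = smash_counit G1 x" for x
    using sum.reindex_bij_betw[OF \<psi>_bij, of "\<lambda>g. x (g, [])"]
    by (simp add: smash_counit_def F_apply tr_simps cong: sum.cong)
  have "linear_map_on (smash_carrier G1 scale1) F"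
    by (simp only: linear_map_on_def F_linear) blast
  moreover have "F (smash_group_elem \<one>\<^bsub>G1\<^esub>) = smash_group_elem \<one>\<^bsub>G2\<^esub>"
    by (simp add: F_group \<phi>_one)
  ultimately show ?thesis
    unfolding hopf_iso_hopf_A by (simp only: F_bij F_mult counit) (simp add: FF_bosonised_comult)
qed

end

section \<open>Comparison of an isomorphism with its inverse\<close>

locale hopf_hom_pair =
  L: hopf_hom G1 scale1 \<rho>1 u1 B1 G2 scale2 \<rho>2 u2 B2 F + R: hopf_hom G2 scale2 \<rho>2 u2 B2 G1 scale1 \<rho>1 u1 B1 F'
  for G1 :: "('g1, 'm1) monoid_scheme" and scale1 :: "complex \<Rightarrow> 'v1::ab_group_add \<Rightarrow> 'v1"
    and \<rho>1 :: "'g1 \<Rightarrow> 'v1 \<Rightarrow> 'v1" and u1 B1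
    and G2 :: "('g2, 'm2) monoid_scheme" and scale2 :: "complex \<Rightarrow> 'v2::ab_group_add \<Rightarrow> 'v2"
    and \<rho>2 :: "'g2 \<Rightarrow> 'v2 \<Rightarrow> 'v2" and u2 B2 F F' +
  assumes left_inverse: "x \<in> smash_carrier G1 scale1 \<Longrightarrow> F' (F x) = x"
begin

text \<open>\<open>F(g)\<close> agrees with \<open>gmap g\<close> modulo \<open>I\<close>, and the
  degree zero part of its image under \<open>F'\<close> depends only on this class.\<close>

lemma gmap_left_inverse:
  assumes g: "g \<in> carrier G1"
  shows "R.gmap (L.gmap g) = g"
proof -
  note eg = L.S1.group_elem_mem[OF g] and gm = L.gmap_closed[OF g]
  have "vanishing 1 (F (smash_group_elem g) - smash_group_elem (L.gmap g))"
    by (simp add: vanishing_def L.F_group_Nil[OF g] smash_group_elem_def[of "L.gmap g"] at_group_def ext_one_def)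
  then have "F' (F (smash_group_elem g)) (g, []) = F' (smash_group_elem (L.gmap g)) (g, [])"
    by (rule R.F_eq_below[OF L.F_closed[OF eg] L.S2.group_elem_mem[OF gm]]) simp
  then have "(1 :: complex) = (if g = R.gmap (L.gmap g) then 1 else 0)"
    unfolding left_inverse[OF eg] R.F_group_Nil[OF gm] by (simp add: smash_group_elem_def at_group_def ext_one_def)
  then show ?thesis by (simp split: if_splits)
qed

text \<open>The same argument modulo \<open>I^2\<close>, read off in degree one.\<close>

lemma vmap_left_inverse: "R.vmap (L.vmap v) = v"
proof (rule L.S1.vec_inject)
  fix f
  let ?x = "smash_embed G1 (vec scale1 v)"
  have "vanishing 2 (F ?x - smash_embed G2 (vec scale2 (L.vmap v)))"
    unfolding vanishing_def length_less_2
    by (auto simp: L.F_vec_Nil L.F_vec_single smash_embed_def[of G2] at_group_def ext_embed_def)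
  then have "F' (F ?x) (\<one>\<^bsub>G1\<^esub>, [f]) = F' (smash_embed G2 (vec scale2 (L.vmap v))) (\<one>\<^bsub>G1\<^esub>, [f])"
    by (rule R.F_eq_below[OF L.F_closed[OF L.S1.embed_mem] L.S2.embed_mem]) simp
  then have "?x (\<one>\<^bsub>G1\<^esub>, [f]) = F' (smash_embed G2 (vec scale2 (L.vmap v))) (\<one>\<^bsub>G1\<^esub>, [f])"
    by (simp only: left_inverse[OF L.S1.embed_mem])
  then show "vec scale1 (R.vmap (L.vmap v)) f = vec scale1 v f"
    unfolding R.F_vec_single by (simp add: smash_embed_def at_group_def ext_embed_def)
qed

end

context hopf_hom
begin

lemma hopf_hom_inverse:
  assumes bij: "bij_betw F (smash_carrier G1 scale1) (smash_carrier G2 scale2)"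
  shows "hopf_hom G2 scale2 \<rho>2 u2 B2 G1 scale1 \<rho>1 u1 B1 (inv_into (smash_carrier G1 scale1) F)"
proof -
  let ?F' = "inv_into C1 F"
  have img: "\<exists>x\<in>C1. y = F x" if "y \<in> C2" for y
    using bij that by (auto simp: bij_betw_def)
  have left: "?F' (F x) = x" if "x \<in> C1" for x
    using bij that by (simp add: bij_betw_def inv_into_f_f)
  have F_add: "F (x + y) = F x + F y" and F_scale: "F (fscale c x) = fscale c (F x)" if "x \<in> C1" "y \<in> C1" for x y c
    using F_linear that unfolding linear_map_on_def by blast+
  have lin: "linear_map_on C2 ?F'"
    unfolding linear_map_on_def
  proof (intro conjI ballI allI)
    fix a b c assume "a \<in> C2" "b \<in> C2"
    then obtain x y where "a = F x" "b = F y" and xy: "x \<in> C1" "y \<in> C1" using img by blast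
    then show "?F' (a + b) = ?F' a + ?F' b"
      using fspace.subspace_add[OF subspace_smash_carrier xy] by (simp only: F_add[symmetric] left)
  next
    fix a c assume "a \<in> C2"
    then obtain x where "a = F x" and x: "x \<in> C1" using img by blast
    then show "?F' (fscale c a) = fscale c (?F' a)"
      using fspace.subspace_scale[OF subspace_smash_carrier x, of c] by (simp only: F_scale[OF x x, symmetric] left)
  qed
  \<comment> \<open>Compatibility of the inverse with coproducts needs
    \<open>F' \<otimes> F'\<close> to undo \<open>F \<otimes> F\<close> on tensors.\<close>
  have tensor: "tensor_map ?F' ?F' (tensor_map F F t) = t" if "t \<in> carrier (smash_tensor G1 scale1 \<rho>1)" for t
  proof -
    have lin2: "linear_map_on (tensor_space C2 C2) (tensor_map ?F' ?F')"
      by (rule tensor_map_linear[OF subspace_smash_carrier subspace_smash_carrier lin lin])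
    \<comment> \<open>The membership claims are carried through the induction because both tensor
      maps are linear only on the respective tensor spaces.\<close>
    have "t \<in> carrier (smash_tensor G1 scale1 \<rho>1) \<and> tensor_map F F t \<in> tensor_space C2 C2 \<and>
        tensor_map ?F' ?F' (tensor_map F F t) = t"
      using that unfolding S1.smash_tensor_carrier tensor_space_def[of C1]
    proof (induction t rule: fspace.span_induct_alt)
      case base
      have "tensor_map ?F' ?F' 0 = 0"
        using fspace_lincomb_zero[OF lin2 fspace.subspace_0[OF subspace_tensor_space]] .
      then show ?case
        unfolding tensor_F_zero by (intro conjI fspace.subspace_0[OF subspace_tensor_space] fspace.span_zero)
    next
      case (step c s t)
      then obtain a b where s: "s = pure_tensor a b" and ab: "a \<in> C1" "b \<in> C1" by blast
      have mem: "s \<in> carrier (smash_tensor G1 scale1 \<rho>1)" "t \<in> carrier (smash_tensor G1 scale1 \<rho>1)"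
        using pure_T1[OF ab] step.IH by (simp_all only: s S1.smash_tensor_carrier tensor_space_def)
      have FF: "tensor_map F F (fscale c s + t) = fscale c (pure_tensor (F a) (F b)) + tensor_map F F t"
        using mem by (simp only: tensor_F_add S1.T.carrier_scale tensor_F_scale) (simp only: s tensor_F_pure[OF ab])
      have p: "pure_tensor (F a) (F b) \<in> tensor_space C2 C2"
        using ab by (intro pure_tensor_mem F_closed)
      have cp: "fscale c (pure_tensor (F a) (F b)) \<in> tensor_space C2 C2"
        by (rule fspace.subspace_scale[OF subspace_tensor_space p])
      have t: "tensor_map F F t \<in> tensor_space C2 C2" "tensor_map ?F' ?F' (tensor_map F F t) = t"
        using step.IH by (simp_all only:)
      have "tensor_map ?F' ?F' (tensor_map F F (fscale c s + t)) =
          tensor_map ?F' ?F' (fscale c (pure_tensor (F a) (F b))) + tensor_map ?F' ?F' (tensor_map F F t)"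
        unfolding FF using lin2 cp t(1) unfolding linear_map_on_def by blast
      also have "tensor_map ?F' ?F' (fscale c (pure_tensor (F a) (F b))) = fscale c (tensor_map ?F' ?F' (pure_tensor (F a) (F b)))"
        using lin2 p unfolding linear_map_on_def by blast
      also have "tensor_map ?F' ?F' (pure_tensor (F a) (F b)) = s"
        using tensor_map_pure_tensor[OF lin lin F_closed[OF ab(1)] F_closed[OF ab(2)]] by (simp only: left[OF ab(1)] left[OF ab(2)] s)
      finally have inv: "tensor_map ?F' ?F' (tensor_map F F (fscale c s + t)) = fscale c s + t"
        by (simp only: t(2))
      have FF_mem: "tensor_map F F (fscale c s + t) \<in> tensor_space C2 C2"
        unfolding FF by (rule fspace.subspace_add[OF subspace_tensor_space cp t(1)])
      have "fscale c s + t \<in> carrier (smash_tensor G1 scale1 \<rho>1)"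
        using mem by (intro S1.T.carrier_add S1.T.carrier_scale)
      then show ?case
        unfolding S1.smash_tensor_carrier tensor_space_def[of C1] using FF_mem inv by (intro conjI)
    qed
    then show ?thesis by blast
  qed
  show ?thesis
  proof (unfold_locales, fact lin)
    show "?F' (smash_group_elem \<one>\<^bsub>G2\<^esub>) = smash_group_elem \<one>\<^bsub>G1\<^esub>"
      using left[OF S1.group_elem_mem[OF S1.one_closed]] by (simp only: F_one)
    fix x y assume "x \<in> C2" "y \<in> C2"
    then obtain a b where x: "x = F a" and y: "y = F b" and ab: "a \<in> C1" "b \<in> C1" using img by blast
    show "?F' x \<in> C1" by (simp only: x left ab)
    show "?F' (x \<otimes>\<^bsub>smash_algebra G2 scale2 \<rho>2\<^esub> y) = ?F' x \<otimes>\<^bsub>smash_algebra G1 scale1 \<rho>1\<^esub> ?F' y"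
      by (simp only: x y left ab F_mult[symmetric] S1.smash_mult_closed)
    show "bosonised_comult G1 scale1 \<rho>1 u1 B1 (?F' x) = tensor_map ?F' ?F' (bosonised_comult G2 scale2 \<rho>2 u2 B2 x)"
      by (simp only: x left ab F_comult tensor S1.D_closed)
    show "smash_counit G1 (?F' x) = smash_counit G2 x"
      by (simp only: x left ab F_counit)
  qed
qed

end

theorem proposition2p1:
  fixes G\<^sub>1 :: "('g1, 'm1) monoid_scheme" and G\<^sub>2 :: "('g2, 'm2) monoid_scheme"
    and scale\<^sub>1 :: "complex \<Rightarrow> 'v1::ab_group_add \<Rightarrow> 'v1"
    and scale\<^sub>2 :: "complex \<Rightarrow> 'v2::ab_group_add \<Rightarrow> 'v2"
    and \<rho>\<^sub>1 :: "'g1 \<Rightarrow> 'v1 \<Rightarrow> 'v1" and \<rho>\<^sub>2 :: "'g2 \<Rightarrow> 'v2 \<Rightarrow> 'v2"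
    and u\<^sub>1 :: 'g1 and u\<^sub>2 :: 'g2
    and B\<^sub>1 :: "('v1 \<Rightarrow> complex) \<times> ('v1 \<Rightarrow> complex) \<Rightarrow> complex"
    and B\<^sub>2 :: "('v2 \<Rightarrow> complex) \<times> ('v2 \<Rightarrow> complex) \<Rightarrow> complex"
  assumes "finite_group_rep G\<^sub>1 scale\<^sub>1 \<rho>\<^sub>1" and "finite_group_rep G\<^sub>2 scale\<^sub>2 \<rho>\<^sub>2"
    and "\<exists>v::'v1. v \<noteq> 0" and "\<exists>v::'v2. v \<noteq> 0"
    and "u\<^sub>1 \<in> carrier G\<^sub>1" and "\<forall>g\<in>carrier G\<^sub>1. g \<otimes>\<^bsub>G\<^sub>1\<^esub> u\<^sub>1 = u\<^sub>1 \<otimes>\<^bsub>G\<^sub>1\<^esub> g"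
    and "group.ord G\<^sub>1 u\<^sub>1 = 2" and "\<forall>v. \<rho>\<^sub>1 u\<^sub>1 v = - v"
    and "u\<^sub>2 \<in> carrier G\<^sub>2" and "\<forall>g\<in>carrier G\<^sub>2. g \<otimes>\<^bsub>G\<^sub>2\<^esub> u\<^sub>2 = u\<^sub>2 \<otimes>\<^bsub>G\<^sub>2\<^esub> g"
    and "group.ord G\<^sub>2 u\<^sub>2 = 2" and "\<forall>v. \<rho>\<^sub>2 u\<^sub>2 v = - v"
    and "B\<^sub>1 \<in> sym_square scale\<^sub>1" and "B\<^sub>2 \<in> sym_square scale\<^sub>2"
  shows "(\<exists>F. hopf_iso (hopf_A G\<^sub>1 scale\<^sub>1 \<rho>\<^sub>1 u\<^sub>1 B\<^sub>1) (hopf_A G\<^sub>2 scale\<^sub>2 \<rho>\<^sub>2 u\<^sub>2 B\<^sub>2) F) \<longleftrightarrow>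
         (\<exists>\<phi> \<eta>. \<phi> \<in> iso G\<^sub>1 G\<^sub>2 \<and> \<phi> u\<^sub>1 = u\<^sub>2 \<and>
            rep_iso G\<^sub>1 scale\<^sub>1 \<rho>\<^sub>1 scale\<^sub>2 (\<rho>\<^sub>2 \<circ> \<phi>) \<eta> \<and>
            tensor_map (vec_map scale\<^sub>2 \<eta>) (vec_map scale\<^sub>2 \<eta>) B\<^sub>1 - B\<^sub>2
              \<in> sym_square_invariants G\<^sub>2 scale\<^sub>2 \<rho>\<^sub>2)"
    (is "?L \<longleftrightarrow> ?R")
proof -
  interpret S1: twisted_supergroup G\<^sub>1 scale\<^sub>1 \<rho>\<^sub>1 u\<^sub>1 B\<^sub>1
    using assms by (simp add: twisted_supergroup_def twisted_supergroup_axioms_def)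
  interpret S2: twisted_supergroup G\<^sub>2 scale\<^sub>2 \<rho>\<^sub>2 u\<^sub>2 B\<^sub>2
    using assms by (simp add: twisted_supergroup_def twisted_supergroup_axioms_def)
  show ?thesis
  proof
    assume ?R
    then obtain \<phi> \<eta> where "transport G\<^sub>1 scale\<^sub>1 \<rho>\<^sub>1 u\<^sub>1 B\<^sub>1 G\<^sub>2 scale\<^sub>2 \<rho>\<^sub>2 u\<^sub>2 B\<^sub>2 \<phi> \<eta>"
      unfolding transport_def transport_axioms_def
      using S1.twisted_supergroup_axioms S2.twisted_supergroup_axioms by blast
    then show ?L by (blast dest: transport.hopf_iso_F)
  next
    assume ?L
    then obtain F where F: "hopf_iso (hopf_A G\<^sub>1 scale\<^sub>1 \<rho>\<^sub>1 u\<^sub>1 B\<^sub>1) (hopf_A G\<^sub>2 scale\<^sub>2 \<rho>\<^sub>2 u\<^sub>2 B\<^sub>2) F" ..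
    have bij: "bij_betw F (smash_carrier G\<^sub>1 scale\<^sub>1) (smash_carrier G\<^sub>2 scale\<^sub>2)"
      using F unfolding hopf_iso_hopf_A by blast
    interpret H: hopf_hom G\<^sub>1 scale\<^sub>1 \<rho>\<^sub>1 u\<^sub>1 B\<^sub>1 G\<^sub>2 scale\<^sub>2 \<rho>\<^sub>2 u\<^sub>2 B\<^sub>2 F
      using F bij_betw_apply[OF bij] unfolding hopf_iso_hopf_A by unfold_locales blast+
    define F' where "F' = inv_into (smash_carrier G\<^sub>1 scale\<^sub>1) F"
    interpret H': hopf_hom G\<^sub>2 scale\<^sub>2 \<rho>\<^sub>2 u\<^sub>2 B\<^sub>2 G\<^sub>1 scale\<^sub>1 \<rho>\<^sub>1 u\<^sub>1 B\<^sub>1 F'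
      unfolding F'_def by (rule H.hopf_hom_inverse[OF bij])
    interpret P: hopf_hom_pair G\<^sub>1 scale\<^sub>1 \<rho>\<^sub>1 u\<^sub>1 B\<^sub>1 G\<^sub>2 scale\<^sub>2 \<rho>\<^sub>2 u\<^sub>2 B\<^sub>2 F F'
      by unfold_locales (use bij in \<open>simp add: F'_def bij_betw_def inv_into_f_f\<close>)
    interpret Q: hopf_hom_pair G\<^sub>2 scale\<^sub>2 \<rho>\<^sub>2 u\<^sub>2 B\<^sub>2 G\<^sub>1 scale\<^sub>1 \<rho>\<^sub>1 u\<^sub>1 B\<^sub>1 F' F
      by unfold_locales (use bij in \<open>auto simp: F'_def bij_betw_def f_inv_into_f\<close>)
    let ?\<phi> = H.gmap and ?\<eta> = H.vmap
    have iso: "?\<phi> \<in> iso G\<^sub>1 G\<^sub>2"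
    proof (rule isoI)
      show "?\<phi> \<in> hom G\<^sub>1 G\<^sub>2"
        by (intro homI H.gmap_closed H.gmap_mult)
      show "bij_betw ?\<phi> (carrier G\<^sub>1) (carrier G\<^sub>2)"
        by (rule bij_betw_byWitness[where f' = H'.gmap])
          (auto simp: P.gmap_left_inverse Q.gmap_left_inverse H.gmap_closed H'.gmap_closed)
    qed
    \<comment> \<open>A nonzero vector has nonzero image, since \<open>H'.vmap\<close> is linear and
      undoes \<open>?\<eta>\<close>; this is what \<open>gmap_u\<close> requires.\<close>
    obtain v :: 'v1 where "v \<noteq> 0" using assms(3) by blast
    have "module_hom scale\<^sub>2 scale\<^sub>1 H'.vmap"
      using H'.vmap_linear by (simp add: Vector_Spaces.linear_def)
    then have "H'.vmap 0 = 0" by (rule module_hom.zero)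
    then have "?\<eta> v \<noteq> 0"
      using P.vmap_left_inverse[of v] \<open>v \<noteq> 0\<close> by auto
    then have u: "?\<phi> u\<^sub>1 = u\<^sub>2" by (rule H.gmap_u)
    have "bij ?\<eta>"
      by (rule o_bij[of H'.vmap]) (simp_all add: fun_eq_iff P.vmap_left_inverse Q.vmap_left_inverse)
    then have \<eta>: "rep_iso G\<^sub>1 scale\<^sub>1 \<rho>\<^sub>1 scale\<^sub>2 (\<rho>\<^sub>2 \<circ> ?\<phi>) ?\<eta>"
      by (simp add: rep_iso_def H.vmap_linear H.vmap_equivariant)
    let ?B = "tensor_map (vec_map scale\<^sub>2 ?\<eta>) (vec_map scale\<^sub>2 ?\<eta>) B\<^sub>1"
    have "?B \<in> S2.VV"
      by (rule tensor_map_vec_map_mem[OF H.vmap_linear S1.B_mem])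
    then have sym: "?B - B\<^sub>2 \<in> sym_square scale\<^sub>2"
      using S2.VV_closed(3)[OF _ S2.B_mem]
      by (simp add: sym_square_def tensor_map_vec_map S1.B_swap S2.B_swap)
    have "?B - B\<^sub>2 \<in> sym_square_invariants G\<^sub>2 scale\<^sub>2 \<rho>\<^sub>2"
    proof (rule S2.sym_square_invariantsI[OF sym])
      fix k f f' assume k: "k \<in> carrier G\<^sub>2" and f: "f \<in> dual_space scale\<^sub>2" "f' \<in> dual_space scale\<^sub>2"
      \<comment> \<open>\<open>B_invariance\<close> speaks of images of elements of the first group;
        surjectivity writes \<open>k\<close> as one of them.\<close>
      define g where "g = H'.gmap k"
      have g: "g \<in> carrier G\<^sub>1" "?\<phi> g = k"
        using k by (simp_all add: g_def H'.gmap_closed Q.gmap_left_inverse)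
      have dual: "f \<circ> \<rho>\<^sub>2 k \<in> dual_space scale\<^sub>2" if "f \<in> dual_space scale\<^sub>2" for f
        using that Vector_Spaces.linear_compose[OF S2.rep_linear[OF k]] by (simp add: dual_space_def)
      \<comment> \<open>Equivariance moves the action from the first space to the second, so the
        values of \<open>B\<^sub>1\<close> become values of its image under
        \<open>?\<eta> \<otimes> ?\<eta>\<close> at the transformed functionals.\<close>
      have comp: "f \<circ> ?\<eta> \<circ> \<rho>\<^sub>1 g = f \<circ> \<rho>\<^sub>2 k \<circ> ?\<eta>" for f :: "'v2 \<Rightarrow> complex"
        using g by (simp add: fun_eq_iff H.vmap_equivariant)
      show "(?B - B\<^sub>2) (f \<circ> \<rho>\<^sub>2 k, f' \<circ> \<rho>\<^sub>2 k) = (?B - B\<^sub>2) (f, f')"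
        using H.B_invariance[OF u g(1) f] f dual
        unfolding g(2) comp by (simp add: tensor_map_vec_map algebra_simps)
    qed
    with iso u \<eta> show ?R by blast
  qed
qed

end
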